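(* Let $\pi$ be a probability distribution on $[q]^n$. For every integer $h\ge 1$ with $h^{2h}\le n$, there exists an algorithm that, given oracle access to the conditional marginals $\pi_i(\cdot\mid X_S)$ of $\pi$ through density queries and sampling queries (defined in the context), outputs a sample distributed exactly according to $\pi$, such that the expected number of rounds is $O\big(n^{\frac12+\frac1{2h}}h^2\log n\sqrt{\log q}\big)$ and the expected number of queries is $O(nh)$. Moreover, for any $\epsilon>0$, with probability at least $1-\epsilon$ the number of rounds is at most $$O\Big(n^{\frac12+\frac1{2h}}\big(h^2\log n\sqrt{\log q}+(4h)^h\log^h(n/\epsilon)\big)\cdot\log(1/\epsilon)\Big).$$
   Context: Density query: given $S\subseteq[n]$, an index $i\notin S$, a configuration $x_S\in[q]^S$ with $\Pr_{X\sim\pi}[X_S=x_S]>0$, and $x_i\in[q]$, the oracle returns $\pi_i(x_i\mid X_S=x_S)=\Pr_{X\sim\pi}[X_i=x_i\mid X_S=x_S]$. Sampling query: given $S\subseteq[n]$, $i\notin S$ and $x_S\in[q]^S$ with $\Pr_{X\sim\pi}[X_S=x_S]>0$, the oracle returns a sample $x_i\sim\pi_i(\cdot\mid X_S=x_S)$. The algorithm interacts with the oracles in rounds: in each round it may send any number of queries in parallel, which may depend only on answers from previous rounds. The number of rounds is the number of such sequential rounds; the number of queries is the total number of queries issued.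
   Formalization: log n and the last factor log(1/ε) are replaced by their maximum with 1 (the bounds would vanish at n=1 or as ε→1); queries conditioning on a zero-probability event are allowed, answered from an arbitrary fixed distribution on [q]. *)

theory Defs
  imports "HOL-Probability.Probability" "HOL-Probability.SPMF"
begin

text \<open>
  Coordinates are \<open>{1..n}\<close>, letters are \<open>{1..q}\<close>, and a (partial) configuration in \<open>[q]^S\<close> is an
  extensional function, so that the projection \<open>X_S\<close> of a configuration \<open>X\<close> is \<open>restrict X S\<close>.
\<close>

definition configs :: "nat \<Rightarrow> nat set \<Rightarrow> (nat \<Rightarrow> nat) set" where
  "configs q S = S \<rightarrow>\<^sub>E {1..q}"

definition distribution_on_configs :: "nat \<Rightarrow> nat \<Rightarrow> (nat \<Rightarrow> nat) pmf \<Rightarrow> bool" where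
  "distribution_on_configs n q \<pi> \<longleftrightarrow> set_pmf \<pi> \<subseteq> configs q {1..n}"

datatype query =
    Density "nat set" nat "nat \<Rightarrow> nat" nat  \<comment> \<open>\<open>S\<close>, \<open>i\<close>, \<open>x_S\<close>, \<open>x_i\<close>\<close>
  | Sampling "nat set" nat "nat \<Rightarrow> nat"     \<comment> \<open>\<open>S\<close>, \<open>i\<close>, \<open>x_S\<close>\<close>

datatype answer = Probability real | Letter nat

fun valid_query :: "nat \<Rightarrow> nat \<Rightarrow> query \<Rightarrow> bool" where
  "valid_query n q (Density S i x a) \<longleftrightarrow>
     S \<subseteq> {1..n} \<and> i \<in> {1..n} - S \<and> x \<in> configs q S \<and> a \<in> {1..q}"
| "valid_query n q (Sampling S i x) \<longleftrightarrow>
     S \<subseteq> {1..n} \<and> i \<in> {1..n} - S \<and> x \<in> configs q S"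

text \<open>
  \<open>\<kappa> S i x\<close> is the law of \<open>X_i\<close> given \<open>X_S = x\<close>. It is determined by \<open>\<pi>\<close> only when
  \<open>X_S = x\<close> has positive probability. An algorithm that speculates on the value of \<open>X_S\<close> cannot
  know in advance whether this is the case, so such queries are not forbidden, but nothing is promised
  about them: \<open>\<kappa> S i x\<close> is then an arbitrary distribution on the letters (as for any version of a
  conditional distribution), and the algorithm has to be correct and efficient for every choice
  of it. In particular the oracle does not reveal whether a conditioning event is null.
\<close>

definition conditional_marginals ::
    "nat \<Rightarrow> nat \<Rightarrow> (nat \<Rightarrow> nat) pmf \<Rightarrow> (nat set \<Rightarrow> nat \<Rightarrow> (nat \<Rightarrow> nat) \<Rightarrow> nat pmf) \<Rightarrow> bool" where
  "conditional_marginals n q \<pi> \<kappa> \<longleftrightarrow>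
     (\<forall>S i x. S \<subseteq> {1..n} \<longrightarrow> i \<in> {1..n} - S \<longrightarrow> x \<in> configs q S \<longrightarrow>
        set_pmf (\<kappa> S i x) \<subseteq> {1..q} \<and>
        (measure_pmf.prob \<pi> {X. restrict X S = x} > 0 \<longrightarrow>
           \<kappa> S i x = map_pmf (\<lambda>X. X i) (cond_pmf \<pi> {X. restrict X S = x})))"

fun oracle_answer :: "(nat set \<Rightarrow> nat \<Rightarrow> (nat \<Rightarrow> nat) \<Rightarrow> nat pmf) \<Rightarrow> query \<Rightarrow> answer pmf" where
  "oracle_answer \<kappa> (Density S i x a) = return_pmf (Probability (pmf (\<kappa> S i x) a))"
| "oracle_answer \<kappa> (Sampling S i x) = map_pmf Letter (\<kappa> S i x)"

text \<open>The queries of one round are answered independently, repeated ones included.\<close>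

primrec oracle_answers ::
    "(nat set \<Rightarrow> nat \<Rightarrow> (nat \<Rightarrow> nat) \<Rightarrow> nat pmf) \<Rightarrow> query list \<Rightarrow> answer list pmf" where
  "oracle_answers \<kappa> [] = return_pmf []"
| "oracle_answers \<kappa> (Q # Qs) =
     bind_pmf (oracle_answer \<kappa> Q) (\<lambda>r. map_pmf ((#) r) (oracle_answers \<kappa> Qs))"

text \<open>
  A randomized algorithm is a possibly infinite interaction tree. At each node it tosses coins and
  then either stops with an output or issues one round of parallel queries, its continuation
  depending on the list of answers. The distribution \<open>\<pi>\<close> is accessible only through these answers.
\<close>

datatype 'k action =
    Output "nat \<Rightarrow> nat"
  | Round "query list" "answer list \<Rightarrow> 'k"

codatatype algorithm = Algorithm "algorithm action pmf"

coinductive valid_algorithm :: "nat \<Rightarrow> nat \<Rightarrow> algorithm \<Rightarrow> bool" for n q where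
  "(\<And>Qs c. Round Qs c \<in> set_pmf p \<Longrightarrow>
      (\<forall>Q\<in>set Qs. valid_query n q Q) \<and> (\<forall>rs. valid_algorithm n q (c rs)))
   \<Longrightarrow> valid_algorithm n q (Algorithm p)"

text \<open>
  The joint law of the output, the number of rounds and the number of queries; the mass missing
  from this subprobability is the probability of never stopping.
\<close>

partial_function (spmf) run ::
    "(nat set \<Rightarrow> nat \<Rightarrow> (nat \<Rightarrow> nat) \<Rightarrow> nat pmf) \<Rightarrow> algorithm \<Rightarrow> ((nat \<Rightarrow> nat) \<times> nat \<times> nat) spmf" where
  "run \<kappa> A = (case A of Algorithm p \<Rightarrow>
     bind_spmf (spmf_of_pmf p) (\<lambda>act.
       case act of
         Output x \<Rightarrow> return_spmf (x, 0, 0)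
       | Round Qs c \<Rightarrow>
           bind_spmf (spmf_of_pmf (oracle_answers \<kappa> Qs)) (\<lambda>rs.
             map_spmf (\<lambda>(x, r, m). (x, Suc r, length Qs + m)) (run \<kappa> (c rs)))))"

definition exact_sampler_for ::
    "(nat \<Rightarrow> nat) pmf \<Rightarrow> (nat set \<Rightarrow> nat \<Rightarrow> (nat \<Rightarrow> nat) \<Rightarrow> nat pmf) \<Rightarrow> algorithm \<Rightarrow> bool" where
  "exact_sampler_for \<pi> \<kappa> A \<longleftrightarrow> map_spmf (\<lambda>(x, r, m). x) (run \<kappa> A) = spmf_of_pmf \<pi>"

definition expected_rounds ::
    "(nat set \<Rightarrow> nat \<Rightarrow> (nat \<Rightarrow> nat) \<Rightarrow> nat pmf) \<Rightarrow> algorithm \<Rightarrow> ennreal" where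
  "expected_rounds \<kappa> A = (\<integral>\<^sup>+ (x, r, m). of_nat r \<partial>measure_spmf (run \<kappa> A))"

definition expected_queries ::
    "(nat set \<Rightarrow> nat \<Rightarrow> (nat \<Rightarrow> nat) \<Rightarrow> nat pmf) \<Rightarrow> algorithm \<Rightarrow> ennreal" where
  "expected_queries \<kappa> A = (\<integral>\<^sup>+ (x, r, m). of_nat m \<partial>measure_spmf (run \<kappa> A))"

definition prob_rounds_le ::
    "(nat set \<Rightarrow> nat \<Rightarrow> (nat \<Rightarrow> nat) \<Rightarrow> nat pmf) \<Rightarrow> algorithm \<Rightarrow> real \<Rightarrow> real" where
  "prob_rounds_le \<kappa> A b = measure (measure_spmf (run \<kappa> A)) {(x, r, m). real r \<le> b}"

text \<open>
  Natural logarithm, truncated from below at 1. Inside an \<open>O\<close>-bound this differs from \<open>ln\<close> by a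
  constant factor as long as the argument stays away from 1. The untruncated factors \<open>log n\<close> and
  \<open>log (1/\<epsilon>)\<close> would make the bounds vanish for \<open>n = 1\<close> and \<open>\<epsilon> \<rightarrow> 1\<close>, where no algorithm meets them if \<open>q \<ge> 2\<close>.
\<close>

definition tlog :: "real \<Rightarrow> real" where
  "tlog x = max 1 (ln x)"

end

(*
  Coordinates are revealed in a uniformly random order. A block of coordinates is drafted in one
  round from the product of its conditional marginals given the pinned coordinates, and compared with
  the true chain: the fraction of the true mass matched by the draft obeys p' = min 1 (p * mu / nu), and
  the true chain stops where it leaves the matched part. The law of this stopped chain is produced from
  the rejected draft by a race: walking back along the draft, a coordinate is resampled with probability p
  and kept if it lands in the unmatched part, and given up with probability 1 - p. Without success, the
  coordinates tested are determined by the coins of the algorithm alone, so the tests run in batches of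
  doubling size, while their expected number is at most the length of the block.

  A block is rejected with probability O(alpha + KL / alpha) for every alpha > 0, where KL is the relative
  entropy of the block with respect to the product of its marginals. Blocks are aligned to the powers
  b^k, k < h, with b about n^(1/(2h)), each attempt using the largest aligned block. So every aligned block
  is attempted at most once, which gives O(n h) queries. In random order the conditional entropies decrease, so
  the KL terms of one level telescope, and O(sqrt(n log q)) attempts of one level fail; each
  failure costs at most (h - 1) b further attempts to climb back to the top level.

  The remaining cost is bounded uniformly over all states, which makes the number of rounds an
  exponentially tailed variable on that scale.
*)
theory Submission
  imports Defs
begin

section \<open>Algorithms that alternate sampling rounds and density rounds\<close>

text \<open>All bounds come from potentials with values in \<open>ennreal\<close>, which give
  inequalities in one direction only. Exactness is recovered from them: an output \<open>x\<close>
  appears with probability at most \<open>pmf \<pi> x\<close>, and almost sure termination leaves no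
  room for a deficit. The race has the right law because of one pointwise identity: the draft and
  the true law scaled by p share the mass min(nu, p * mu). So the mass a draft step loses is what
  leaves now plus what had left before, in the proportions of the coins of the race. Once the draft
  enters a null configuration, p is 0 and no test is made there, so infinite potentials on null
  configurations do no harm. The obstacle to the tail bound is that the number of tests is
  controlled in mean only. About log n batches are prepaid at each rejection; a later batch has at
  least n tests and is paid by a price per test so small that all blocks can afford it. The additive
  potential is scaled to at most 1/2, so that one plus twice its value shrinks on average by the
  factor 1 + \<eta> in every pair of rounds; this scaling determines \<eta>.\<close>

primcorec unfold_algorithm :: "('s \<Rightarrow> 's action pmf) \<Rightarrow> 's \<Rightarrow> algorithm" where
  "unfold_algorithm step s = Algorithm (map_pmf (map_action (unfold_algorithm step)) (step s))"

lemma run_unfold_algorithm: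
  "run \<kappa> (unfold_algorithm step s) =
     bind_pmf (step s) (\<lambda>act. case act of
         Output x \<Rightarrow> return_spmf (x, 0, 0)
       | Round Qs c \<Rightarrow> bind_pmf (oracle_answers \<kappa> Qs) (\<lambda>rs.
           map_spmf (\<lambda>(x, r, m). (x, Suc r, length Qs + m))
             (run \<kappa> (unfold_algorithm step (c rs)))))"
proof -
  have "run \<kappa> (unfold_algorithm step s) =
    bind_pmf (step s) (\<lambda>act. case map_action (unfold_algorithm step) act of
         Output x \<Rightarrow> return_spmf (x, 0, 0)
       | Round Qs c \<Rightarrow> bind_pmf (oracle_answers \<kappa> Qs) (\<lambda>rs.
           map_spmf (\<lambda>(x, r, m). (x, Suc r, length Qs + m)) (run \<kappa> (c rs))))"
    by (subst run.simps, subst unfold_algorithm.code)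
       (simp add: bind_map_pmf)
  also have "\<dots> = bind_pmf (step s) (\<lambda>act. case act of
         Output x \<Rightarrow> return_spmf (x, 0, 0)
       | Round Qs c \<Rightarrow> bind_pmf (oracle_answers \<kappa> Qs) (\<lambda>rs.
           map_spmf (\<lambda>(x, r, m). (x, Suc r, length Qs + m))
             (run \<kappa> (unfold_algorithm step (c rs)))))"
    by (intro bind_pmf_cong refl) (auto split: action.split)
  finally show ?thesis .
qed

text \<open>The invariant must survive every list of answers, also lists that no oracle returns,
  because \<open>valid_algorithm\<close> ranges over all continuations.\<close>

lemma valid_unfold_algorithm:
  assumes "I s"
    and "\<And>s Qs c. I s \<Longrightarrow> Round Qs c \<in> set_pmf (step s) \<Longrightarrow>
      (\<forall>Q\<in>set Qs. valid_query n q Q) \<and> (\<forall>rs. I (c rs))"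
  shows "valid_algorithm n q (unfold_algorithm step s)"
proof -
  have "\<exists>s. A = unfold_algorithm step s \<and> I s \<Longrightarrow> valid_algorithm n q A" for A
  proof (coinduction arbitrary: A rule: valid_algorithm.coinduct)
    case valid_algorithm
    then obtain s where s: "A = unfold_algorithm step s" "I s" by blast
    have "A = Algorithm (map_pmf (map_action (unfold_algorithm step)) (step s))"
      unfolding s by (rule unfold_algorithm.code)
    moreover have "(\<forall>Q\<in>set Qs. valid_query n q Q) \<and>
        (\<forall>rs. (\<exists>s. c rs = unfold_algorithm step s \<and> I s) \<or> valid_algorithm n q (c rs))"
      if "Round Qs c \<in> set_pmf (map_pmf (map_action (unfold_algorithm step)) (step s))" for Qs c
    proof -
      from that obtain act where act: "act \<in> set_pmf (step s)"
          "Round Qs c = map_action (unfold_algorithm step) act" by auto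
      then obtain c' where "act = Round Qs c'" "c = unfold_algorithm step \<circ> c'"
        by (cases act) (auto simp: fun_eq_iff)
      then show ?thesis using assms(2)[OF s(2)] act(1) by fastforce
    qed
    ultimately show ?case
      by (intro exI[of _ "map_pmf (map_action (unfold_algorithm step)) (step s)"] conjI allI impI) simp_all
  qed
  then show ?thesis using assms(1) by blast
qed

section \<open>Rounds of sampling queries and rounds of density queries, and the machine that
  alternates them\<close>

type_synonym site = "nat set \<times> nat \<times> (nat \<Rightarrow> nat)"

fun sampling :: "site \<Rightarrow> query" where
  "sampling (S, i, x) = Sampling S i x"

fun density :: "site \<times> nat \<Rightarrow> query" where
  "density ((S, i, x), a) = Density S i x a"

text \<open>Off the range of genuine oracle answers the decoding is arbitrary but stays inside the alphabet.\<close>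

definition letters :: "nat \<Rightarrow> nat \<Rightarrow> answer list \<Rightarrow> nat list" where
  "letters q k rs = map (\<lambda>j. if j < length rs
     then (case rs ! j of Letter a \<Rightarrow> if a \<in> {1..q} then a else 1 | Probability r \<Rightarrow> 1) else 1) [0..<k]"

definition probabilities :: "nat \<Rightarrow> answer list \<Rightarrow> real list" where
  "probabilities k rs = map (\<lambda>j. if j < length rs
     then (case rs ! j of Letter a \<Rightarrow> 0 | Probability r \<Rightarrow> max 0 (min 1 r)) else 0) [0..<k]"

type_synonym marginals = "nat set \<Rightarrow> nat \<Rightarrow> (nat \<Rightarrow> nat) \<Rightarrow> nat pmf"

primrec draws :: "marginals \<Rightarrow> site list \<Rightarrow> nat list pmf" where
  "draws \<kappa> [] = return_pmf []"
| "draws \<kappa> (Q # Qs) = bind_pmf (case Q of (S, i, x) \<Rightarrow> \<kappa> S i x) (\<lambda>a. map_pmf ((#) a) (draws \<kappa> Qs))"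

fun mass :: "marginals \<Rightarrow> site \<times> nat \<Rightarrow> real" where
  "mass \<kappa> ((S, i, x), a) = pmf (\<kappa> S i x) a"

lemma length_draws: "ys \<in> set_pmf (draws \<kappa> Qs) \<Longrightarrow> length ys = length Qs"
  by (induction Qs arbitrary: ys) auto

lemma set_draws:
  assumes "\<And>S i x. (S, i, x) \<in> set Qs \<Longrightarrow> set_pmf (\<kappa> S i x) \<subseteq> A" and "ys \<in> set_pmf (draws \<kappa> Qs)"
  shows "set ys \<subseteq> A"
  using assms
proof (induction Qs arbitrary: ys)
  case (Cons Q Qs)
  obtain S i x where Q: "Q = (S, i, x)" by (cases Q)
  from Cons.prems(2) obtain a as where as: "ys = a # as" "a \<in> set_pmf (\<kappa> S i x)" "as \<in> set_pmf (draws \<kappa> Qs)"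
    by (auto simp: Q)
  have "set as \<subseteq> A" using Cons.IH[OF _ as(3)] Cons.prems(1) by auto
  moreover have "a \<in> A" using Cons.prems(1)[of S i x] as(2) Q by auto
  ultimately show ?case using as(1) by simp
qed simp

lemma oracle_answers_sampling: "oracle_answers \<kappa> (map sampling Qs) = map_pmf (map Letter) (draws \<kappa> Qs)"
proof (induction Qs)
  case (Cons Q Qs)
  then show ?case
    by (cases Q) (simp add: bind_map_pmf map_bind_pmf pmf.map_comp o_def)
qed simp

lemma oracle_answers_density:
  "oracle_answers \<kappa> (map density Qs) = return_pmf (map (\<lambda>Q. Probability (mass \<kappa> Q)) Qs)"
proof (induction Qs)
  case (Cons Q Qs)
  obtain S i x a where "Q = ((S, i, x), a)" by (cases Q) auto
  with Cons show ?case by (simp add: bind_return_pmf)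
qed simp

lemma letters_map_Letter: "set ys \<subseteq> {1..q} \<Longrightarrow> length ys = k \<Longrightarrow> letters q k (map Letter ys) = ys"
  by (rule nth_equalityI) (auto simp: letters_def subset_iff)

lemma probabilities_map: "probabilities (length Qs) (map (\<lambda>Q. Probability (mass \<kappa> Q)) Qs) = map (mass \<kappa>) Qs"
proof (rule nth_equalityI)
  fix j assume "j < length (probabilities (length Qs) (map (\<lambda>Q. Probability (mass \<kappa> Q)) Qs))"
  then have j: "j < length Qs" by (simp add: probabilities_def)
  obtain S i x a where "Qs ! j = ((S, i, x), a)" by (metis prod.exhaust)
  with j show "probabilities (length Qs) (map (\<lambda>Q. Probability (mass \<kappa> Q)) Qs) ! j = map (mass \<kappa>) Qs ! j"
    by (simp add: probabilities_def pmf_le_1)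
qed (simp add: probabilities_def)

text \<open>\<open>Choose\<close> stands before a sampling round, \<open>Check\<close> before the
  density round that evaluates the sampled letters. \<open>Choose\<close> carries a law instead of a
  state: coins tossed after the density answers belong to the next node of the interaction
  tree.\<close>

datatype ('s, 'c) node = Choose "('s + (nat \<Rightarrow> nat)) pmf" | Check 'c "nat list"

text \<open>\<open>pick\<close> tosses the coins that precede the queries, \<open>resume\<close>
  those that follow the densities. The assumptions restrict answers only by length and range, which
  the decoding enforces for arbitrary answer lists.\<close>

locale sampling_machine =
  fixes n q :: nat
    and pick :: "'s \<Rightarrow> 'c pmf"
    and samples :: "'c \<Rightarrow> site list"
    and checks :: "'c \<Rightarrow> nat list \<Rightarrow> (site \<times> nat) list"
    and resume :: "'c \<Rightarrow> nat list \<Rightarrow> real list \<Rightarrow> ('s + (nat \<Rightarrow> nat)) pmf"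
    and ok :: "'s \<Rightarrow> bool"
  assumes q_pos: "q \<ge> 1"
    and ok_samples: "\<And>s c Q. ok s \<Longrightarrow> c \<in> set_pmf (pick s) \<Longrightarrow> Q \<in> set (samples c) \<Longrightarrow>
      valid_query n q (sampling Q)"
    and ok_checks: "\<And>s c ys Q. ok s \<Longrightarrow> c \<in> set_pmf (pick s) \<Longrightarrow> length ys = length (samples c) \<Longrightarrow>
      set ys \<subseteq> {1..q} \<Longrightarrow> Q \<in> set (checks c ys) \<Longrightarrow> valid_query n q (density Q)"
    and ok_resume: "\<And>s c ys ds s'. ok s \<Longrightarrow> c \<in> set_pmf (pick s) \<Longrightarrow> length ys = length (samples c) \<Longrightarrow>
      set ys \<subseteq> {1..q} \<Longrightarrow> length ds = length (checks c ys) \<Longrightarrow> set ds \<subseteq> {0..1} \<Longrightarrow>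
      Inl s' \<in> set_pmf (resume c ys ds) \<Longrightarrow> ok s'"
begin

fun step :: "('s, 'c) node \<Rightarrow> ('s, 'c) node action pmf" where
  "step (Choose P) = bind_pmf P (\<lambda>r. case r of
      Inr x \<Rightarrow> return_pmf (Output x)
    | Inl s \<Rightarrow> map_pmf (\<lambda>c. Round (map sampling (samples c))
        (\<lambda>rs. Check c (letters q (length (samples c)) rs))) (pick s))"
| "step (Check c ys) = return_pmf (Round (map density (checks c ys))
      (\<lambda>rs. Choose (resume c ys (probabilities (length (checks c ys)) rs))))"

definition algorithm_from :: "('s + (nat \<Rightarrow> nat)) pmf \<Rightarrow> algorithm" where
  "algorithm_from P = unfold_algorithm step (Choose P)"

definition ok_pmf :: "('s + (nat \<Rightarrow> nat)) pmf \<Rightarrow> bool" where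
  "ok_pmf P \<longleftrightarrow> (\<forall>s. Inl s \<in> set_pmf P \<longrightarrow> ok s)"

lemma letters_range: "set (letters q k rs) \<subseteq> {1..q}"
  using q_pos by (auto simp: letters_def split: answer.splits)

lemma valid_algorithm_from:
  assumes "ok_pmf P"
  shows "valid_algorithm n q (algorithm_from P)"
proof -
  define I where "I = (\<lambda>v. case v of Choose P \<Rightarrow> ok_pmf P
    | Check c ys \<Rightarrow> (\<exists>s. ok s \<and> c \<in> set_pmf (pick s)) \<and> length ys = length (samples c) \<and> set ys \<subseteq> {1..q})"
  show ?thesis unfolding algorithm_from_def
  proof (rule valid_unfold_algorithm[where I = I])
    show "I (Choose P)" using assms by (simp add: I_def)
  next
    fix v Qs c assume v: "I v" "Round Qs c \<in> set_pmf (step v)"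
    show "(\<forall>Q\<in>set Qs. valid_query n q Q) \<and> (\<forall>rs. I (c rs))"
    proof (cases v)
      case (Choose P)
      with v(2) obtain r where r: "r \<in> set_pmf P" "Round Qs c \<in> set_pmf (case r of
            Inr x \<Rightarrow> return_pmf (Output x)
          | Inl s \<Rightarrow> map_pmf (\<lambda>c. Round (map sampling (samples c))
              (\<lambda>rs. Check c (letters q (length (samples c)) rs))) (pick s))"
        by auto
      then obtain s d where s: "Inl s \<in> set_pmf P" "d \<in> set_pmf (pick s)"
          "Qs = map sampling (samples d)" "c = (\<lambda>rs. Check d (letters q (length (samples d)) rs))"
        by (cases r) auto
      then have "ok s" using v(1) Choose by (auto simp: I_def ok_pmf_def)
      with s show ?thesis using ok_samples letters_range
        by (auto simp: I_def) (auto simp: letters_def)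
    next
      case (Check d ys)
      with v obtain s where s: "ok s" "d \<in> set_pmf (pick s)" "length ys = length (samples d)" "set ys \<subseteq> {1..q}"
        by (auto simp: I_def)
      from Check v(2) have c: "Qs = map density (checks d ys)"
        "c = (\<lambda>rs. Choose (resume d ys (probabilities (length (checks d ys)) rs)))" by auto
      have "length (probabilities k rs) = k" "set (probabilities k rs) \<subseteq> {0..1}" for k rs
        by (auto simp: probabilities_def split: answer.splits)
      then have "ok_pmf (resume d ys (probabilities (length (checks d ys)) rs))" for rs
        unfolding ok_pmf_def using ok_resume[OF s] by blast
      with ok_checks[OF s] show ?thesis by (auto simp: c I_def)
    qed
  qed
qed

text \<open>One sampling round and one density round together: the unit of time of all potentials,
  worth two rounds.\<close>

definition macro :: "marginals \<Rightarrow> 's \<Rightarrow> ('s + (nat \<Rightarrow> nat)) pmf" where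
  "macro \<kappa> s = bind_pmf (pick s) (\<lambda>c. bind_pmf (draws \<kappa> (samples c)) (\<lambda>ys.
     resume c ys (map (mass \<kappa>) (checks c ys))))"

end

locale oracle_machine = sampling_machine n q pick samples checks resume ok
  for n q :: nat and pick :: "'s \<Rightarrow> 'c pmf" and samples checks resume and ok :: "'s \<Rightarrow> bool" +
  fixes \<kappa> :: marginals
  assumes support: "\<And>S i x. valid_query n q (Sampling S i x) \<Longrightarrow> set_pmf (\<kappa> S i x) \<subseteq> {1..q}"
begin

lemma draws_samples:
  assumes "ok s" "c \<in> set_pmf (pick s)" "ys \<in> set_pmf (draws \<kappa> (samples c))"
  shows "length ys = length (samples c)" "set ys \<subseteq> {1..q}"
proof -
  show "length ys = length (samples c)" using assms(3) by (rule length_draws)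
  have "set_pmf (\<kappa> S i x) \<subseteq> {1..q}" if "(S, i, x) \<in> set (samples c)" for S i x
    using ok_samples[OF assms(1,2) that] support by simp
  then show "set ys \<subseteq> {1..q}" using assms(3) by (rule set_draws)
qed

lemma mass_range: "set (map (mass \<kappa>) Qs) \<subseteq> {0..1}"
proof -
  have "mass \<kappa> Q \<in> {0..1}" for Q by (cases "(\<kappa>, Q)" rule: mass.cases) (auto simp: pmf_le_1)
  then show ?thesis by auto
qed

lemma ok_pmf_resume:
  assumes "ok s" "c \<in> set_pmf (pick s)" "ys \<in> set_pmf (draws \<kappa> (samples c))"
  shows "ok_pmf (resume c ys (map (mass \<kappa>) (checks c ys)))"
  unfolding ok_pmf_def
  using ok_resume[OF assms(1,2) draws_samples[OF assms] _ mass_range] by auto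

lemma run_algorithm_from:
  assumes "ok_pmf P"
  shows "run \<kappa> (algorithm_from P) = bind_pmf P (\<lambda>r. case r of
      Inr x \<Rightarrow> return_spmf (x, 0, 0)
    | Inl s \<Rightarrow> bind_pmf (pick s) (\<lambda>c. bind_pmf (draws \<kappa> (samples c)) (\<lambda>ys.
        map_spmf (\<lambda>(x, r, m). (x, Suc (Suc r), length (samples c) + (length (checks c ys) + m)))
          (run \<kappa> (algorithm_from (resume c ys (map (mass \<kappa>) (checks c ys))))))))"
proof -
  have chk: "run \<kappa> (unfold_algorithm step (Check c ys)) =
      map_spmf (\<lambda>(x, r, m). (x, Suc r, length (checks c ys) + m))
        (run \<kappa> (algorithm_from (resume c ys (map (mass \<kappa>) (checks c ys)))))" for c ys
    by (subst run_unfold_algorithm)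
       (simp add: bind_return_pmf oracle_answers_density probabilities_map algorithm_from_def)
  have "run \<kappa> (algorithm_from P) = bind_pmf P (\<lambda>r. case r of
      Inr x \<Rightarrow> return_spmf (x, 0, 0)
    | Inl s \<Rightarrow> bind_pmf (pick s) (\<lambda>c. bind_pmf (draws \<kappa> (samples c)) (\<lambda>ys.
        map_spmf (\<lambda>(x, r, m). (x, Suc r, length (samples c) + m))
          (run \<kappa> (unfold_algorithm step (Check c (letters q (length (samples c)) (map Letter ys))))))))"
    unfolding algorithm_from_def
    by (subst run_unfold_algorithm)
       (auto simp: bind_assoc_pmf bind_return_pmf bind_map_pmf oracle_answers_sampling
             intro!: bind_pmf_cong split: sum.split)
  also have "\<dots> = bind_pmf P (\<lambda>r. case r of
      Inr x \<Rightarrow> return_spmf (x, 0, 0)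
    | Inl s \<Rightarrow> bind_pmf (pick s) (\<lambda>c. bind_pmf (draws \<kappa> (samples c)) (\<lambda>ys.
        map_spmf (\<lambda>(x, r, m). (x, Suc (Suc r), length (samples c) + (length (checks c ys) + m)))
          (run \<kappa> (algorithm_from (resume c ys (map (mass \<kappa>) (checks c ys))))))))"
  proof (intro bind_pmf_cong refl, goal_cases)
    case (1 r)
    show ?case
    proof (cases r)
      case (Inl s)
      then have "ok s" using 1 assms by (simp add: ok_pmf_def)
      then show ?thesis unfolding Inl sum.case
        by (intro bind_pmf_cong refl)
           (auto simp: letters_map_Letter[OF draws_samples(2,1)] chk spmf.map_comp o_def split_def)
    qed simp
  qed
  finally show ?thesis .
qed

abbreviation val :: "('s \<Rightarrow> ennreal) \<Rightarrow> ((nat \<Rightarrow> nat) \<Rightarrow> ennreal) \<Rightarrow> ('s + (nat \<Rightarrow> nat)) pmf \<Rightarrow> ennreal" where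
  "val V g P \<equiv> \<integral>\<^sup>+r. (case r of Inl s \<Rightarrow> V s | Inr x \<Rightarrow> g x) \<partial>P"

lemma nn_integral_run:
  assumes "ok_pmf P"
  shows "(\<integral>\<^sup>+\<omega>. \<phi> \<omega> \<partial>measure_pmf (run \<kappa> (algorithm_from P))) =
    val (\<lambda>s. \<integral>\<^sup>+c. \<integral>\<^sup>+ys. \<integral>\<^sup>+\<omega>.
        \<phi> (map_option (\<lambda>(x, r, m). (x, Suc (Suc r), length (samples c) + (length (checks c ys) + m))) \<omega>)
          \<partial>measure_pmf (run \<kappa> (algorithm_from (resume c ys (map (mass \<kappa>) (checks c ys)))))
          \<partial>draws \<kappa> (samples c) \<partial>pick s)
      (\<lambda>x. \<phi> (Some (x, 0, 0))) P"
  by (subst run_algorithm_from[OF assms])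
     (auto intro!: nn_integral_cong split: sum.split)

text \<open>A supersolution bounds the expected cost. Truncating the cost at \<open>2 * k\<close>
  rounds allows induction on \<open>k\<close> without knowing that the run stops; monotone
  convergence removes the truncation. Runs that never stop contribute nothing.\<close>

lemma run_potential:
  fixes V :: "'s \<Rightarrow> ennreal" and v w :: ennreal and queries :: "'s \<Rightarrow> nat"
  assumes cost: "\<And>s c ys. ok s \<Longrightarrow> c \<in> set_pmf (pick s) \<Longrightarrow> ys \<in> set_pmf (draws \<kappa> (samples c)) \<Longrightarrow>
      length (samples c) + length (checks c ys) \<le> queries s"
    and V: "\<And>s. ok s \<Longrightarrow> 2 * v + w * of_nat (queries s) + val V g (macro \<kappa> s) \<le> V s"
    and P: "ok_pmf P"
  shows "(\<integral>\<^sup>+(x, r, m). g x + v * of_nat r + w * of_nat m \<partial>measure_spmf (run \<kappa> (algorithm_from P))) \<le> val V g P"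
proof -
  define \<phi> where "\<phi> k \<omega> = (case \<omega> of None \<Rightarrow> 0 | Some (x, r, m) \<Rightarrow>
    if r < 2 * k then g x + v * of_nat r + w * of_nat m else 0)"
    for k and \<omega> :: "((nat \<Rightarrow> nat) \<times> nat \<times> nat) option"
  have bound: "(\<integral>\<^sup>+\<omega>. \<phi> k \<omega> \<partial>measure_pmf (run \<kappa> (algorithm_from P))) \<le> val V g P" if "ok_pmf P" for k P
    using that
  proof (induction k arbitrary: P)
    case 0
    have "\<phi> 0 = (\<lambda>_. 0)" by (auto simp: \<phi>_def fun_eq_iff split: option.split)
    then show ?case by simp
  next
    case (Suc k)
    show ?case unfolding nn_integral_run[OF Suc.prems]
    proof (intro nn_integral_mono_AE AE_pmfI, goal_cases)
      case (1 r)
      show ?case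
      proof (cases r)
        case (Inr x)
        then show ?thesis by (simp add: \<phi>_def)
      next
        case (Inl s)
        with 1 Suc.prems have s: "ok s" by (simp add: ok_pmf_def)
        have "(\<integral>\<^sup>+c. \<integral>\<^sup>+ys. \<integral>\<^sup>+\<omega>.
            \<phi> (Suc k) (map_option (\<lambda>(x, r, m). (x, Suc (Suc r), length (samples c) + (length (checks c ys) + m))) \<omega>)
              \<partial>measure_pmf (run \<kappa> (algorithm_from (resume c ys (map (mass \<kappa>) (checks c ys)))))
              \<partial>draws \<kappa> (samples c) \<partial>pick s)
          \<le> (\<integral>\<^sup>+c. \<integral>\<^sup>+ys. 2 * v + w * of_nat (queries s) +
              val V g (resume c ys (map (mass \<kappa>) (checks c ys))) \<partial>draws \<kappa> (samples c) \<partial>pick s)"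
        proof (intro nn_integral_mono_AE AE_pmfI, goal_cases)
          case (1 c ys)
          let ?L = "length (samples c) + length (checks c ys)"
          let ?M = "measure_pmf (run \<kappa> (algorithm_from (resume c ys (map (mass \<kappa>) (checks c ys)))))"
          have "(\<integral>\<^sup>+\<omega>. \<phi> (Suc k) (map_option (\<lambda>(x, r, m). (x, Suc (Suc r), length (samples c) + (length (checks c ys) + m))) \<omega>) \<partial>?M)
            \<le> (\<integral>\<^sup>+\<omega>. (2 * v + w * of_nat (queries s)) + \<phi> k \<omega> \<partial>?M)"
          proof (intro nn_integral_mono)
            fix \<omega>
            show "\<phi> (Suc k) (map_option (\<lambda>(x, r, m). (x, Suc (Suc r), length (samples c) + (length (checks c ys) + m))) \<omega>)
              \<le> (2 * v + w * of_nat (queries s)) + \<phi> k \<omega>"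
            proof (cases \<omega>)
              case (Some t)
              obtain x r m where t: "t = (x, r, m)" by (cases t)
              have "w * of_nat ?L \<le> w * of_nat (queries s)"
                using cost[OF s 1] by (intro mult_left_mono of_nat_mono) auto
              then have "g x + v * (1 + (1 + of_nat r)) + w * (of_nat ?L + of_nat m)
                \<le> 2 * v + w * of_nat (queries s) + (g x + v * of_nat r + w * of_nat m)"
                by (simp add: distrib_left mult_2 add_ac add_mono)
              then show ?thesis by (auto simp: \<phi>_def Some t add_ac)
            qed (simp add: \<phi>_def)
          qed
          also have "\<dots> = 2 * v + w * of_nat (queries s) + (\<integral>\<^sup>+\<omega>. \<phi> k \<omega> \<partial>?M)"
            by (simp add: nn_integral_add)
          also have "\<dots> \<le> 2 * v + w * of_nat (queries s) + val V g (resume c ys (map (mass \<kappa>) (checks c ys)))"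
            by (intro add_left_mono Suc.IH ok_pmf_resume[OF s 1])
          finally show ?case .
        qed
        also have "\<dots> = 2 * v + w * of_nat (queries s) + val V g (macro \<kappa> s)"
          by (simp add: macro_def nn_integral_add)
        also have "\<dots> \<le> V s" by (rule V[OF s])
        finally show ?thesis by (simp add: Inl)
      qed
    qed
  qed
  let ?f = "\<lambda>(x, r, m). g x + v * of_nat r + w * of_nat m"
  have "(\<integral>\<^sup>+\<omega>. ?f \<omega> \<partial>measure_spmf (run \<kappa> (algorithm_from P)))
    = (\<integral>\<^sup>+\<omega>. ?f (the \<omega>) * indicator (range Some) \<omega> \<partial>measure_pmf (run \<kappa> (algorithm_from P)))"
    by (subst nn_integral_measure_spmf_conv_measure_pmf, simp, subst nn_integral_restrict_space) (simp_all add: o_def)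
  also have "\<dots> = (\<integral>\<^sup>+\<omega>. (SUP k. \<phi> k \<omega>) \<partial>measure_pmf (run \<kappa> (algorithm_from P)))"
    proof (intro nn_integral_cong)
      fix \<omega> :: "((nat \<Rightarrow> nat) \<times> nat \<times> nat) option"
      show "?f (the \<omega>) * indicator (range Some) \<omega> = (SUP k. \<phi> k \<omega>)"
      proof (cases \<omega>)
        case (Some t)
        obtain x r m where t: "t = (x, r, m)" by (cases t)
        have "(SUP k. \<phi> k \<omega>) = g x + v * of_nat r + w * of_nat m"
        proof (intro antisym SUP_least)
          show "g x + v * of_nat r + w * of_nat m \<le> (SUP k. \<phi> k \<omega>)"
            by (rule SUP_upper2[of "Suc r"]) (auto simp: \<phi>_def Some t)
        qed (auto simp: \<phi>_def Some t)
        then show ?thesis by (simp add: Some t)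
      qed (auto simp: \<phi>_def)
    qed
  also have "\<dots> = (SUP k. \<integral>\<^sup>+\<omega>. \<phi> k \<omega> \<partial>measure_pmf (run \<kappa> (algorithm_from P)))"
    by (intro nn_integral_monotone_convergence_SUP incseq_SucI le_funI)
       (auto simp: \<phi>_def split: option.split)
  also have "\<dots> \<le> val V g P" by (intro SUP_least bound P)
  finally show ?thesis .
qed

text \<open>If \<open>U\<close> shrinks on average by the factor \<open>\<theta>\<close> per macro
  step and stays above 1, Markov's inequality gives an exponential tail. The complement is taken in
  the option type, so a run that never stops counts as slow and termination follows from the same
  bound.\<close>

lemma run_tail:
  fixes U :: "'s \<Rightarrow> ennreal" and \<theta> :: ennreal
  assumes U: "\<And>s. ok s \<Longrightarrow> \<theta> * val U (\<lambda>_. 1) (macro \<kappa> s) \<le> U s"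
    and U1: "\<And>s. ok s \<Longrightarrow> 1 \<le> U s"
    and P: "ok_pmf P"
  shows "\<theta> ^ k * ennreal (1 - measure (measure_spmf (run \<kappa> (algorithm_from P))) {(x, r, m). r < 2 * k})
    \<le> val U (\<lambda>_. 1) P"
proof -
  define \<phi> :: "nat \<Rightarrow> ((nat \<Rightarrow> nat) \<times> nat \<times> nat) option \<Rightarrow> ennreal"
    where "\<phi> k = indicator (- (Some ` {(x, r, m). r < 2 * k}))" for k
  have bound: "\<theta> ^ k * (\<integral>\<^sup>+\<omega>. \<phi> k \<omega> \<partial>measure_pmf (run \<kappa> (algorithm_from P))) \<le> val U (\<lambda>_. 1) P"
    if "ok_pmf P" for k P
    using that
  proof (induction k arbitrary: P)
    case 0
    have "(\<integral>\<^sup>+\<omega>. \<phi> 0 \<omega> \<partial>measure_pmf (run \<kappa> (algorithm_from P))) = 1"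
      by (simp add: \<phi>_def split_def)
    also have "(1::ennreal) = (\<integral>\<^sup>+r. 1 \<partial>P)" by simp
    also have "\<dots> \<le> val U (\<lambda>_. 1) P"
      using 0 U1 by (intro nn_integral_mono_AE AE_pmfI) (auto simp: ok_pmf_def split: sum.split)
    finally show ?case by simp
  next
    case (Suc k)
    have "\<theta> ^ Suc k * (\<integral>\<^sup>+\<omega>. \<phi> (Suc k) \<omega> \<partial>measure_pmf (run \<kappa> (algorithm_from P))) =
      (\<integral>\<^sup>+r. \<theta> ^ Suc k * (case r of Inl s \<Rightarrow> \<integral>\<^sup>+c. \<integral>\<^sup>+ys. \<integral>\<^sup>+\<omega>.
        \<phi> (Suc k) (map_option (\<lambda>(x, r, m). (x, Suc (Suc r), length (samples c) + (length (checks c ys) + m))) \<omega>)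
          \<partial>measure_pmf (run \<kappa> (algorithm_from (resume c ys (map (mass \<kappa>) (checks c ys)))))
          \<partial>draws \<kappa> (samples c) \<partial>pick s
        | Inr x \<Rightarrow> \<phi> (Suc k) (Some (x, 0, 0))) \<partial>P)"
      unfolding nn_integral_run[OF Suc.prems] by (simp add: nn_integral_cmult)
    also have "\<dots> \<le> val U (\<lambda>_. 1) P"
    proof (intro nn_integral_mono_AE AE_pmfI, goal_cases)
      case (1 r)
      show ?case
      proof (cases r)
        case (Inr x)
        then show ?thesis by (auto simp: \<phi>_def)
      next
        case (Inl s)
        with 1 Suc.prems have s: "ok s" by (simp add: ok_pmf_def)
        have "\<theta> ^ Suc k * (\<integral>\<^sup>+c. \<integral>\<^sup>+ys. \<integral>\<^sup>+\<omega>.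
            \<phi> (Suc k) (map_option (\<lambda>(x, r, m). (x, Suc (Suc r), length (samples c) + (length (checks c ys) + m))) \<omega>)
              \<partial>measure_pmf (run \<kappa> (algorithm_from (resume c ys (map (mass \<kappa>) (checks c ys)))))
              \<partial>draws \<kappa> (samples c) \<partial>pick s)
          = \<theta> * (\<integral>\<^sup>+c. \<integral>\<^sup>+ys. \<theta> ^ k * (\<integral>\<^sup>+\<omega>. \<phi> k \<omega>
              \<partial>measure_pmf (run \<kappa> (algorithm_from (resume c ys (map (mass \<kappa>) (checks c ys))))))
              \<partial>draws \<kappa> (samples c) \<partial>pick s)"
        proof -
          have "\<phi> (Suc k) (map_option (\<lambda>(x, r, m). (x, Suc (Suc r), l + (l' + m))) \<omega>) = \<phi> k \<omega>" for l l' \<omega>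
            by (cases \<omega>) (auto simp: \<phi>_def indicator_def image_iff split_def)
          then show ?thesis by (simp add: nn_integral_cmult mult.assoc)
        qed
        also have "\<dots> \<le> \<theta> * (\<integral>\<^sup>+c. \<integral>\<^sup>+ys. val U (\<lambda>_. 1) (resume c ys (map (mass \<kappa>) (checks c ys)))
              \<partial>draws \<kappa> (samples c) \<partial>pick s)"
          by (intro mult_left_mono nn_integral_mono_AE AE_pmfI Suc.IH ok_pmf_resume[OF s]) auto
        also have "\<dots> = \<theta> * val U (\<lambda>_. 1) (macro \<kappa> s)" by (simp add: macro_def)
        also have "\<dots> \<le> U s" by (rule U[OF s])
        finally show ?thesis by (simp add: Inl)
      qed
    qed
    finally show ?case .
  qed
  let ?M = "measure_pmf (run \<kappa> (algorithm_from P))" and ?A = "{(x, r, m). r < 2 * k} :: ((nat \<Rightarrow> nat) \<times> nat \<times> nat) set"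
  have "(\<integral>\<^sup>+\<omega>. \<phi> k \<omega> \<partial>?M) = emeasure ?M (- (Some ` ?A))"
    by (simp add: \<phi>_def)
  also have "\<dots> = ennreal (1 - measure ?M (Some ` ?A))"
    using measure_pmf.prob_compl[of "Some ` ?A" "run \<kappa> (algorithm_from P)"]
    by (simp add: measure_pmf.emeasure_eq_measure Diff_eq)
  also have "measure ?M (Some ` ?A) = measure (measure_spmf (run \<kappa> (algorithm_from P))) ?A"
    by (simp add: measure_measure_spmf_conv_measure_pmf)
  finally show ?thesis using bound[OF P, of k] by simp
qed

end

section \<open>Speculative drafting with race-based correction\<close>

type_synonym frame = "real \<times> site"

text \<open>\<open>Testing S0 z0 st l j\<close> keeps the pinned configuration \<open>z0\<close> on
  \<open>S0\<close>, the frames \<open>st\<close> of the rejected draft with the latest coordinate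
  on top, the length \<open>l\<close> of that draft, and the number \<open>j\<close> of batches that
  brought no success.\<close>

datatype state =
    Start "nat set" "nat \<Rightarrow> nat"
  | Testing "nat set" "nat \<Rightarrow> nat" "frame list" nat nat

datatype choice =
    Draft "nat set" "nat \<Rightarrow> nat" "nat list"
  | Tests "nat set" "nat \<Rightarrow> nat" "frame list" "frame list list" nat nat

fun orders :: "nat set \<Rightarrow> nat \<Rightarrow> nat list pmf" where
  "orders R 0 = return_pmf []"
| "orders R (Suc m) = bind_pmf (pmf_of_set R) (\<lambda>i. map_pmf ((#) i) (orders (R - {i}) m))"

text \<open>The bottom frame has matched fraction 1 in every valid stack, so keeping it without a
  coin agrees with the general rule.\<close>

fun level :: "frame list \<Rightarrow> frame list pmf" where
  "level [] = return_pmf []"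
| "level [e] = return_pmf [e]"
| "level (e # e' # st) = bind_pmf (bernoulli_pmf (fst e))
     (\<lambda>c. if c then return_pmf (e # e' # st) else level (e' # st))"

text \<open>Each search starts at the frame tested last, as it would after a failed test. No answer
  is consulted, hence the \<open>w\<close> tests fit into one pair of rounds.\<close>

primrec walk :: "nat \<Rightarrow> frame list \<Rightarrow> frame list list pmf" where
  "walk 0 st = return_pmf []"
| "walk (Suc w) st = bind_pmf (level st) (\<lambda>st'. map_pmf ((#) st') (walk w st'))"

text \<open>\<open>d0\<close> is the density of a drafted letter given the pinned coordinates,
  \<open>d1\<close> the one given also the letters drafted before it. A frame stores the matched
  fraction before its own coordinate.\<close>

fun trace :: "real \<Rightarrow> nat set \<Rightarrow> (nat \<Rightarrow> nat) \<Rightarrow> frame list \<Rightarrow> nat list \<Rightarrow> nat list \<Rightarrow> real list \<Rightarrow>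
    real \<times> nat set \<times> (nat \<Rightarrow> nat) \<times> frame list" where
  "trace p S z st (i # js) (a # as) (d0 # d1 # ds) =
     trace (min 1 (p * (d1 / d0))) (insert i S) (z(i := a)) ((p, S, i, z) # st) js as ds"
| "trace p S z st _ _ _ = (p, S, z, st)"

fun draft_checks :: "nat set \<Rightarrow> (nat \<Rightarrow> nat) \<Rightarrow> nat set \<Rightarrow> (nat \<Rightarrow> nat) \<Rightarrow> nat list \<Rightarrow> nat list \<Rightarrow>
    (site \<times> nat) list" where
  "draft_checks S0 z0 S z (i # js) (a # as) =
     ((S0, i, z0), a) # ((S, i, z), a) # draft_checks S0 z0 (insert i S) (z(i := a)) js as"
| "draft_checks S0 z0 S z _ _ = []"

abbreviation site_of :: "frame list \<Rightarrow> site" where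
  "site_of st \<equiv> snd (hd st)"

fun test_checks :: "nat set \<Rightarrow> (nat \<Rightarrow> nat) \<Rightarrow> frame list list \<Rightarrow> nat list \<Rightarrow> (site \<times> nat) list" where
  "test_checks S0 z0 (st # lv) (b # bs) =
     ((S0, fst (snd (site_of st)), z0), b) # (site_of st, b) # test_checks S0 z0 lv bs"
| "test_checks S0 z0 _ _ = []"

text \<open>A success rolls back to the frame tested and puts \<open>b\<close> in place of the
  drafted letter there; everything drafted later is lost. Tests behind the first success are
  dropped, since a sequential race would not have made them.\<close>

fun first_success :: "frame list \<Rightarrow> frame list list \<Rightarrow> nat list \<Rightarrow> real list \<Rightarrow>
    (frame list + nat set \<times> (nat \<Rightarrow> nat)) pmf" where
  "first_success st (st' # lv) (b # bs) (d0 # d1 # ds) = (case hd st' of (p, S, i, z) \<Rightarrow>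
     bind_pmf (bernoulli_pmf (1 - min 1 (d0 / (p * d1)))) (\<lambda>s.
       if s then return_pmf (Inr (insert i S, z(i := b))) else first_success st' lv bs ds))"
| "first_success st _ _ _ = return_pmf (Inl st)"

definition settle :: "nat \<Rightarrow> nat set \<Rightarrow> (nat \<Rightarrow> nat) \<Rightarrow> state + (nat \<Rightarrow> nat)" where
  "settle n S z = (if S = {1..n} then Inr z else Inl (Start S z))"

fun samples :: "choice \<Rightarrow> site list" where
  "samples (Draft S z ord) = map (\<lambda>i. (S, i, z)) ord"
| "samples (Tests S0 z0 st lv l j) = map site_of lv"

fun checks :: "choice \<Rightarrow> nat list \<Rightarrow> (site \<times> nat) list" where
  "checks (Draft S z ord) ys = draft_checks S z S z ord ys"
| "checks (Tests S0 z0 st lv l j) ys = test_checks S0 z0 lv ys"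

text \<open>The final matched fraction is the acceptance probability of the whole draft; after a
  rejection the drafted letters survive only inside the stack.\<close>

definition arbitrate :: "nat \<Rightarrow> nat set \<Rightarrow> (nat \<Rightarrow> nat) \<Rightarrow> nat \<Rightarrow>
    real \<times> nat set \<times> (nat \<Rightarrow> nat) \<times> frame list \<Rightarrow> (state + (nat \<Rightarrow> nat)) pmf" where
  "arbitrate n S0 z0 l t = (case t of (p, S, z, st) \<Rightarrow> map_pmf (\<lambda>c.
     if c then settle n S z else Inl (Testing S0 z0 st l 0)) (bernoulli_pmf p))"

fun resume :: "nat \<Rightarrow> choice \<Rightarrow> nat list \<Rightarrow> real list \<Rightarrow> (state + (nat \<Rightarrow> nat)) pmf" where
  "resume n (Draft S z ord) ys ds = arbitrate n S z (length ord) (trace 1 S z [] ord ys ds)"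
| "resume n (Tests S0 z0 st lv l j) ys ds = map_pmf (\<lambda>r. case r of
       Inl st' \<Rightarrow> Inl (Testing S0 z0 st' l (Suc j)) | Inr (S, z) \<Rightarrow> settle n S z)
     (first_success st lv ys ds)"

fun pick :: "nat \<Rightarrow> (nat \<Rightarrow> nat) \<Rightarrow> state \<Rightarrow> choice pmf" where
  "pick n blk (Start S z) = map_pmf (Draft S z) (orders ({1..n} - S) (blk (card S)))"
| "pick n blk (Testing S0 z0 st l j) =
     map_pmf (\<lambda>lv. Tests S0 z0 st lv l j) (walk (l * 2 ^ j) st)"

fun valid_site :: "nat \<Rightarrow> nat \<Rightarrow> site \<Rightarrow> bool" where
  "valid_site n q (S, i, z) \<longleftrightarrow> S \<subseteq> {1..n} \<and> i \<in> {1..n} - S \<and> z \<in> configs q S"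

fun valid_frame :: "nat \<Rightarrow> nat \<Rightarrow> nat set \<Rightarrow> frame \<Rightarrow> bool" where
  "valid_frame n q S0 (p, S, i, z) \<longleftrightarrow> 0 \<le> p \<and> p \<le> 1 \<and> S0 \<subseteq> S \<and> valid_site n q (S, i, z)"

definition valid_stack :: "nat \<Rightarrow> nat \<Rightarrow> nat set \<Rightarrow> frame list \<Rightarrow> bool" where
  "valid_stack n q S0 st \<longleftrightarrow> st \<noteq> [] \<and> fst (last st) = 1 \<and> (\<forall>e\<in>set st. valid_frame n q S0 e)"

fun ok :: "nat \<Rightarrow> nat \<Rightarrow> state \<Rightarrow> bool" where
  "ok n q (Start S z) \<longleftrightarrow> S \<subset> {1..n} \<and> z \<in> configs q S"
| "ok n q (Testing S0 z0 st l j) \<longleftrightarrow>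
     S0 \<subseteq> {1..n} \<and> z0 \<in> configs q S0 \<and> valid_stack n q S0 st \<and> l \<ge> 1"

section \<open>Well-formedness of all queries along a run\<close>

lemma configs_upd: "z \<in> configs q S \<Longrightarrow> a \<in> {1..q} \<Longrightarrow> z(i := a) \<in> configs q (insert i S)"
  unfolding configs_def by (rule PiE_fun_upd)

lemma set_orders:
  assumes "finite R" "m \<le> card R" "ord \<in> set_pmf (orders R m)"
  shows "length ord = m \<and> distinct ord \<and> set ord \<subseteq> R"
  using assms
proof (induction m arbitrary: R ord)
  case (Suc m)
  then have "R \<noteq> {}" by auto
  with Suc.prems obtain i js where i: "ord = i # js" "i \<in> R" "js \<in> set_pmf (orders (R - {i}) m)"
    by auto
  have "length js = m \<and> distinct js \<and> set js \<subseteq> R - {i}"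
    using Suc.prems i by (intro Suc.IH) auto
  with i show ?case by auto
qed simp

lemma valid_stack_level:
  "valid_stack n q S0 st \<Longrightarrow> st' \<in> set_pmf (level st) \<Longrightarrow> valid_stack n q S0 st'"
proof (induction st arbitrary: st' rule: level.induct)
  case (3 e e' st)
  have "valid_stack n q S0 (e' # st)" using 3(2) by (simp add: valid_stack_def)
  then show ?case using 3(1)[of False st'] 3(2,3) by (auto split: if_splits)
qed (auto simp: valid_stack_def)

lemma valid_stack_walk:
  "valid_stack n q S0 st \<Longrightarrow> lv \<in> set_pmf (walk w st) \<Longrightarrow>
     length lv = w \<and> (\<forall>st'\<in>set lv. valid_stack n q S0 st')"
proof (induction w arbitrary: st lv)
  case (Suc w)
  then obtain st' lv' where "lv = st' # lv'" "st' \<in> set_pmf (level st)" "lv' \<in> set_pmf (walk w st')"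
    by auto
  with Suc.IH[of st' lv'] valid_stack_level[OF Suc.prems(1)] show ?case by auto
qed simp

lemma valid_stack_hd: "valid_stack n q S0 st \<Longrightarrow> valid_frame n q S0 (hd st)"
  by (simp add: valid_stack_def)

lemma valid_site_of: "valid_stack n q S0 st \<Longrightarrow> valid_site n q (site_of st)"
  by (drule valid_stack_hd, cases "hd st") auto

lemma valid_draft_checks:
  assumes "S0 \<subseteq> {1..n}" "z0 \<in> configs q S0" "S \<subseteq> {1..n}" "z \<in> configs q S" "S0 \<subseteq> S" "distinct js"
    "set js \<subseteq> {1..n} - S" "set ys \<subseteq> {1..q}" "Q \<in> set (draft_checks S0 z0 S z js ys)"
  shows "valid_query n q (density Q)"
  using assms
proof (induction S0 z0 S z js ys rule: draft_checks.induct)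
  case (1 S0 z0 S z i js a as)
  consider "Q = ((S0, i, z0), a)" | "Q = ((S, i, z), a)"
    | "Q \<in> set (draft_checks S0 z0 (insert i S) (z(i := a)) js as)"
    using "1.prems" by auto
  then show ?case
  proof cases
    case 3
    then show ?thesis using "1.prems" configs_upd[of z q S a i]
      by (intro "1.IH") (auto simp del: fun_upd_apply)
  qed (use "1.prems" in auto)
qed auto

lemma length_draft_checks: "length ys = length js \<Longrightarrow> length (draft_checks S0 z0 S z js ys) = 2 * length js"
  by (induction S0 z0 S z js ys rule: draft_checks.induct) auto

lemma length_test_checks: "length bs = length lv \<Longrightarrow> length (test_checks S0 z0 lv bs) = 2 * length lv"
  by (induction S0 z0 lv bs rule: test_checks.induct) auto

lemma valid_test_checks:
  assumes "S0 \<subseteq> {1..n}" "z0 \<in> configs q S0" "\<forall>st\<in>set lv. valid_stack n q S0 st" "set bs \<subseteq> {1..q}"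
    "Q \<in> set (test_checks S0 z0 lv bs)"
  shows "valid_query n q (density Q)"
  using assms
proof (induction S0 z0 lv bs rule: test_checks.induct)
  case (1 S0 z0 st lv b bs)
  obtain p S i z where e: "hd st = (p, S, i, z)" by (metis prod.exhaust)
  have v: "valid_frame n q S0 (hd st)" using "1.prems" valid_stack_hd by simp
  consider "Q = ((S0, i, z0), b)" | "Q = ((S, i, z), b)" | "Q \<in> set (test_checks S0 z0 lv bs)"
    using "1.prems" by (auto simp: e)
  then show ?case
  proof cases
    case 3
    then show ?thesis using "1.prems" by (intro "1.IH") auto
  qed (use "1.prems" v in \<open>auto simp: e\<close>)
qed auto

lemma valid_trace:
  assumes "trace p S z st js ys ds = (p', S', z', st')" "length ys = length js" "length ds = 2 * length js"
    "0 \<le> p" "p \<le> 1" "set ds \<subseteq> {0..1}" "set ys \<subseteq> {1..q}" "distinct js" "set js \<subseteq> {1..n} - S"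
    "S0 \<subseteq> S" "S \<subseteq> {1..n}" "z \<in> configs q S" "st = [] \<longrightarrow> p = 1" "st \<noteq> [] \<longrightarrow> valid_stack n q S0 st"
  shows "0 \<le> p' \<and> p' \<le> 1 \<and> S' \<subseteq> {1..n} \<and> z' \<in> configs q S' \<and> (js \<noteq> [] \<or> st \<noteq> [] \<longrightarrow> valid_stack n q S0 st')"
  using assms
proof (induction p S z st js ys ds rule: trace.induct)
  case (1 p S z st i js a as d0 d1 ds)
  have "0 \<le> p' \<and> p' \<le> 1 \<and> S' \<subseteq> {1..n} \<and> z' \<in> configs q S' \<and>
    (js \<noteq> [] \<or> (p, S, i, z) # st \<noteq> [] \<longrightarrow> valid_stack n q S0 st')"
    using "1.prems" configs_upd[of z q S a i]
    by (intro "1.IH") (auto simp: valid_stack_def simp del: fun_upd_apply)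
  then show ?case by simp
qed auto

lemma valid_settle:
  "S \<subseteq> {1..n} \<Longrightarrow> z \<in> configs q S \<Longrightarrow> settle n S z = Inl s \<Longrightarrow> ok n q s"
  by (auto simp: settle_def split: if_splits)

lemma valid_first_success:
  assumes "r \<in> set_pmf (first_success st lv bs ds)" "valid_stack n q S0 st" "\<forall>st\<in>set lv. valid_stack n q S0 st"
    "set bs \<subseteq> {1..q}"
  shows "case r of Inl st' \<Rightarrow> valid_stack n q S0 st' | Inr (S, z) \<Rightarrow> S \<subseteq> {1..n} \<and> z \<in> configs q S"
  using assms
proof (induction st lv bs ds rule: first_success.induct)
  case (1 st st' lv b bs d0 d1 ds)
  obtain p S i z where e: "hd st' = (p, S, i, z)" by (metis prod.exhaust)
  have v: "valid_frame n q S0 (p, S, i, z)" using "1.prems" valid_stack_hd e by (metis list.set_intros(1))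
  from "1.prems"(1) consider "r = Inr (insert i S, z(i := b))" | c where "c \<in> set_pmf (bernoulli_pmf (1 - min 1 (d0 / (p * d1))))" "\<not> c"
      "r \<in> set_pmf (first_success st' lv bs ds)"
    by (auto simp: e split: if_splits)
  then show ?case
  proof cases
    case 1
    then show ?thesis using v "1.prems" configs_upd[of z q S b i] by (auto simp del: fun_upd_apply)
  next
    case 2
    then show ?thesis using "1.IH"[OF e[symmetric] refl refl 2] "1.prems" by auto
  qed
qed (auto split: sum.splits)

text \<open>The block length depends only on the number of pinned coordinates, so the grid of blocks
  can be fixed later and independently of the correctness proof.\<close>

locale sampler =
  fixes n q :: nat and blk :: "nat \<Rightarrow> nat"
  assumes q: "q \<ge> 1"
    and blk_pos: "\<And>p. p < n \<Longrightarrow> blk p \<ge> 1"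
    and blk_le: "\<And>p. p < n \<Longrightarrow> blk p \<le> n - p"
begin

lemma Start_orders:
  assumes "ok n q (Start S z)" "ord \<in> set_pmf (orders ({1..n} - S) (blk (card S)))"
  shows "length ord = blk (card S)" "distinct ord" "set ord \<subseteq> {1..n} - S" "length ord \<ge> 1"
proof -
  have S: "S \<subset> {1..n}" using assms(1) by simp
  then have "finite S" "card S < n" using psubset_card_mono[of "{1..n}" S] by (auto dest: finite_subset)
  moreover from this S have "card ({1..n} - S) = n - card S" by (subst card_Diff_subset) auto
  ultimately show "length ord = blk (card S)" "distinct ord" "set ord \<subseteq> {1..n} - S" "length ord \<ge> 1"
    using set_orders[OF _ _ assms(2)] blk_le blk_pos by auto
qed

sublocale sampling_machine n q "pick n blk" samples checks "resume n" "ok n q"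
proof
  show "q \<ge> 1" by (rule q)
next
  fix s c Q assume s: "ok n q s" "c \<in> set_pmf (pick n blk s)" "Q \<in> set (samples c)"
  show "valid_query n q (sampling Q)"
  proof (cases s)
    case (Start S z)
    then obtain ord where "c = Draft S z ord" "ord \<in> set_pmf (orders ({1..n} - S) (blk (card S)))"
      using s by auto
    with Start_orders(3)[of S z ord] s Start show ?thesis by auto
  next
    case (Testing S0 z0 st l j)
    then obtain lv where lv: "c = Tests S0 z0 st lv l j" "lv \<in> set_pmf (walk (l * 2 ^ j) st)"
      using s by auto
    then obtain st' where st': "st' \<in> set lv" "Q = site_of st'" using s(3) by auto
    then have "valid_stack n q S0 st'" using valid_stack_walk[OF _ lv(2)] s(1) Testing by auto
    then have "valid_site n q Q" using valid_site_of st'(2) by simp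
    then show ?thesis by (cases Q) auto
  qed
next
  fix s c ys Q assume s: "ok n q s" "c \<in> set_pmf (pick n blk s)" "length ys = length (samples c)"
    "set ys \<subseteq> {1..q}" "Q \<in> set (checks c ys)"
  show "valid_query n q (density Q)"
  proof (cases s)
    case (Start S z)
    then obtain ord where "c = Draft S z ord" "ord \<in> set_pmf (orders ({1..n} - S) (blk (card S)))"
      using s by auto
    with Start_orders[of S z ord] s Start show ?thesis
      by (intro valid_draft_checks[of S n z q S z ord ys]) auto
  next
    case (Testing S0 z0 st l j)
    then obtain lv where lv: "c = Tests S0 z0 st lv l j" "lv \<in> set_pmf (walk (l * 2 ^ j) st)"
      using s by auto
    with s Testing valid_stack_walk[OF _ lv(2)] show ?thesis
      by (intro valid_test_checks[of S0 n z0 q lv ys]) auto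
  qed
next
  fix s c ys ds s' assume s: "ok n q s" "c \<in> set_pmf (pick n blk s)" "length ys = length (samples c)"
    "set ys \<subseteq> {1..q}" "length ds = length (checks c ys)" "set ds \<subseteq> {0..1}"
    "Inl s' \<in> set_pmf (resume n c ys ds)"
  show "ok n q s'"
  proof (cases s)
    case (Start S z)
    then obtain ord where c: "c = Draft S z ord" "ord \<in> set_pmf (orders ({1..n} - S) (blk (card S)))"
      using s by auto
    note o = Start_orders[of S z ord, OF s(1)[unfolded Start] c(2)]
    obtain p' S' z' st' where t: "trace 1 S z [] ord ys ds = (p', S', z', st')" by (metis prod.exhaust)
    have len: "length ys = length ord" "length ds = 2 * length ord"
      using s(3,5) length_draft_checks[of ys ord] by (auto simp: c)
    have v: "0 \<le> p' \<and> p' \<le> 1 \<and> S' \<subseteq> {1..n} \<and> z' \<in> configs q S' \<and> (ord \<noteq> [] \<or> [] \<noteq> ([] :: frame list) \<longrightarrow> valid_stack n q S st')"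
      using s Start o by (intro valid_trace[OF t len, where ?S0.0 = S]) auto
    have "settle n S' z' = Inl s' \<or> s' = Testing S z st' (length ord) 0"
      using s(7) by (auto simp: c t arbitrate_def split: if_splits)
    then show ?thesis
      using valid_settle[of S' n z' q s'] v o s(1) Start by auto
  next
    case (Testing S0 z0 st l j)
    then obtain lv where lv: "c = Tests S0 z0 st lv l j" "lv \<in> set_pmf (walk (l * 2 ^ j) st)"
      using s by auto
    from s(7) obtain r where r: "r \<in> set_pmf (first_success st lv ys ds)"
      "Inl s' = (case r of Inl st' \<Rightarrow> Inl (Testing S0 z0 st' l (Suc j)) | Inr (S, z) \<Rightarrow> settle n S z)"
      by (auto simp: lv)
    have "case r of Inl st' \<Rightarrow> valid_stack n q S0 st' | Inr (S, z) \<Rightarrow> S \<subseteq> {1..n} \<and> z \<in> configs q S"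
      using s Testing valid_stack_walk[OF _ lv(2)] by (intro valid_first_success[OF r(1)]) auto
    with r(2) s(1) Testing show ?thesis
      using valid_settle by (auto split: sum.splits prod.splits)
  qed
qed

end

section \<open>The unmatched mass and the expected outcome of the race\<close>

lemma nn_integral_pmf_commute:
  "(\<integral>\<^sup>+x. \<integral>\<^sup>+y. f x y \<partial>measure_pmf B \<partial>measure_pmf A) = (\<integral>\<^sup>+y. \<integral>\<^sup>+x. f x y \<partial>measure_pmf A \<partial>measure_pmf B)"
proof -
  have "(\<integral>\<^sup>+z. (case z of (x, y) \<Rightarrow> f x y) \<partial>bind_pmf A (\<lambda>x. bind_pmf B (\<lambda>y. return_pmf (x, y)))) =
    (\<integral>\<^sup>+z. (case z of (x, y) \<Rightarrow> f x y) \<partial>bind_pmf B (\<lambda>y. bind_pmf A (\<lambda>x. return_pmf (x, y))))"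
    by (subst bind_commute_pmf) simp
  then show ?thesis by simp
qed

lemma nn_integral_bernoulli_mult:
  "0 \<le> p \<Longrightarrow> p \<le> 1 \<Longrightarrow>
     (\<integral>\<^sup>+c. f c \<partial>measure_pmf (bernoulli_pmf p)) = ennreal p * f True + ennreal (1 - p) * f False"
  by (simp add: mult.commute)

text \<open>Against counting measure both integrands are the minimum of \<open>pmf \<nu> a\<close>
  and \<open>p * pmf \<mu> a\<close>, times \<open>f a\<close>. Since division by zero yields zero,
  the degenerate cases agree as well.\<close>

lemma nn_integral_speculation:
  fixes \<mu> \<nu> :: "'a pmf"
  assumes "0 \<le> p"
  shows "(\<integral>\<^sup>+a. ennreal (min 1 (p * (pmf \<mu> a / pmf \<nu> a))) * f a \<partial>\<nu>) =
    ennreal p * (\<integral>\<^sup>+a. ennreal (min 1 (pmf \<nu> a / (p * pmf \<mu> a))) * f a \<partial>\<mu>)"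
proof -
  have eq: "pmf \<nu> a * min 1 (p * (pmf \<mu> a / pmf \<nu> a)) = p * (pmf \<mu> a * min 1 (pmf \<nu> a / (p * pmf \<mu> a)))" for a
  proof (cases "p = 0 \<or> pmf \<mu> a = 0 \<or> pmf \<nu> a = 0")
    case False
    then have "p > 0" "pmf \<mu> a > 0" "pmf \<nu> a > 0" using assms by (auto simp: pmf_pos less_le)
    then show ?thesis by (auto simp: min_def field_simps)
  qed auto
  have "(\<integral>\<^sup>+a. ennreal (min 1 (p * (pmf \<mu> a / pmf \<nu> a))) * f a \<partial>\<nu>) =
    (\<integral>\<^sup>+a. ennreal (pmf \<nu> a * min 1 (p * (pmf \<mu> a / pmf \<nu> a))) * f a \<partial>count_space UNIV)"
    by (subst nn_integral_measure_pmf) (simp add: ennreal_mult' mult.assoc)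
  also have "\<dots> = (\<integral>\<^sup>+a. ennreal p * (ennreal (pmf \<mu> a) * (ennreal (min 1 (pmf \<nu> a / (p * pmf \<mu> a))) * f a)) \<partial>count_space UNIV)"
    unfolding eq using assms by (simp add: ennreal_mult' mult.assoc)
  also have "\<dots> = ennreal p * (\<integral>\<^sup>+a. ennreal (min 1 (pmf \<nu> a / (p * pmf \<mu> a))) * f a \<partial>\<mu>)"
    by (subst nn_integral_measure_pmf) (simp add: nn_integral_cmult)
  finally show ?thesis .
qed

text \<open>
  A frame \<open>(p, S, i, z)\<close> holds the fraction \<open>p\<close> of the true law matched by the draft up to the
  configuration \<open>z\<close> on \<open>S\<close>; \<open>surplus\<close> is the conditional probability that coordinate \<open>i\<close>,
  drawn from its true law, leaves the matched part.
\<close>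

fun surplus :: "marginals \<Rightarrow> nat set \<Rightarrow> (nat \<Rightarrow> nat) \<Rightarrow> frame \<Rightarrow> nat \<Rightarrow> real" where
  "surplus \<kappa> S0 z0 (p, S, i, z) b = 1 - min 1 (pmf (\<kappa> S0 i z0) b / (p * pmf (\<kappa> S i z) b))"

fun matched :: "marginals \<Rightarrow> nat set \<Rightarrow> (nat \<Rightarrow> nat) \<Rightarrow> frame \<Rightarrow> nat \<Rightarrow> real" where
  "matched \<kappa> S0 z0 (p, S, i, z) a = min 1 (p * (pmf (\<kappa> S i z) a / pmf (\<kappa> S0 i z0) a))"

lemma surplus_range: "0 \<le> fst e \<Longrightarrow> 0 \<le> surplus \<kappa> S0 z0 e b \<and> surplus \<kappa> S0 z0 e b \<le> 1"
  by (cases e) auto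

lemma matched_range: "0 \<le> fst e \<Longrightarrow> 0 \<le> matched \<kappa> S0 z0 e b \<and> matched \<kappa> S0 z0 e b \<le> 1"
  by (cases e) auto

definition rejection :: "marginals \<Rightarrow> nat set \<Rightarrow> (nat \<Rightarrow> nat) \<Rightarrow> frame \<Rightarrow> ennreal" where
  "rejection \<kappa> S0 z0 e = (\<integral>\<^sup>+a. ennreal (1 - matched \<kappa> S0 z0 e a) \<partial>\<kappa> S0 (fst (snd (snd e))) z0)"

text \<open>The mass unmatched after a step splits into what leaves in this step, \<open>p\<close>
  times the mean surplus under the true law, and the fraction \<open>1 - p\<close> that had left
  before. These are the success at this frame and the pop in one turn of the race.\<close>

lemma rejection_eq:
  assumes "0 \<le> p" "p \<le> 1"
  shows "rejection \<kappa> S0 z0 (p, S, i, z) =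
    ennreal p * (\<integral>\<^sup>+b. ennreal (surplus \<kappa> S0 z0 (p, S, i, z) b) \<partial>\<kappa> S i z) + ennreal (1 - p)"
proof -
  let ?x = "\<integral>\<^sup>+a. ennreal (matched \<kappa> S0 z0 (p, S, i, z) a) \<partial>\<kappa> S0 i z0"
  let ?y = "\<integral>\<^sup>+b. ennreal (min 1 (pmf (\<kappa> S0 i z0) b / (p * pmf (\<kappa> S i z) b))) \<partial>\<kappa> S i z"
  have 1: "rejection \<kappa> S0 z0 (p, S, i, z) + ?x = 1"
    unfolding rejection_def fst_conv snd_conv using matched_range[of "(p, S, i, z)" \<kappa> S0 z0] assms
    by (subst nn_integral_add[symmetric]) (simp_all flip: ennreal_plus del: matched.simps)
  have 2: "(\<integral>\<^sup>+b. ennreal (surplus \<kappa> S0 z0 (p, S, i, z) b) \<partial>\<kappa> S i z) + ?y = 1"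
    using assms by (subst nn_integral_add[symmetric]) (simp_all flip: ennreal_plus)
  have 3: "?x = ennreal p * ?y"
    using nn_integral_speculation[OF assms(1), where \<mu> = "\<kappa> S i z" and \<nu> = "\<kappa> S0 i z0" and f = "\<lambda>_. 1"] by simp
  \<comment> \<open>Subtraction is awkward in \<open>ennreal\<close>: the kept mass
    \<open>?x\<close> is added to both sides and cancelled, being finite.\<close>
  have "ennreal p * (\<integral>\<^sup>+b. ennreal (surplus \<kappa> S0 z0 (p, S, i, z) b) \<partial>\<kappa> S i z) + ennreal (1 - p) + ?x =
    ennreal p * ((\<integral>\<^sup>+b. ennreal (surplus \<kappa> S0 z0 (p, S, i, z) b) \<partial>\<kappa> S i z) + ?y) + ennreal (1 - p)"
    by (simp only: 3 distrib_left add_ac)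
  also have "\<dots> = 1" unfolding 2 using assms by (simp flip: ennreal_plus)
  also have "\<dots> = rejection \<kappa> S0 z0 (p, S, i, z) + ?x" using 1 by simp
  finally have "?x + rejection \<kappa> S0 z0 (p, S, i, z) =
    ?x + (ennreal p * (\<integral>\<^sup>+b. ennreal (surplus \<kappa> S0 z0 (p, S, i, z) b) \<partial>\<kappa> S i z) + ennreal (1 - p))"
    by (simp only: add_ac)
  moreover have "?x \<noteq> \<infinity>" using 1 by (metis ennreal_add_eq_top ennreal_one_neq_top infinity_ennreal_def)
  ultimately show ?thesis by (simp only: ennreal_add_left_cancel infinity_ennreal_def simp_thms)
qed

lemma rejection_finite: "0 \<le> p \<Longrightarrow> rejection \<kappa> S0 z0 (p, S, i, z) \<le> 1"
proof -
  assume "0 \<le> p"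
  then have "rejection \<kappa> S0 z0 (p, S, i, z) \<le> (\<integral>\<^sup>+a. 1 \<partial>\<kappa> S0 i z0)"
    unfolding rejection_def fst_conv snd_conv using matched_range[of "(p, S, i, z)" \<kappa> S0 z0]
    by (intro nn_integral_mono) (simp add: ennreal_le_1 del: matched.simps)
  then show ?thesis by simp
qed

text \<open>Closed form of a fixed point equation. In one turn at the top frame, a test of price
  \<open>c\<close> is made with probability \<open>p\<close>, and the frame is popped otherwise. A
  failed test returns to the same frame, which has probability \<open>p\<close> times the mean of
  \<open>1 - surplus\<close>; one minus this is \<open>rejection\<close>, hence the divisor.\<close>

fun charge :: "marginals \<Rightarrow> nat set \<Rightarrow> (nat \<Rightarrow> nat) \<Rightarrow> ennreal \<Rightarrow> (nat set \<Rightarrow> (nat \<Rightarrow> nat) \<Rightarrow> ennreal) \<Rightarrow>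
    frame list \<Rightarrow> ennreal" where
  "charge \<kappa> S0 z0 c F [] = 0"
| "charge \<kappa> S0 z0 c F ((p, S, i, z) # st) =
    (ennreal p * (c + (\<integral>\<^sup>+b. ennreal (surplus \<kappa> S0 z0 (p, S, i, z) b) * F (insert i S) (z(i := b)) \<partial>\<kappa> S i z))
      + ennreal (1 - p) * charge \<kappa> S0 z0 c F st) / rejection \<kappa> S0 z0 (p, S, i, z)"

text \<open>The expected unmatched mass that a draft step hands to the new top frame is
  \<open>rejection\<close>, which cancels the divisor. If it is zero, nothing is handed over and the
  left side vanishes.\<close>

lemma charge_push:
  assumes "0 \<le> p" "p \<le> 1"
  shows "rejection \<kappa> S0 z0 (p, S, i, z) * charge \<kappa> S0 z0 c F ((p, S, i, z) # st) \<le>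
    ennreal p * (c + (\<integral>\<^sup>+b. ennreal (surplus \<kappa> S0 z0 (p, S, i, z) b) * F (insert i S) (z(i := b)) \<partial>\<kappa> S i z))
      + ennreal (1 - p) * charge \<kappa> S0 z0 c F st"
proof (cases "rejection \<kappa> S0 z0 (p, S, i, z) = 0")
  case False
  moreover have "rejection \<kappa> S0 z0 (p, S, i, z) \<noteq> \<top>" using rejection_finite[OF assms(1)] by (metis ennreal_one_neq_top neq_top_trans)
  ultimately show ?thesis by (simp add: ennreal_times_divide ennreal_mult_divide_eq mult.commute[of "rejection \<kappa> S0 z0 (p, S, i, z)"] ennreal_divide_times)
qed simp

text \<open>Unfolds one turn of the loop behind \<open>charge\<close>. For zero
  \<open>rejection\<close> the value \<open>Y\<close> is 0 or infinite according to its numerator,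
  and the inequality holds in both cases.\<close>

lemma charge_test:
  assumes "0 \<le> p" "p \<le> 1"
    and "Y = charge \<kappa> S0 z0 c F ((p, S, i, z) # st)"
  shows "ennreal p * (c + (\<integral>\<^sup>+b. ennreal (surplus \<kappa> S0 z0 (p, S, i, z) b) * F (insert i S) (z(i := b))
      + ennreal (1 - surplus \<kappa> S0 z0 (p, S, i, z) b) * Y \<partial>\<kappa> S i z))
    + ennreal (1 - p) * charge \<kappa> S0 z0 c F st \<le> Y"
proof -
  let ?D = "rejection \<kappa> S0 z0 (p, S, i, z)"
  let ?s = "\<integral>\<^sup>+b. ennreal (surplus \<kappa> S0 z0 (p, S, i, z) b) \<partial>\<kappa> S i z"
  let ?t = "\<integral>\<^sup>+b. ennreal (1 - surplus \<kappa> S0 z0 (p, S, i, z) b) \<partial>\<kappa> S i z"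
  let ?f = "\<integral>\<^sup>+b. ennreal (surplus \<kappa> S0 z0 (p, S, i, z) b) * F (insert i S) (z(i := b)) \<partial>\<kappa> S i z"
  let ?N = "ennreal p * (c + ?f) + ennreal (1 - p) * charge \<kappa> S0 z0 c F st"
  have st: "?s + ?t = 1"
    using surplus_range[of "(p, S, i, z)" \<kappa> S0 z0] assms
    by (subst nn_integral_add[symmetric]) (simp_all flip: ennreal_plus del: surplus.simps)
  have Y: "Y = ?N / ?D" using assms(3) by simp
  have lhs: "ennreal p * (c + (\<integral>\<^sup>+b. ennreal (surplus \<kappa> S0 z0 (p, S, i, z) b) * F (insert i S) (z(i := b))
      + ennreal (1 - surplus \<kappa> S0 z0 (p, S, i, z) b) * Y \<partial>\<kappa> S i z))
    + ennreal (1 - p) * charge \<kappa> S0 z0 c F st = ?N + ennreal p * ?t * Y"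
  proof -
    have "(\<integral>\<^sup>+b. ennreal (1 - surplus \<kappa> S0 z0 (p, S, i, z) b) * Y \<partial>\<kappa> S i z) = ?t * Y"
      by (rule nn_integral_multc) simp
    then show ?thesis
      by (subst nn_integral_add) (simp_all only: distrib_left add_ac mult.assoc measurable_measure_pmf measurable_count_space_eq1, simp_all)
  qed
  have D1: "?D + ennreal p * ?t = 1"
  proof -
    have "?D + ennreal p * ?t = ennreal p * (?s + ?t) + ennreal (1 - p)"
      unfolding rejection_eq[OF assms(1,2)] by (simp add: distrib_left add_ac)
    then show ?thesis unfolding st using assms(1,2) by (simp flip: ennreal_plus)
  qed
  show ?thesis
  proof (cases "?D = 0")
    case True
    show ?thesis
    proof (cases "?N = 0")
      case True
      then have "Y = 0" unfolding Y by simp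
      then show ?thesis unfolding lhs True by simp
    next
      case False
      then have "Y = \<top>" unfolding Y \<open>?D = 0\<close> by (simp add: ennreal_divide_zero)
      then show ?thesis by simp
    qed
  next
    case False
    have "?D \<noteq> \<top>" using rejection_finite[OF assms(1)] by (metis ennreal_one_neq_top neq_top_trans)
    then have "?N = ?D * Y" unfolding Y ennreal_times_divide mult.commute[of ?D]
      using False by (simp only: ennreal_mult_divide_eq simp_thms)
    then have "?N + ennreal p * ?t * Y = (?D + ennreal p * ?t) * Y" by (simp add: distrib_right)
    then show ?thesis unfolding lhs D1 by simp
  qed
qed

text \<open>\<open>B\<close> is the value of one test at the top frame with \<open>charge\<close> as
  continuation after a failure. Going down the stack, each pop is valued by the charge of what is
  left; at the bottom \<open>p = 1\<close> leaves no weight for the empty stack.\<close>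

lemma nn_integral_level_test:
  fixes B :: "frame list \<Rightarrow> ennreal" and \<kappa> :: marginals
  assumes "valid_stack n q S0 st"
    and B: "\<And>p S i z st. B ((p, S, i, z) # st) = c + (\<integral>\<^sup>+b. ennreal (surplus \<kappa> S0 z0 (p, S, i, z) b) * F (insert i S) (z(i := b))
      + ennreal (1 - surplus \<kappa> S0 z0 (p, S, i, z) b) * charge \<kappa> S0 z0 c F ((p, S, i, z) # st) \<partial>\<kappa> S i z)"
  shows "(\<integral>\<^sup>+st'. B st' \<partial>level st) \<le> charge \<kappa> S0 z0 c F st"
  using assms(1)
proof (induction st rule: level.induct)
  case (2 e)
  obtain p S i z where e: "e = (p, S, i, z)" by (metis prod.exhaust)
  then have "p = 1" using 2 by (simp add: valid_stack_def)
  then show ?case using charge_test[where p = 1 and \<kappa> = \<kappa> and ?S0.0 = S0 and ?z0.0 = z0 and S = S and i = i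
      and z = z and c = c and F = F and st = "[]", OF _ _ refl] by (simp add: e B)
next
  case (3 e e' st)
  obtain p S i z where e: "e = (p, S, i, z)" by (metis prod.exhaust)
  have p: "0 \<le> p" "p \<le> 1" using 3(2) by (auto simp: valid_stack_def e)
  have v: "valid_stack n q S0 (e' # st)" using 3(2) by (simp add: valid_stack_def)
  have "(\<integral>\<^sup>+st'. B st' \<partial>level (e # e' # st)) =
    ennreal p * B (e # e' # st) + ennreal (1 - p) * (\<integral>\<^sup>+st'. B st' \<partial>level (e' # st))"
    using p by (simp add: e nn_integral_bernoulli_mult del: nn_integral_bernoulli_pmf)
  also have "\<dots> \<le> ennreal p * B (e # e' # st) + ennreal (1 - p) * charge \<kappa> S0 z0 c F (e' # st)"
  proof (cases "p = 1")
    case False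
    then have "False \<in> set_pmf (bernoulli_pmf (fst e))" using p by (simp add: e set_pmf_iff)
    then show ?thesis using 3(1)[of False] v by (intro add_left_mono mult_left_mono) auto
  qed simp
  also have "\<dots> \<le> charge \<kappa> S0 z0 c F (e # e' # st)"
    unfolding e B by (rule charge_test[OF p refl])
  finally show ?case .
qed (simp add: valid_stack_def)

text \<open>Value of a batch of \<open>w\<close> tests: \<open>F\<close> is collected at the first
  success, \<open>\<Psi>\<close> at the stack from which the next batch resumes.\<close>

primrec race :: "marginals \<Rightarrow> nat set \<Rightarrow> (nat \<Rightarrow> nat) \<Rightarrow> (nat set \<Rightarrow> (nat \<Rightarrow> nat) \<Rightarrow> ennreal) \<Rightarrow>
    (frame list \<Rightarrow> ennreal) \<Rightarrow> nat \<Rightarrow> frame list \<Rightarrow> ennreal" where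
  "race \<kappa> S0 z0 F \<Psi> 0 st = \<Psi> st"
| "race \<kappa> S0 z0 F \<Psi> (Suc w) st = (\<integral>\<^sup>+st'. (case hd st' of (p, S, i, z) \<Rightarrow>
     \<integral>\<^sup>+b. ennreal (surplus \<kappa> S0 z0 (p, S, i, z) b) * F (insert i S) (z(i := b))
       + ennreal (1 - surplus \<kappa> S0 z0 (p, S, i, z) b) * race \<kappa> S0 z0 F \<Psi> w st' \<partial>\<kappa> S i z) \<partial>level st)"

lemma race_mono:
  "(\<And>S z. F S z \<le> F' S z) \<Longrightarrow> (\<And>st. \<Psi> st \<le> \<Psi>' st) \<Longrightarrow> race \<kappa> S0 z0 F \<Psi> w st \<le> race \<kappa> S0 z0 F' \<Psi>' w st"
proof (induction w arbitrary: st)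
  case (Suc w)
  then show ?case
    by (auto intro!: nn_integral_mono add_mono mult_left_mono simp del: surplus.simps split: prod.split)
qed simp

lemma race_add:
  "race \<kappa> S0 z0 (\<lambda>S z. F S z + F' S z) (\<lambda>st. \<Psi> st + \<Psi>' st) w st =
     race \<kappa> S0 z0 F \<Psi> w st + race \<kappa> S0 z0 F' \<Psi>' w st"
proof (induction w arbitrary: st)
  case (Suc w)
  show ?case
    by (simp add: Suc nn_integral_add[symmetric] split_def distrib_left add_ac del: surplus.simps)
qed simp

lemma race_cmult:
  "race \<kappa> S0 z0 (\<lambda>S z. c * F S z) (\<lambda>st. c * \<Psi> st) w st = c * race \<kappa> S0 z0 F \<Psi> w st"
proof (induction w arbitrary: st)
  case (Suc w)
  show ?case
    by (simp add: Suc nn_integral_cmult[symmetric] split_def distrib_left mult_ac del: surplus.simps)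
qed simp

lemma race_le_const:
  assumes "valid_stack n q S0 st"
  shows "race \<kappa> S0 z0 (\<lambda>_ _. D) (\<lambda>_. D) w st \<le> D"
  using assms
proof (induction w arbitrary: st)
  case (Suc w)
  have "race \<kappa> S0 z0 (\<lambda>_ _. D) (\<lambda>_. D) (Suc w) st \<le> (\<integral>\<^sup>+st'. D \<partial>level st)"
    unfolding race.simps
  proof (intro nn_integral_mono_AE AE_pmfI, goal_cases)
    case (1 st')
    have v: "valid_stack n q S0 st'" by (rule valid_stack_level[OF Suc.prems 1])
    obtain p S i z where e: "hd st' = (p, S, i, z)" by (metis prod.exhaust)
    have "0 \<le> p" using valid_stack_hd[OF v] by (simp add: e)
    then have s: "0 \<le> surplus \<kappa> S0 z0 (p, S, i, z) b" "surplus \<kappa> S0 z0 (p, S, i, z) b \<le> 1" for b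
      using surplus_range[of "(p, S, i, z)" \<kappa> S0 z0 b] by auto
    have "ennreal (surplus \<kappa> S0 z0 (p, S, i, z) b) * D
       + ennreal (1 - surplus \<kappa> S0 z0 (p, S, i, z) b) * race \<kappa> S0 z0 (\<lambda>_ _. D) (\<lambda>_. D) w st' \<le> D" for b
    proof -
      have "ennreal (surplus \<kappa> S0 z0 (p, S, i, z) b) * D
         + ennreal (1 - surplus \<kappa> S0 z0 (p, S, i, z) b) * race \<kappa> S0 z0 (\<lambda>_ _. D) (\<lambda>_. D) w st'
        \<le> ennreal (surplus \<kappa> S0 z0 (p, S, i, z) b) * D + ennreal (1 - surplus \<kappa> S0 z0 (p, S, i, z) b) * D"
        by (intro add_left_mono mult_left_mono Suc.IH[OF v]) auto
      also have "\<dots> = D"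
        using s by (simp flip: ennreal_plus distrib_right del: surplus.simps)
      finally show ?thesis .
    qed
    then have "(\<integral>\<^sup>+b. ennreal (surplus \<kappa> S0 z0 (p, S, i, z) b) * D
       + ennreal (1 - surplus \<kappa> S0 z0 (p, S, i, z) b) * race \<kappa> S0 z0 (\<lambda>_ _. D) (\<lambda>_. D) w st' \<partial>\<kappa> S i z)
      \<le> (\<integral>\<^sup>+b. D \<partial>\<kappa> S i z)"
      by (intro nn_integral_mono)
    then show ?case by (simp add: e del: surplus.simps)
  qed
  then show ?case by simp
qed simp

lemma race_le_1:
  assumes "valid_stack n q S0 st"
  shows "race \<kappa> S0 z0 (\<lambda>_ _. 0) (\<lambda>_. 1) w st \<le> 1"
  by (rule order_trans[OF race_mono race_le_const[OF assms, of \<kappa> z0 1 w]]) auto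

text \<open>With free tests \<open>charge\<close> is the expected value of \<open>F\<close> at the
  success. Interrupting the race after \<open>w\<close> tests and valuing the remainder again by
  \<open>charge\<close> does not raise it.\<close>

lemma race_charge_0:
  assumes "valid_stack n q S0 st"
  shows "race \<kappa> S0 z0 F (charge \<kappa> S0 z0 0 F) w st \<le> charge \<kappa> S0 z0 0 F st"
  using assms
proof (induction w arbitrary: st)
  case (Suc w)
  let ?Y = "charge \<kappa> S0 z0 0 F"
  have "race \<kappa> S0 z0 F ?Y (Suc w) st \<le> (\<integral>\<^sup>+st'. (case hd st' of (p, S, i, z) \<Rightarrow>
     0 + (\<integral>\<^sup>+b. ennreal (surplus \<kappa> S0 z0 (p, S, i, z) b) * F (insert i S) (z(i := b))
       + ennreal (1 - surplus \<kappa> S0 z0 (p, S, i, z) b) * ?Y ((p, S, i, z) # tl st') \<partial>\<kappa> S i z)) \<partial>level st)"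
    unfolding race.simps
  proof (intro nn_integral_mono_AE AE_pmfI, goal_cases)
    case (1 st')
    have v: "valid_stack n q S0 st'" by (rule valid_stack_level[OF Suc.prems 1])
    obtain p S i z where e: "hd st' = (p, S, i, z)" by (metis prod.exhaust)
    with v have "st' = (p, S, i, z) # tl st'" by (metis list.collapse valid_stack_def)
    with Suc.IH[OF v] have "race \<kappa> S0 z0 F ?Y w st' \<le> ?Y ((p, S, i, z) # tl st')" by simp
    then show ?case unfolding e prod.case add_0
      by (intro nn_integral_mono add_mono mult_left_mono order_refl) auto
  qed
  also have "\<dots> \<le> ?Y st"
    by (rule nn_integral_level_test[OF Suc.prems]) simp
  finally show ?case .
qed simp

text \<open>Each of the \<open>w\<close> tests of a batch without success is paid by the expected number of remaining tests.\<close>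

lemma race_charge_1:
  assumes "valid_stack n q S0 st"
  shows "of_nat w * race \<kappa> S0 z0 (\<lambda>_ _. 0) (\<lambda>_. 1) w st + race \<kappa> S0 z0 (\<lambda>_ _. 0) (charge \<kappa> S0 z0 1 (\<lambda>_ _. 0)) w st
    \<le> charge \<kappa> S0 z0 1 (\<lambda>_ _. 0) st"
  using assms
proof (induction w arbitrary: st)
  case (Suc w)
  let ?Y = "charge \<kappa> S0 z0 1 (\<lambda>_ _. 0)"
  let ?P = "race \<kappa> S0 z0 (\<lambda>_ _. 0) (\<lambda>_. 1)" and ?T = "race \<kappa> S0 z0 (\<lambda>_ _. 0) ?Y"
  have "of_nat (Suc w) * ?P (Suc w) st + ?T (Suc w) st =
     ?P (Suc w) st + (of_nat w * ?P (Suc w) st + ?T (Suc w) st)"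
    by (simp only: of_nat_Suc distrib_right mult_1_left add_ac)
  also have "of_nat w * ?P (Suc w) st + ?T (Suc w) st =
    (\<integral>\<^sup>+st'. (case hd st' of (p, S, i, z) \<Rightarrow>
      \<integral>\<^sup>+b. ennreal (1 - surplus \<kappa> S0 z0 (p, S, i, z) b) * (of_nat w * ?P w st' + ?T w st') \<partial>\<kappa> S i z) \<partial>level st)"
    by (simp add: nn_integral_cmult[symmetric] nn_integral_add[symmetric] split_def distrib_left mult_ac del: surplus.simps)
  \<comment> \<open>The full price 1 of the first test dominates the probability that the batch
    brings no success.\<close>
  also have "?P (Suc w) st + \<dots> \<le> (\<integral>\<^sup>+st'. 1 \<partial>level st) + \<dots>"
    using race_le_1[OF Suc.prems, of \<kappa> z0 "Suc w"] by (intro add_right_mono) (simp del: race.simps)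
  also have "\<dots> = (\<integral>\<^sup>+st'. 1 + (case hd st' of (p, S, i, z) \<Rightarrow>
      \<integral>\<^sup>+b. ennreal (1 - surplus \<kappa> S0 z0 (p, S, i, z) b) * (of_nat w * ?P w st' + ?T w st') \<partial>\<kappa> S i z) \<partial>level st)"
    by (subst nn_integral_add) simp_all
  also have "\<dots> \<le> (\<integral>\<^sup>+st'. (case hd st' of (p, S, i, z) \<Rightarrow>
     1 + (\<integral>\<^sup>+b. ennreal (surplus \<kappa> S0 z0 (p, S, i, z) b) * 0
       + ennreal (1 - surplus \<kappa> S0 z0 (p, S, i, z) b) * ?Y ((p, S, i, z) # tl st') \<partial>\<kappa> S i z)) \<partial>level st)"
  proof (intro nn_integral_mono_AE AE_pmfI, goal_cases)
    case (1 st')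
    have v: "valid_stack n q S0 st'" by (rule valid_stack_level[OF Suc.prems 1])
    obtain p S i z where e: "hd st' = (p, S, i, z)" by (metis prod.exhaust)
    with v have "st' = (p, S, i, z) # tl st'" by (metis list.collapse valid_stack_def)
    with Suc.IH[OF v] have "of_nat w * ?P w st' + ?T w st' \<le> ?Y ((p, S, i, z) # tl st')" by simp
    then show ?case unfolding e prod.case mult_zero_right add_0
      by (intro add_left_mono nn_integral_mono mult_left_mono) auto
  qed
  also have "\<dots> \<le> ?Y st"
    by (rule nn_integral_level_test[OF Suc.prems]) simp
  finally show ?case .
qed simp

text \<open>The algorithm draws the whole walk, all letters, and finally the success coins, while
  \<open>race\<close> interleaves them. The integrals may be exchanged because the walk does not
  depend on the letters.\<close>

lemma nn_integral_first_success:
  assumes "valid_stack n q S0 st"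
  shows "(\<integral>\<^sup>+lv. \<integral>\<^sup>+bs. \<integral>\<^sup>+r. (case r of Inl st' \<Rightarrow> \<Psi> st' | Inr (S, z) \<Rightarrow> F S z)
      \<partial>first_success st lv bs (map (mass \<kappa>) (test_checks S0 z0 lv bs))
      \<partial>draws \<kappa> (map site_of lv) \<partial>walk w st) = race \<kappa> S0 z0 F \<Psi> w st"
  using assms
proof (induction w arbitrary: st)
  case (Suc w)
  let ?\<psi> = "\<lambda>r. case r of Inl st' \<Rightarrow> \<Psi> st' | Inr (S, z) \<Rightarrow> F S z"
  show ?case unfolding race.simps walk.simps nn_integral_bind_pmf nn_integral_map_pmf
  proof (intro nn_integral_cong_AE AE_pmfI, goal_cases)
    case (1 st')
    have v: "valid_stack n q S0 st'" by (rule valid_stack_level[OF Suc.prems 1])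
    obtain p S i z where e: "hd st' = (p, S, i, z)" by (metis prod.exhaust)
    have p: "0 \<le> p" using valid_stack_hd[OF v] by (simp add: e)
    let ?s = "surplus \<kappa> S0 z0 (p, S, i, z)"
    let ?h = "\<lambda>lv bs. \<integral>\<^sup>+r. ?\<psi> r \<partial>first_success st' lv bs (map (mass \<kappa>) (test_checks S0 z0 lv bs))"
    have one: "(\<integral>\<^sup>+r. ?\<psi> r \<partial>first_success st (st' # lv) (b # bs)
        (map (mass \<kappa>) (test_checks S0 z0 (st' # lv) (b # bs)))) =
      ennreal (?s b) * F (insert i S) (z(i := b)) + ennreal (1 - ?s b) * ?h lv bs" for lv b bs
    proof -
      have "0 \<le> ?s b" "?s b \<le> 1" using surplus_range[of "(p, S, i, z)" \<kappa> S0 z0 b] p by auto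
      then show ?thesis using nn_integral_bernoulli_mult[of "?s b"]
        by (simp add: e del: nn_integral_bernoulli_pmf)
    qed
    have "(\<integral>\<^sup>+lv. \<integral>\<^sup>+bs. \<integral>\<^sup>+r. ?\<psi> r \<partial>first_success st (st' # lv) bs
        (map (mass \<kappa>) (test_checks S0 z0 (st' # lv) bs)) \<partial>draws \<kappa> (map site_of (st' # lv)) \<partial>walk w st')
      = (\<integral>\<^sup>+lv. \<integral>\<^sup>+b. \<integral>\<^sup>+bs. ennreal (?s b) * F (insert i S) (z(i := b)) + ennreal (1 - ?s b) * ?h lv bs
          \<partial>draws \<kappa> (map site_of lv) \<partial>\<kappa> S i z \<partial>walk w st')"
      by (simp add: e one del: first_success.simps test_checks.simps surplus.simps)
    also have "\<dots> = (\<integral>\<^sup>+b. \<integral>\<^sup>+lv. \<integral>\<^sup>+bs. ennreal (?s b) * F (insert i S) (z(i := b)) + ennreal (1 - ?s b) * ?h lv bs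
          \<partial>draws \<kappa> (map site_of lv) \<partial>walk w st' \<partial>\<kappa> S i z)"
      by (rule nn_integral_pmf_commute)
    also have "\<dots> = (\<integral>\<^sup>+b. ennreal (?s b) * F (insert i S) (z(i := b)) + ennreal (1 - ?s b) * race \<kappa> S0 z0 F \<Psi> w st' \<partial>\<kappa> S i z)"
      unfolding Suc.IH[OF v, symmetric]
      by (simp add: nn_integral_add nn_integral_cmult del: surplus.simps)
    finally show ?case by (simp add: e del: surplus.simps)
  qed
qed (simp)

section \<open>The true chain, stopped when it leaves the matched part\<close>

primrec stopped :: "marginals \<Rightarrow> nat set \<Rightarrow> (nat \<Rightarrow> nat) \<Rightarrow> ennreal \<Rightarrow> (nat set \<Rightarrow> (nat \<Rightarrow> nat) \<Rightarrow> ennreal) \<Rightarrow>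
    (nat set \<Rightarrow> (nat \<Rightarrow> nat) \<Rightarrow> ennreal) \<Rightarrow> nat list \<Rightarrow> real \<Rightarrow> nat set \<Rightarrow> (nat \<Rightarrow> nat) \<Rightarrow> ennreal" where
  "stopped \<kappa> S0 z0 c F G [] p S z = F S z"
| "stopped \<kappa> S0 z0 c F G (i # js) p S z = c + (\<integral>\<^sup>+a.
     ennreal (surplus \<kappa> S0 z0 (p, S, i, z) a) * G (insert i S) (z(i := a))
     + ennreal (1 - surplus \<kappa> S0 z0 (p, S, i, z) a)
       * stopped \<kappa> S0 z0 c F G js (matched \<kappa> S0 z0 (p, S, i, z) a) (insert i S) (z(i := a)) \<partial>\<kappa> S i z)"

text \<open>Exchanges the draft for the true chain. By \<open>nn_integral_speculation\<close> the
  kept part of a draft step is a true step that stays matched; the lost part goes to the new top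
  frame, and the assumption on \<open>Y\<close> converts it into what the true chain collects on
  leaving, \<open>G\<close>, plus the price \<open>c\<close> of the step.\<close>

lemma draft_le_stopped:
  fixes Y :: "frame list \<Rightarrow> ennreal"
  assumes Y: "\<And>p S i z st. 0 \<le> p \<Longrightarrow> p \<le> 1 \<Longrightarrow> rejection \<kappa> S0 z0 (p, S, i, z) * Y ((p, S, i, z) # st) \<le>
      ennreal p * (c + (\<integral>\<^sup>+b. ennreal (surplus \<kappa> S0 z0 (p, S, i, z) b) * G (insert i S) (z(i := b)) \<partial>\<kappa> S i z))
      + ennreal (1 - p) * Y st"
    and "0 \<le> p" "p \<le> 1"
  shows "(\<integral>\<^sup>+ys. (case trace p S z st js ys (map (mass \<kappa>) (draft_checks S0 z0 S z js ys)) of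
      (p', S', z', st') \<Rightarrow> ennreal p' * F S' z' + ennreal (1 - p') * Y st') \<partial>draws \<kappa> (map (\<lambda>i. (S0, i, z0)) js))
    \<le> ennreal p * stopped \<kappa> S0 z0 c F G js p S z + ennreal (1 - p) * Y st"
  using assms(2,3)
proof (induction js arbitrary: p S z st)
  case (Cons i js)
  let ?e = "(p, S, i, z)"
  let ?m = "matched \<kappa> S0 z0 ?e" and ?s = "surplus \<kappa> S0 z0 ?e"
  let ?Z = "\<lambda>a. stopped \<kappa> S0 z0 c F G js (?m a) (insert i S) (z(i := a))"
  have m: "0 \<le> ?m a" "?m a \<le> 1" and s: "0 \<le> ?s a" "?s a \<le> 1" for a
    using matched_range[of ?e] surplus_range[of ?e] Cons.prems by auto
  have "(\<integral>\<^sup>+ys. (case trace p S z st (i # js) ys (map (mass \<kappa>) (draft_checks S0 z0 S z (i # js) ys)) of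
      (p', S', z', st') \<Rightarrow> ennreal p' * F S' z' + ennreal (1 - p') * Y st') \<partial>draws \<kappa> (map (\<lambda>i. (S0, i, z0)) (i # js)))
    = (\<integral>\<^sup>+a. \<integral>\<^sup>+ys. (case trace (?m a) (insert i S) (z(i := a)) (?e # st) js ys
        (map (mass \<kappa>) (draft_checks S0 z0 (insert i S) (z(i := a)) js ys)) of
      (p', S', z', st') \<Rightarrow> ennreal p' * F S' z' + ennreal (1 - p') * Y st')
        \<partial>draws \<kappa> (map (\<lambda>i. (S0, i, z0)) js) \<partial>\<kappa> S0 i z0)"
    by simp
  also have "\<dots> \<le> (\<integral>\<^sup>+a. ennreal (?m a) * ?Z a + ennreal (1 - ?m a) * Y (?e # st) \<partial>\<kappa> S0 i z0)"
    using m by (intro nn_integral_mono Cons.IH)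
  also have "\<dots> = (\<integral>\<^sup>+a. ennreal (?m a) * ?Z a \<partial>\<kappa> S0 i z0) + rejection \<kappa> S0 z0 ?e * Y (?e # st)"
    unfolding rejection_def by (simp add: nn_integral_add nn_integral_multc del: matched.simps)
  also have "(\<integral>\<^sup>+a. ennreal (?m a) * ?Z a \<partial>\<kappa> S0 i z0) = ennreal p * (\<integral>\<^sup>+a. ennreal (1 - ?s a) * ?Z a \<partial>\<kappa> S i z)"
    using nn_integral_speculation[OF Cons.prems(1), where \<mu> = "\<kappa> S i z" and \<nu> = "\<kappa> S0 i z0" and f = ?Z] by simp
  also have "\<dots> + rejection \<kappa> S0 z0 ?e * Y (?e # st) \<le> \<dots> +
      (ennreal p * (c + (\<integral>\<^sup>+b. ennreal (?s b) * G (insert i S) (z(i := b)) \<partial>\<kappa> S i z)) + ennreal (1 - p) * Y st)"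
    by (intro add_left_mono Y Cons.prems)
  also have "\<dots> = ennreal p * stopped \<kappa> S0 z0 c F G (i # js) p S z + ennreal (1 - p) * Y st"
    by (simp add: nn_integral_add distrib_left add_ac del: matched.simps surplus.simps)
  finally show ?case .
qed simp

lemma trace_range:
  "0 \<le> p \<Longrightarrow> p \<le> 1 \<Longrightarrow> set ds \<subseteq> {0..} \<Longrightarrow>
     0 \<le> fst (trace p S z st js ys ds) \<and> fst (trace p S z st js ys ds) \<le> 1"
  by (induction p S z st js ys ds rule: trace.induct) auto

locale oracle_sampler = sampler n q blk for n q :: nat and blk :: "nat \<Rightarrow> nat" +
  fixes \<kappa> :: marginals
  assumes oracle_support: "\<And>S i x. valid_query n q (Sampling S i x) \<Longrightarrow> set_pmf (\<kappa> S i x) \<subseteq> {1..q}"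
begin

sublocale oracle_machine n q "pick n blk" samples checks "resume n" "ok n q" \<kappa>
  by unfold_locales (rule oracle_support)

definition settled :: "(state \<Rightarrow> ennreal) \<Rightarrow> ((nat \<Rightarrow> nat) \<Rightarrow> ennreal) \<Rightarrow> nat set \<Rightarrow> (nat \<Rightarrow> nat) \<Rightarrow> ennreal" where
  "settled V g S z = (if S = {1..n} then g z else V (Start S z))"

lemma val_settle: "(case settle n S z of Inl s \<Rightarrow> V s | Inr x \<Rightarrow> g x) = settled V g S z"
  by (simp add: settle_def settled_def)

lemma val_macro_Testing:
  assumes "ok n q (Testing S0 z0 st l j)"
  shows "val V g (macro \<kappa> (Testing S0 z0 st l j)) =
    race \<kappa> S0 z0 (settled V g) (\<lambda>st'. V (Testing S0 z0 st' l (Suc j))) (l * 2 ^ j) st"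
proof -
  have v: "valid_stack n q S0 st" using assms by simp
  show ?thesis
    unfolding nn_integral_first_success[OF v, symmetric] macro_def
    by (auto simp: val_settle intro!: nn_integral_cong split: sum.split prod.split)
qed

fun stopped_avg :: "nat set \<Rightarrow> (nat \<Rightarrow> nat) \<Rightarrow> ennreal \<Rightarrow> (nat set \<Rightarrow> (nat \<Rightarrow> nat) \<Rightarrow> ennreal) \<Rightarrow>
    (nat set \<Rightarrow> (nat \<Rightarrow> nat) \<Rightarrow> ennreal) \<Rightarrow> nat \<Rightarrow> real \<Rightarrow> nat set \<Rightarrow> (nat \<Rightarrow> nat) \<Rightarrow> ennreal" where
  "stopped_avg S0 z0 c F G 0 p S z = F S z"
| "stopped_avg S0 z0 c F G (Suc m) p S z = c + (\<integral>\<^sup>+i. \<integral>\<^sup>+a.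
     ennreal (surplus \<kappa> S0 z0 (p, S, i, z) a) * G (insert i S) (z(i := a))
     + ennreal (1 - surplus \<kappa> S0 z0 (p, S, i, z) a)
       * stopped_avg S0 z0 c F G m (matched \<kappa> S0 z0 (p, S, i, z) a) (insert i S) (z(i := a))
     \<partial>\<kappa> S i z \<partial>pmf_of_set ({1..n} - S))"

lemma nn_integral_orders_stopped:
  "(\<integral>\<^sup>+ord. stopped \<kappa> S0 z0 c F G ord p S z \<partial>orders ({1..n} - S) m) = stopped_avg S0 z0 c F G m p S z"
proof (induction m arbitrary: p S z)
  case (Suc m)
  have R: "{1..n} - S - {i} = {1..n} - insert i S" for i by auto
  have "(\<integral>\<^sup>+ord. stopped \<kappa> S0 z0 c F G ord p S z \<partial>orders ({1..n} - S) (Suc m)) =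
    (\<integral>\<^sup>+i. \<integral>\<^sup>+ord. c + (\<integral>\<^sup>+a. ennreal (surplus \<kappa> S0 z0 (p, S, i, z) a) * G (insert i S) (z(i := a))
     + ennreal (1 - surplus \<kappa> S0 z0 (p, S, i, z) a)
       * stopped \<kappa> S0 z0 c F G ord (matched \<kappa> S0 z0 (p, S, i, z) a) (insert i S) (z(i := a)) \<partial>\<kappa> S i z)
     \<partial>orders ({1..n} - insert i S) m \<partial>pmf_of_set ({1..n} - S))"
    by (simp add: R del: One_nat_def surplus.simps matched.simps)
  also have "\<dots> = (\<integral>\<^sup>+i. c + (\<integral>\<^sup>+a. \<integral>\<^sup>+ord. ennreal (surplus \<kappa> S0 z0 (p, S, i, z) a) * G (insert i S) (z(i := a))
     + ennreal (1 - surplus \<kappa> S0 z0 (p, S, i, z) a)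
       * stopped \<kappa> S0 z0 c F G ord (matched \<kappa> S0 z0 (p, S, i, z) a) (insert i S) (z(i := a))
     \<partial>orders ({1..n} - insert i S) m \<partial>\<kappa> S i z) \<partial>pmf_of_set ({1..n} - S))"
    by (subst nn_integral_pmf_commute) (simp add: nn_integral_add del: surplus.simps matched.simps)
  also have "\<dots> = stopped_avg S0 z0 c F G (Suc m) p S z"
    by (simp add: nn_integral_add nn_integral_cmult Suc del: One_nat_def fun_upd_apply surplus.simps matched.simps)
  finally show ?case .
qed simp

text \<open>A draft begins with \<open>p = 1\<close> and no frames, so the term with
  \<open>1 - p\<close> in \<open>draft_le_stopped\<close> disappears and only the stopped true chain
  remains.\<close>

lemma val_macro_Start:
  assumes S: "ok n q (Start S z)"
    and Y: "\<And>p S' i z' st. 0 \<le> p \<Longrightarrow> p \<le> 1 \<Longrightarrow>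
      rejection \<kappa> S z (p, S', i, z') * V (Testing S z ((p, S', i, z') # st) (blk (card S)) 0) \<le>
      ennreal p * (c + (\<integral>\<^sup>+b. ennreal (surplus \<kappa> S z (p, S', i, z') b) * G (insert i S') (z'(i := b)) \<partial>\<kappa> S' i z'))
      + ennreal (1 - p) * V (Testing S z st (blk (card S)) 0)"
  shows "val V g (macro \<kappa> (Start S z)) \<le> stopped_avg S z c (settled V g) G (blk (card S)) 1 S z"
proof -
  let ?l = "blk (card S)"
  let ?t = "\<lambda>ord ys. trace 1 S z [] ord ys (map (mass \<kappa>) (draft_checks S z S z ord ys))"
  have arb: "(\<integral>\<^sup>+r. (case r of Inl s \<Rightarrow> V s | Inr x \<Rightarrow> g x) \<partial>arbitrate n S z l t) =
      (case t of (p', S', z', st') \<Rightarrow> ennreal p' * settled V g S' z' + ennreal (1 - p') * V (Testing S z st' l 0))"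
    if "0 \<le> fst t" "fst t \<le> 1" for t l
    using that
    by (cases t) (simp add: arbitrate_def val_settle nn_integral_bernoulli_mult del: nn_integral_bernoulli_pmf)
  have t: "0 \<le> fst (?t ord ys)" "fst (?t ord ys) \<le> 1" for ord ys
    using trace_range[of 1 "map (mass \<kappa>) (draft_checks S z S z ord ys)" S z "[]" ord ys]
      order_trans[OF mass_range, of "{0..}" "draft_checks S z S z ord ys"] by auto
  have "val V g (macro \<kappa> (Start S z)) = (\<integral>\<^sup>+ord. \<integral>\<^sup>+ys. (case ?t ord ys of (p', S', z', st') \<Rightarrow>
      ennreal p' * settled V g S' z' + ennreal (1 - p') * V (Testing S z st' ?l 0))
      \<partial>draws \<kappa> (map (\<lambda>i. (S, i, z)) ord) \<partial>orders ({1..n} - S) ?l)"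
    using Start_orders[OF S]
    by (auto simp: macro_def arb[OF t] intro!: nn_integral_cong_AE AE_pmfI)
  also have "\<dots> \<le> (\<integral>\<^sup>+ord. ennreal 1 * stopped \<kappa> S z c (settled V g) G ord 1 S z
      + ennreal (1 - 1) * V (Testing S z [] ?l 0) \<partial>orders ({1..n} - S) ?l)"
    by (intro nn_integral_mono draft_le_stopped[where c = c and G = G] Y) auto
  also have "\<dots> = stopped_avg S z c (settled V g) G ?l 1 S z"
    by (simp add: nn_integral_orders_stopped del: One_nat_def)
  finally show ?thesis .
qed

definition forecast :: "(nat set \<Rightarrow> (nat \<Rightarrow> nat) \<Rightarrow> ennreal) \<Rightarrow> nat set \<Rightarrow> (nat \<Rightarrow> nat) \<Rightarrow> ennreal" where
  "forecast f S z = (\<integral>\<^sup>+i. \<integral>\<^sup>+a. f (insert i S) (z(i := a)) \<partial>\<kappa> S i z \<partial>pmf_of_set ({1..n} - S))"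

text \<open>Reward 1 on leaving and 0 at the end of the block: the probability that the true chain
  does not stay matched throughout.\<close>

definition stop_prob :: "nat set \<Rightarrow> (nat \<Rightarrow> nat) \<Rightarrow> nat \<Rightarrow> real \<Rightarrow> nat set \<Rightarrow> (nat \<Rightarrow> nat) \<Rightarrow> ennreal" where
  "stop_prob S0 z0 = stopped_avg S0 z0 0 (\<lambda>_ _. 0) (\<lambda>_ _. 1)"

lemma stop_prob_le_1: "0 \<le> p \<Longrightarrow> stop_prob S0 z0 m p S z \<le> 1"
proof (induction m arbitrary: p S z)
  case (Suc m)
  have "stop_prob S0 z0 (Suc m) p S z \<le> (\<integral>\<^sup>+i. \<integral>\<^sup>+a. 1 \<partial>\<kappa> S i z \<partial>pmf_of_set ({1..n} - S))"
    unfolding stop_prob_def stopped_avg.simps add_0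
  proof (intro nn_integral_mono, goal_cases)
    case (1 i a)
    let ?s = "surplus \<kappa> S0 z0 (p, S, i, z) a"
    have s: "0 \<le> ?s" "?s \<le> 1" using surplus_range[of "(p, S, i, z)"] Suc.prems by auto
    have "stop_prob S0 z0 m (matched \<kappa> S0 z0 (p, S, i, z) a) (insert i S) (z(i := a)) \<le> 1"
      using matched_range[of "(p, S, i, z)"] Suc.prems by (intro Suc.IH) auto
    then have "ennreal ?s * 1 + ennreal (1 - ?s) * stop_prob S0 z0 m (matched \<kappa> S0 z0 (p, S, i, z) a) (insert i S) (z(i := a))
      \<le> ennreal ?s * 1 + ennreal (1 - ?s) * 1"
      by (intro add_left_mono mult_left_mono) auto
    also have "\<dots> = 1" using s by (simp flip: ennreal_plus del: surplus.simps)
    finally show ?case unfolding stop_prob_def .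
  qed
  then show ?case by simp
qed (simp add: stop_prob_def)

lemma remaining:
  assumes "S \<subseteq> {1..n}" "card S < n"
  shows "finite ({1..n} - S)" "{1..n} - S \<noteq> {}" "card ({1..n} - S) = n - card S" "finite S"
proof -
  show fS: "finite S" using assms(1) finite_subset by blast
  show 1: "card ({1..n} - S) = n - card S" using assms fS by (subst card_Diff_subset) auto
  show "{1..n} - S \<noteq> {}" using 1 assms(2) by (metis card.empty zero_less_diff less_irrefl)
qed simp

lemma reveal_ok:
  assumes "S \<subseteq> {1..n}" "card S < n" "z \<in> configs q S" "i \<in> set_pmf (pmf_of_set ({1..n} - S))" "a \<in> set_pmf (\<kappa> S i z)"
  shows "i \<in> {1..n} - S" "a \<in> {1..q}" "insert i S \<subseteq> {1..n}" "card (insert i S) = Suc (card S)" "z(i := a) \<in> configs q (insert i S)"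
proof -
  show i: "i \<in> {1..n} - S" using assms(4) remaining[OF assms(1,2)] by simp
  then show a: "a \<in> {1..q}" using oracle_support[of S i z] assms by auto
  show "insert i S \<subseteq> {1..n}" using i assms(1) by auto
  show "card (insert i S) = Suc (card S)" using i remaining[OF assms(1,2)] by simp
  show "z(i := a) \<in> configs q (insert i S)" by (rule configs_upd[OF assms(3) a])
qed

text \<open>
  The bound is through the forecast of \<open>f\<close> one coordinate ahead, because every attempt fixes at
  least one coordinate; afterwards \<open>f\<close> only has to be superharmonic.
\<close>

lemma stopped_avg_le:
  assumes f: "\<And>S z. S \<subseteq> {1..n} \<Longrightarrow> card S < n \<Longrightarrow> z \<in> configs q S \<Longrightarrow> forecast f S z \<le> f S z"
    and F: "\<And>S z. S \<subseteq> {1..n} \<Longrightarrow> z \<in> configs q S \<Longrightarrow> card S = e \<Longrightarrow> F S z \<le> f S z + Q"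
    and G: "\<And>S z. S \<subseteq> {1..n} \<Longrightarrow> z \<in> configs q S \<Longrightarrow> p0 < card S \<Longrightarrow> card S \<le> e \<Longrightarrow> G S z \<le> f S z + Q + K"
    and S: "S \<subseteq> {1..n}" "z \<in> configs q S" "p0 \<le> card S" "card S + m = e" "e \<le> n" "0 \<le> p" "m > 0"
  shows "stopped_avg S0 z0 c F G m p S z \<le> forecast f S z + Q + K * stop_prob S0 z0 m p S z + c * of_nat m"
  using S
proof (induction m arbitrary: p S z)
  case (Suc m)
  have cS: "card S < n" using Suc.prems by simp
  let ?s = "\<lambda>i. surplus \<kappa> S0 z0 (p, S, i, z)" and ?m = "\<lambda>i. matched \<kappa> S0 z0 (p, S, i, z)"
  let ?D = "\<lambda>i a. stop_prob S0 z0 m (?m i a) (insert i S) (z(i := a))"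
  let ?f = "\<lambda>i a. f (insert i S) (z(i := a))"
  have "stopped_avg S0 z0 c F G (Suc m) p S z \<le> c + (\<integral>\<^sup>+i. \<integral>\<^sup>+a. ?f i a + Q
      + K * (ennreal (?s i a) * 1 + ennreal (1 - ?s i a) * ?D i a) + c * of_nat m
      \<partial>\<kappa> S i z \<partial>pmf_of_set ({1..n} - S))"
    unfolding stopped_avg.simps
  proof (intro add_left_mono nn_integral_mono_AE AE_pmfI, goal_cases)
    case (1 i a)
    note r = reveal_ok[OF Suc.prems(1) cS Suc.prems(2) 1]
    have s: "0 \<le> ?s i a" "?s i a \<le> 1" and m: "0 \<le> ?m i a" "?m i a \<le> 1"
      using surplus_range[of "(p, S, i, z)"] matched_range[of "(p, S, i, z)"] Suc.prems by auto
    have G': "G (insert i S) (z(i := a)) \<le> ?f i a + Q + K"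
      using Suc.prems r by (intro G) auto
    have Z: "stopped_avg S0 z0 c F G m (?m i a) (insert i S) (z(i := a)) \<le> ?f i a + Q + K * ?D i a + c * of_nat m"
    proof (cases m)
      case 0
      then show ?thesis using F[of "insert i S" "z(i := a)"] Suc.prems r
        by (simp add: stop_prob_def)
    next
      case (Suc m')
      have "stopped_avg S0 z0 c F G m (?m i a) (insert i S) (z(i := a))
        \<le> forecast f (insert i S) (z(i := a)) + Q + K * ?D i a + c * of_nat m"
        using Suc.prems r m Suc by (intro Suc.IH) (auto simp del: fun_upd_apply surplus.simps matched.simps)
      also have "\<dots> \<le> ?f i a + Q + K * ?D i a + c * of_nat m"
        using Suc.prems r Suc by (intro add_right_mono f) (auto simp del: fun_upd_apply)
      finally show ?thesis .
    qed
    have "ennreal (?s i a) * G (insert i S) (z(i := a))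
        + ennreal (1 - ?s i a) * stopped_avg S0 z0 c F G m (?m i a) (insert i S) (z(i := a))
      \<le> ennreal (?s i a) * (?f i a + Q + K) + ennreal (1 - ?s i a) * (?f i a + Q + K * ?D i a + c * of_nat m)"
      by (intro add_mono mult_left_mono G' Z) auto
    also have "\<dots> = (ennreal (?s i a) + ennreal (1 - ?s i a)) * (?f i a + Q)
       + K * (ennreal (?s i a) * 1 + ennreal (1 - ?s i a) * ?D i a) + ennreal (1 - ?s i a) * (c * of_nat m)"
      by (simp add: distrib_left distrib_right add_ac mult_ac del: surplus.simps matched.simps)
    also have "ennreal (?s i a) + ennreal (1 - ?s i a) = 1"
      using s by (simp flip: ennreal_plus del: surplus.simps)
    also have "1 * (?f i a + Q) + K * (ennreal (?s i a) * 1 + ennreal (1 - ?s i a) * ?D i a) + ennreal (1 - ?s i a) * (c * of_nat m)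
      \<le> 1 * (?f i a + Q) + K * (ennreal (?s i a) * 1 + ennreal (1 - ?s i a) * ?D i a) + 1 * (c * of_nat m)"
      using s by (intro add_left_mono mult_right_mono) (auto simp: ennreal_le_1 simp del: surplus.simps)
    finally show ?case by (simp only: mult_1_left)
  qed
  also have "\<dots> = forecast f S z + Q + K * stop_prob S0 z0 (Suc m) p S z + (c + c * of_nat m)"
    by (simp add: forecast_def stop_prob_def nn_integral_add nn_integral_cmult add_ac del: surplus.simps matched.simps)
  also have "c + c * of_nat m = c * of_nat (Suc m)" by (simp add: distrib_left)
  finally show ?case .
qed simp

text \<open>A draft completed by its race moves along the true chain up to a stopping time, so
  superharmonicity under single revelations passes to the algorithm. During the race,
  \<open>f\<close> is replaced by its expected value at the success.\<close>

lemma macro_potential_exact: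
  fixes f :: "nat set \<Rightarrow> (nat \<Rightarrow> nat) \<Rightarrow> ennreal"
  defines "V \<equiv> \<lambda>s. case s of Start S z \<Rightarrow> f S z | Testing S0 z0 st l j \<Rightarrow> charge \<kappa> S0 z0 0 f st"
  assumes f: "\<And>S z. S \<subseteq> {1..n} \<Longrightarrow> card S < n \<Longrightarrow> z \<in> configs q S \<Longrightarrow> forecast f S z \<le> f S z"
    and s: "ok n q s"
  shows "val V (f {1..n}) (macro \<kappa> s) \<le> V s"
proof (cases s)
  case (Start S z)
  have S: "S \<subseteq> {1..n}" "z \<in> configs q S" "card S < n"
    using s Start psubset_card_mono[of "{1..n}" S] by auto
  have "val V (f {1..n}) (macro \<kappa> (Start S z)) \<le> stopped_avg S z 0 (settled V (f {1..n})) f (blk (card S)) 1 S z"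
    by (rule val_macro_Start) (use s Start charge_push[where c = 0] in \<open>auto simp: V_def simp del: charge.simps surplus.simps\<close>)
  also have "\<dots> \<le> forecast f S z + 0 + 0 * stop_prob S z (blk (card S)) 1 S z + 0 * of_nat (blk (card S))"
    by (rule stopped_avg_le[where f = f and e = "card S + blk (card S)" and ?p0.0 = "card S"])
      (use f S blk_le[OF S(3)] blk_pos[OF S(3)] in \<open>auto simp: settled_def V_def\<close>)
  also have "\<dots> \<le> f S z" using f S by simp
  finally show ?thesis by (simp add: Start V_def)
next
  case (Testing S0 z0 st l j)
  have st: "settled V (f {1..n}) = f" by (auto simp: settled_def V_def fun_eq_iff)
  show ?thesis using s race_charge_0[of n q S0 st \<kappa> z0 f]
    unfolding Testing val_macro_Testing[OF s[unfolded Testing]] st by (simp add: V_def)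
qed

end

section \<open>Potentials for the number of queries and for the tail of the number of rounds\<close>

lemma charge_combination:
  fixes A B M :: ennreal
  assumes p: "0 \<le> p" "p \<le> 1"
  defines "Y \<equiv> \<lambda>\<kappa> S0 z0 f st. A + B * charge \<kappa> S0 z0 1 (\<lambda>_ _. 0) st + M * charge \<kappa> S0 z0 0 f st"
  shows "rejection \<kappa> S0 z0 (p, S, i, z) * Y \<kappa> S0 z0 f ((p, S, i, z) # st) \<le>
    ennreal p * (B + (\<integral>\<^sup>+b. ennreal (surplus \<kappa> S0 z0 (p, S, i, z) b) * (A + M * f (insert i S) (z(i := b))) \<partial>\<kappa> S i z))
    + ennreal (1 - p) * Y \<kappa> S0 z0 f st"
proof -
  let ?e = "(p, S, i, z)"
  let ?R = "rejection \<kappa> S0 z0 ?e"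
  let ?s = "\<integral>\<^sup>+b. ennreal (surplus \<kappa> S0 z0 ?e b) \<partial>\<kappa> S i z"
  let ?f = "\<integral>\<^sup>+b. ennreal (surplus \<kappa> S0 z0 ?e b) * f (insert i S) (z(i := b)) \<partial>\<kappa> S i z"
  let ?C = "charge \<kappa> S0 z0 1 (\<lambda>_ _. 0)" and ?O = "charge \<kappa> S0 z0 0 f"
  have C: "?R * ?C (?e # st) \<le> ennreal p + ennreal (1 - p) * ?C st"
    using charge_push[OF p, where c = 1 and F = "\<lambda>_ _. 0" and \<kappa> = \<kappa> and ?S0.0 = S0 and ?z0.0 = z0
        and S = S and i = i and z = z and st = st]
    by (simp del: charge.simps surplus.simps)
  have O: "?R * ?O (?e # st) \<le> ennreal p * ?f + ennreal (1 - p) * ?O st"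
    using charge_push[OF p, where c = 0 and F = f and \<kappa> = \<kappa> and ?S0.0 = S0 and ?z0.0 = z0
        and S = S and i = i and z = z and st = st]
    by (simp del: charge.simps surplus.simps)
  have "?R * Y \<kappa> S0 z0 f (?e # st) = A * ?R + B * (?R * ?C (?e # st)) + M * (?R * ?O (?e # st))"
    by (simp only: Y_def distrib_left mult_ac)
  also have "\<dots> \<le> A * ?R + B * (ennreal p + ennreal (1 - p) * ?C st) + M * (ennreal p * ?f + ennreal (1 - p) * ?O st)"
    by (intro add_mono mult_left_mono C O order_refl) auto
  also have "\<dots> = ennreal p * (B + (A * ?s + M * ?f)) + ennreal (1 - p) * Y \<kappa> S0 z0 f st"
    by (simp only: Y_def rejection_eq[OF p] distrib_left distrib_right mult_ac add_ac)
  also have "A * ?s + M * ?f =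
    (\<integral>\<^sup>+b. ennreal (surplus \<kappa> S0 z0 ?e b) * (A + M * f (insert i S) (z(i := b))) \<partial>\<kappa> S i z)"
  proof -
    have "(\<integral>\<^sup>+b. ennreal (surplus \<kappa> S0 z0 ?e b) * (A + M * f (insert i S) (z(i := b))) \<partial>\<kappa> S i z) =
      (\<integral>\<^sup>+b. A * ennreal (surplus \<kappa> S0 z0 ?e b) + M * (ennreal (surplus \<kappa> S0 z0 ?e b) * f (insert i S) (z(i := b))) \<partial>\<kappa> S i z)"
      by (intro nn_integral_cong) (simp only: distrib_left mult.left_commute mult.commute[of A])
    also have "\<dots> = A * ?s + M * ?f"
      by (subst nn_integral_add) (simp_all add: nn_integral_cmult del: surplus.simps)
    finally show ?thesis ..
  qed
  finally show ?thesis .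
qed

lemma race_combination:
  fixes A B D M :: ennreal
  assumes v: "valid_stack n q S0 st" and F: "\<And>S z. F S z \<le> D + M * f S z"
  shows "race \<kappa> S0 z0 F (\<lambda>st. D + A + B * charge \<kappa> S0 z0 1 (\<lambda>_ _. 0) st + M * charge \<kappa> S0 z0 0 f st) w st \<le>
    D + A * race \<kappa> S0 z0 (\<lambda>_ _. 0) (\<lambda>_. 1) w st
      + B * race \<kappa> S0 z0 (\<lambda>_ _. 0) (charge \<kappa> S0 z0 1 (\<lambda>_ _. 0)) w st + M * charge \<kappa> S0 z0 0 f st"
proof -
  let ?C = "charge \<kappa> S0 z0 1 (\<lambda>_ _. 0)" and ?O = "charge \<kappa> S0 z0 0 f"
  have "race \<kappa> S0 z0 F (\<lambda>st. D + A + B * ?C st + M * ?O st) w st \<le>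
    race \<kappa> S0 z0 (\<lambda>S z. D + A * 0 + B * 0 + M * f S z) (\<lambda>st. D + A * 1 + B * ?C st + M * ?O st) w st"
    using F by (intro race_mono) auto
  also have "\<dots> = race \<kappa> S0 z0 (\<lambda>_ _. D) (\<lambda>_. D) w st + A * race \<kappa> S0 z0 (\<lambda>_ _. 0) (\<lambda>_. 1) w st
      + B * race \<kappa> S0 z0 (\<lambda>_ _. 0) ?C w st + M * race \<kappa> S0 z0 f ?O w st"
    by (simp only: race_add race_cmult)
  also have "\<dots> \<le> D + A * race \<kappa> S0 z0 (\<lambda>_ _. 0) (\<lambda>_. 1) w st
      + B * race \<kappa> S0 z0 (\<lambda>_ _. 0) ?C w st + M * ?O st"
    by (intro add_mono mult_left_mono race_le_const[OF v] race_charge_0[OF v] order_refl) auto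
  finally show ?thesis .
qed

text \<open>With \<open>c = 0\<close> the weights \<open>p * surplus\<close> and
  \<open>1 - p\<close> integrate to \<open>rejection\<close>, so \<open>charge\<close> is an average
  of values of \<open>f\<close>, and of 0 for the empty stack. It inherits the bound 1/2 unless an
  infinite value has positive weight.\<close>

lemma charge_half:
  assumes f: "\<And>S z. f S z \<le> 1/2 \<or> f S z = \<top>" and "\<forall>e\<in>set st. 0 \<le> fst e \<and> fst e \<le> 1"
  shows "charge \<kappa> S0 z0 0 f st \<le> 1/2 \<or> charge \<kappa> S0 z0 0 f st = \<top>"
  using assms(2)
proof (induction st)
  case (Cons e st)
  obtain p S i z where e: "e = (p, S, i, z)" by (metis prod.exhaust)
  have p: "0 \<le> p" "p \<le> 1" using Cons.prems e by auto
  let ?R = "rejection \<kappa> S0 z0 e" and ?s = "surplus \<kappa> S0 z0 e"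
  let ?X = "charge \<kappa> S0 z0 0 f st"
  let ?f = "\<integral>\<^sup>+b. ennreal (?s b) * f (insert i S) (z(i := b)) \<partial>\<kappa> S i z"
  let ?N = "ennreal p * ?f + ennreal (1 - p) * ?X"
  have ch: "charge \<kappa> S0 z0 0 f (e # st) = ?N / ?R" by (simp add: e)
  have R: "?R \<noteq> \<top>" using rejection_finite[OF p(1)] unfolding e by (metis ennreal_one_neq_top neq_top_trans)
  show ?case
  proof (cases "?N = \<top>")
    case True
    then show ?thesis using R unfolding ch True by (simp add: ennreal_top_divide)
  next
    case False
    then have fin: "ennreal p * ?f \<noteq> \<top>" "ennreal (1 - p) * ?X \<noteq> \<top>" by auto
    have "ennreal p * ?f \<le> ennreal p * ((1/2) * (\<integral>\<^sup>+b. ennreal (?s b) \<partial>\<kappa> S i z))"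
    proof (cases "p = 0")
      case False
      then have "?f \<noteq> \<infinity>" using fin(1) p by (auto simp: ennreal_mult_eq_top_iff)
      \<comment> \<open>A finite integral lets \<open>f\<close> be infinite only where the surplus
        vanishes.\<close>
      then have "AE b in \<kappa> S i z. ennreal (?s b) * f (insert i S) (z(i := b)) \<noteq> \<infinity>"
        by (intro nn_integral_PInf_AE) auto
      then have "AE b in \<kappa> S i z. ennreal (?s b) * f (insert i S) (z(i := b)) \<le> (1/2) * ennreal (?s b)"
      proof (eventually_elim)
        case (elim b)
        show ?case
        proof (cases "f (insert i S) (z(i := b)) = \<top>")
          case True
          then show ?thesis using elim by (auto simp: ennreal_mult_eq_top_iff)
        next
          case False
          then have "f (insert i S) (z(i := b)) \<le> 1/2" using f by blast
          then show ?thesis by (subst mult.commute) (intro mult_right_mono, auto)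
        qed
      qed
      then have "?f \<le> (\<integral>\<^sup>+b. (1/2) * ennreal (?s b) \<partial>\<kappa> S i z)" by (rule nn_integral_mono_AE)
      also have "\<dots> = (1/2) * (\<integral>\<^sup>+b. ennreal (?s b) \<partial>\<kappa> S i z)" by (rule nn_integral_cmult) simp
      finally show ?thesis by (intro mult_left_mono) auto
    qed simp
    moreover have "ennreal (1 - p) * ?X \<le> ennreal (1 - p) * (1/2)"
    proof (cases "p = 1")
      case False
      then have "?X \<noteq> \<top>" using fin(2) p by (auto simp: ennreal_mult_eq_top_iff)
      then show ?thesis using Cons by (intro mult_left_mono) auto
    qed simp
    ultimately have "?N \<le> ennreal p * ((1/2) * (\<integral>\<^sup>+b. ennreal (?s b) \<partial>\<kappa> S i z)) + ennreal (1 - p) * (1/2)"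
      by (rule add_mono)
    also have "\<dots> = (1/2) * ?R" unfolding e rejection_eq[OF p] by (simp only: distrib_left mult_ac)
    finally have N: "?N \<le> (1/2) * ?R" .
    have "?N / ?R \<le> 1/2"
    proof (cases "?R = 0")
      case True
      then have "?N = 0" using N by simp
      then show ?thesis by (simp only: ennreal_zero_divide zero_le)
    next
      case False
      have "?N / ?R \<le> (1/2) * ?R / ?R" by (rule divide_right_mono_ennreal[OF N])
      also have "\<dots> = 1/2" using False R by (rule ennreal_mult_divide_eq)
      finally show ?thesis .
    qed
    then show ?thesis unfolding ch by blast
  qed
qed simp

context oracle_sampler
begin

fun queries :: "state \<Rightarrow> nat" where
  "queries (Start S z) = 3 * blk (card S)"
| "queries (Testing S0 z0 st l j) = 3 * (l * 2 ^ j)"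

lemma length_queries:
  assumes "ok n q s" "c \<in> set_pmf (pick n blk s)" "ys \<in> set_pmf (draws \<kappa> (samples c))"
  shows "length (samples c) + length (checks c ys) \<le> queries s"
proof (cases s)
  case (Start S z)
  then obtain ord where ord: "c = Draft S z ord" "ord \<in> set_pmf (orders ({1..n} - S) (blk (card S)))"
    using assms(2) by auto
  have "length ys = length ord" using length_draws[OF assms(3)] ord by simp
  then show ?thesis using Start_orders(1)[OF assms(1)[unfolded Start] ord(2)] Start ord length_draft_checks[of ys ord] by simp
next
  case (Testing S0 z0 st l j)
  then obtain lv where lv: "c = Tests S0 z0 st lv l j" "lv \<in> set_pmf (walk (l * 2 ^ j) st)"
    using assms(2) by auto
  have "length ys = length lv" using length_draws[OF assms(3)] lv by simp
  moreover have "length lv = l * 2 ^ j" using valid_stack_walk[OF _ lv(2)] assms(1) Testing by auto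
  ultimately show ?thesis using Testing lv length_test_checks[of ys lv] by simp
qed

lemma Start_card: "ok n q (Start S z) \<Longrightarrow> S \<subseteq> {1..n} \<and> z \<in> configs q S \<and> card S < n"
  using psubset_card_mono[of "{1..n}" S] by auto

text \<open>Each drafted coordinate and each test uses one sample and two densities. A lost batch of
  \<open>w\<close> tests is paid at rate 6 because the next batch has \<open>2 * w\<close> tests at
  rate 3. So an attempt of length \<open>l\<close> needs \<open>3 * l\<close> for the draft,
  \<open>3 * l\<close> for a first batch and \<open>6 * l\<close> for at most \<open>l\<close>
  expected tests, which gives the factor 12. Positions of attempts increase, so each position is
  charged at most once.\<close>

lemma macro_potential_queries:
  defines "W \<equiv> \<lambda>p. 12 * (\<Sum>p'\<in>{p..<n}. blk p')"
  defines "V \<equiv> \<lambda>s. case s of Start S z \<Rightarrow> of_nat (W (card S))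
    | Testing S0 z0 st l j \<Rightarrow> of_nat (3 * (l * 2 ^ j)) + 6 * charge \<kappa> S0 z0 1 (\<lambda>_ _. 0) st
        + 1 * charge \<kappa> S0 z0 0 (\<lambda>S z. of_nat (W (card S))) st"
  assumes s: "ok n q s"
  shows "of_nat (queries s) + val V (\<lambda>_. 0) (macro \<kappa> s) \<le> V s"
proof (cases s)
  case (Start S z)
  have S: "S \<subseteq> {1..n}" "z \<in> configs q S" "card S < n" using Start_card s Start by auto
  let ?l = "blk (card S)"
  have W: "W p \<le> W p'" if "p' \<le> p" for p p'
    unfolding W_def using that by (intro mult_left_mono sum_mono2) auto
  have W1: "W (card S) = 12 * ?l + W (Suc (card S))"
    unfolding W_def using S(3) by (subst sum.atLeast_Suc_lessThan) auto
  have "val V (\<lambda>_. 0) (macro \<kappa> (Start S z)) \<le>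
    stopped_avg S z 6 (settled V (\<lambda>_. 0)) (\<lambda>S z. of_nat (3 * ?l) + 1 * of_nat (W (card S))) ?l 1 S z"
    by (rule val_macro_Start[OF s[unfolded Start]])
       (use charge_combination[where A = "of_nat (3 * ?l)" and B = 6 and M = 1 and f = "\<lambda>S z. of_nat (W (card S))"]
         in \<open>simp add: V_def del: charge.simps surplus.simps\<close>)
  also have "\<dots> \<le> forecast (\<lambda>_ _. 0) S z + of_nat (W (Suc (card S))) + of_nat (3 * ?l) * stop_prob S z ?l 1 S z + 6 * of_nat ?l"
  proof (rule stopped_avg_le[where e = "card S + ?l" and ?p0.0 = "card S"])
    show "forecast (\<lambda>_ _. 0) S z \<le> 0" for S z by (simp add: forecast_def)
    show "settled V (\<lambda>_. 0) S' z' \<le> 0 + of_nat (W (Suc (card S)))" if "card S' = card S + ?l" for S' z'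
      using that blk_pos[OF S(3)] by (auto simp: settled_def V_def intro!: of_nat_mono W)
    show "of_nat (3 * ?l) + 1 * of_nat (W (card S')) \<le> 0 + of_nat (W (Suc (card S))) + (of_nat (3 * ?l) :: ennreal)"
      if "card S < card S'" for S'
      using that by (simp only: mult_1_left add_0 add.commute[of "of_nat (3 * ?l)"])
        (intro add_right_mono of_nat_mono W, simp)
  qed (use S blk_le[OF S(3)] blk_pos[OF S(3)] in auto)
  also have "\<dots> \<le> 0 + of_nat (W (Suc (card S))) + of_nat (3 * ?l) * 1 + 6 * of_nat ?l"
    by (intro add_mono mult_left_mono stop_prob_le_1 order_refl) (auto simp: forecast_def)
  also have "\<dots> = of_nat (W (Suc (card S))) + of_nat (3 * ?l) + of_nat (6 * ?l)" by simp
  also have "\<dots> = of_nat (W (Suc (card S)) + 3 * ?l + 6 * ?l)" by (simp only: of_nat_add)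
  also have "\<dots> = of_nat (W (Suc (card S)) + 9 * ?l)" by (rule arg_cong[where f = of_nat]) simp
  finally have "of_nat (queries s) + val V (\<lambda>_. 0) (macro \<kappa> s) \<le> of_nat (3 * ?l) + of_nat (W (Suc (card S)) + 9 * ?l)"
    unfolding Start queries.simps by (rule add_left_mono)
  also have "\<dots> = of_nat (3 * ?l + (W (Suc (card S)) + 9 * ?l))" by (simp only: of_nat_add)
  also have "\<dots> = of_nat (W (card S))" unfolding W1 by (rule arg_cong[where f = of_nat]) simp
  also have "\<dots> = V s" by (simp add: Start V_def)
  finally show ?thesis .
next
  case (Testing S0 z0 st l j)
  have v: "valid_stack n q S0 st" using s Testing by simp
  let ?w = "l * 2 ^ j"
  let ?C = "charge \<kappa> S0 z0 1 (\<lambda>_ _. 0)" and ?O = "charge \<kappa> S0 z0 0 (\<lambda>S z. of_nat (W (card S)))"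
  let ?P = "race \<kappa> S0 z0 (\<lambda>_ _. 0) (\<lambda>_. 1) ?w st" and ?T = "race \<kappa> S0 z0 (\<lambda>_ _. 0) ?C ?w st"
  have "val V (\<lambda>_. 0) (macro \<kappa> s) =
    race \<kappa> S0 z0 (settled V (\<lambda>_. 0)) (\<lambda>st. 0 + of_nat (6 * ?w) + 6 * ?C st + 1 * ?O st) ?w st"
    unfolding Testing val_macro_Testing[OF s[unfolded Testing]] by (simp add: V_def mult_ac)
  also have "\<dots> \<le> 0 + of_nat (6 * ?w) * ?P + 6 * ?T + 1 * ?O st"
    by (rule race_combination[OF v]) (auto simp: settled_def V_def)
  also have "\<dots> = 6 * (of_nat ?w * ?P + ?T) + ?O st"
    by (simp add: distrib_left mult.assoc)
  also have "\<dots> \<le> 6 * ?C st + ?O st"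
    by (intro add_right_mono mult_left_mono race_charge_1[OF v]) auto
  finally have "of_nat (queries s) + val V (\<lambda>_. 0) (macro \<kappa> s) \<le> of_nat (3 * ?w) + (6 * ?C st + ?O st)"
    unfolding Testing queries.simps by (rule add_left_mono)
  then show ?thesis by (simp add: Testing V_def add_ac)
qed

text \<open>\<open>A j\<close> prepays batches, \<open>B l j\<close> is a price per expected test. A
  batch of \<open>w\<close> tests without success has consumed \<open>w\<close> expected tests, so
  \<open>B l (Suc j) * w\<close> can help to fund the following batch. The bound 1/2 on
  \<open>f\<close> turns additive losses into a factor: \<open>(1 + \<eta>) * (1 + 2 * f)\<close>
  exceeds \<open>1 + 2 * f\<close> by at most \<open>2 * \<eta>\<close>.\<close>

lemma macro_potential_exp:
  fixes f :: "nat set \<Rightarrow> (nat \<Rightarrow> nat) \<Rightarrow> ennreal" and A :: "nat \<Rightarrow> real" and B :: "nat \<Rightarrow> nat \<Rightarrow> real" and \<eta> :: real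
  defines "U \<equiv> \<lambda>s. case s of Start S z \<Rightarrow> 1 + 2 * f S z
    | Testing S0 z0 st l j \<Rightarrow> 1 + ennreal (2 * A j) + ennreal (2 * B l j) * charge \<kappa> S0 z0 1 (\<lambda>_ _. 0) st
        + 2 * charge \<kappa> S0 z0 0 f st"
  assumes f: "\<And>S z. f S z \<le> 1/2 \<or> f S z = \<top>" and \<eta>: "\<eta> \<ge> 0"
    and B: "\<And>l j. l \<ge> 1 \<Longrightarrow> 0 < B l j" "\<And>l j. l \<ge> 1 \<Longrightarrow> (1 + \<eta>) * B l (Suc j) \<le> B l j"
    and A: "\<And>j. \<eta> \<le> A j" "\<And>l j. l \<ge> 1 \<Longrightarrow> \<eta> + (1 + \<eta>) * A (Suc j) \<le> A j + (1 + \<eta>) * B l (Suc j) * real (l * 2 ^ j)"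
    and start: "\<And>S z. S \<subseteq> {1..n} \<Longrightarrow> z \<in> configs q S \<Longrightarrow> card S < n \<Longrightarrow>
      ennreal (1 + \<eta>) * stopped_avg S z (ennreal (2 * B (blk (card S)) 0)) (\<lambda>S z. 1 + 2 * f S z)
        (\<lambda>S z. 1 + ennreal (2 * A 0) + 2 * f S z) (blk (card S)) 1 S z \<le> 1 + 2 * f S z"
    and s: "ok n q s"
  shows "ennreal (1 + \<eta>) * val U (\<lambda>_. 1) (macro \<kappa> s) \<le> U s"
proof (cases s)
  case (Start S z)
  have S: "S \<subseteq> {1..n}" "z \<in> configs q S" "card S < n" using Start_card s Start by auto
  let ?l = "blk (card S)"
  have mono: "stopped_avg S0 z0 c F G m p S z \<le> stopped_avg S0 z0 c F' G m p S z" if "\<And>S z. F S z \<le> F' S z"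
    for S0 z0 c F F' G m p S z
    using that by (induction m arbitrary: p S z)
      (auto intro!: add_mono nn_integral_mono mult_left_mono simp del: surplus.simps)
  have "val U (\<lambda>_. 1) (macro \<kappa> (Start S z)) \<le>
    stopped_avg S z (ennreal (2 * B ?l 0)) (settled U (\<lambda>_. 1)) (\<lambda>S z. 1 + ennreal (2 * A 0) + 2 * f S z) ?l 1 S z"
    by (rule val_macro_Start[OF s[unfolded Start]])
       (use charge_combination[where A = "1 + ennreal (2 * A 0)" and B = "ennreal (2 * B ?l 0)" and M = 2 and f = f]
         in \<open>simp add: U_def del: charge.simps surplus.simps\<close>)
  also have "\<dots> \<le> stopped_avg S z (ennreal (2 * B ?l 0)) (\<lambda>S z. 1 + 2 * f S z)
      (\<lambda>S z. 1 + ennreal (2 * A 0) + 2 * f S z) ?l 1 S z"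
    by (rule mono) (auto simp: settled_def U_def)
  finally have "ennreal (1 + \<eta>) * val U (\<lambda>_. 1) (macro \<kappa> (Start S z)) \<le> ennreal (1 + \<eta>) * \<dots>"
    by (rule mult_left_mono) simp
  also have "\<dots> \<le> 1 + 2 * f S z" by (rule start[OF S])
  finally show ?thesis by (simp add: Start U_def)
next
  case (Testing S0 z0 st l j)
  have v: "valid_stack n q S0 st" and l: "l \<ge> 1" using s Testing by simp_all
  let ?w = "l * 2 ^ j"
  let ?C = "charge \<kappa> S0 z0 1 (\<lambda>_ _. 0)" and ?O = "charge \<kappa> S0 z0 0 f"
  let ?P = "race \<kappa> S0 z0 (\<lambda>_ _. 0) (\<lambda>_. 1) ?w st" and ?T = "race \<kappa> S0 z0 (\<lambda>_ _. 0) ?C ?w st"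
  have "val U (\<lambda>_. 1) (macro \<kappa> s) = race \<kappa> S0 z0 (settled U (\<lambda>_. 1))
      (\<lambda>st. 1 + ennreal (2 * A (Suc j)) + ennreal (2 * B l (Suc j)) * ?C st + 2 * ?O st) ?w st"
    unfolding Testing val_macro_Testing[OF s[unfolded Testing]] by (simp add: U_def)
  also have "\<dots> \<le> 1 + ennreal (2 * A (Suc j)) * ?P + ennreal (2 * B l (Suc j)) * ?T + 2 * ?O st"
    by (rule race_combination[OF v]) (auto simp: settled_def U_def)
  finally have val: "val U (\<lambda>_. 1) (macro \<kappa> s) \<le>
    1 + ennreal (2 * A (Suc j)) * ?P + ennreal (2 * B l (Suc j)) * ?T + 2 * ?O st" .
  have U: "U s = 1 + ennreal (2 * A j) + ennreal (2 * B l j) * ?C st + 2 * ?O st"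
    by (simp add: Testing U_def)
  show ?thesis
  proof (cases "?C st = \<top> \<or> ?O st = \<top>")
    case True
    then have "U s = \<top>" unfolding U using B(1)[OF l, of j] by (auto simp: ennreal_mult_eq_top_iff)
    then show ?thesis by simp
  next
    case False
    have wPT: "of_nat ?w * ?P + ?T \<le> ?C st" by (rule race_charge_1[OF v])
    have P1: "?P \<le> 1" by (rule race_le_1[OF v])
    have half: "(1/2 :: ennreal) = ennreal (1/2)"
      by (metis divide_ennreal ennreal_1 ennreal_numeral zero_le_one zero_less_numeral)
    have "?O st \<le> ennreal (1/2)"
      using charge_half[of f st \<kappa> S0 z0] f False v unfolding half by (force simp: valid_stack_def)
    moreover obtain Ov where Ov: "?O st = ennreal Ov" "Ov \<ge> 0" using False by (cases "?O st") auto
    ultimately have O2: "Ov \<le> 1/2" by (simp only: ennreal_le_iff zero_le_divide_1_iff zero_le_numeral)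
    obtain C where C: "?C st = ennreal C" "C \<ge> 0" using False by (cases "?C st") auto
    have "?T \<noteq> \<top>" using wPT False by (metis add_top neq_top_trans ennreal_add_eq_top)
    then obtain T where T: "?T = ennreal T" "T \<ge> 0" by (cases "?T") auto
    have "?P \<noteq> \<top>" using P1 by (metis ennreal_one_neq_top neq_top_trans)
    then obtain P where P: "?P = ennreal P" "P \<ge> 0" by (cases "?P") auto
    have r: "Ov \<le> 1/2" "P \<le> 1" "real ?w * P + T \<le> C"
      using P1 wPT C T P O2
      by (simp_all add: ennreal_of_nat_eq_real_of_nat ennreal_le_1 flip: ennreal_mult ennreal_plus)
    have Bp: "B l j > 0" "B l (Suc j) > 0" using B(1)[OF l] by auto
    have Ap: "A j \<ge> 0" "A (Suc j) \<ge> 0" using A(1) \<eta> order_trans by blast+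
    have 1: "(1 + \<eta>) * (1 + 2 * Ov) \<le> 1 + 2 * Ov + 2 * \<eta>"
      using mult_left_mono[OF r(1) \<eta>] by (simp add: algebra_simps)
    have 2: "(1 + \<eta>) * B l (Suc j) * T \<le> (1 + \<eta>) * B l (Suc j) * (C - real ?w * P)"
      using r(3) Bp \<eta> by (intro mult_left_mono) auto
    have 3: "(1 + \<eta>) * B l (Suc j) * C \<le> B l j * C" using B(2)[OF l] C(2) by (intro mult_right_mono)
    have 4: "P * ((1 + \<eta>) * A (Suc j) - (1 + \<eta>) * B l (Suc j) * real ?w) \<le> P * (A j - \<eta>)"
      using A(2)[OF l, of j] P(2) by (intro mult_left_mono) auto
    have 5: "P * (A j - \<eta>) \<le> 1 * (A j - \<eta>)" using r(2) A(1)[of j] by (intro mult_right_mono) auto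
    have "(1 + \<eta>) * (1 + 2 * A (Suc j) * P + 2 * B l (Suc j) * T + 2 * Ov) \<le> 1 + 2 * A j + 2 * B l j * C + 2 * Ov"
      using 1 2 3 4 5 by (simp add: algebra_simps)
    then have "ennreal ((1 + \<eta>) * (1 + 2 * A (Suc j) * P + 2 * B l (Suc j) * T + 2 * Ov)) \<le>
      ennreal (1 + 2 * A j + 2 * B l j * C + 2 * Ov)" by (rule ennreal_leI)
    also have "ennreal ((1 + \<eta>) * (1 + 2 * A (Suc j) * P + 2 * B l (Suc j) * T + 2 * Ov)) =
      ennreal (1 + \<eta>) * (1 + ennreal (2 * A (Suc j)) * ?P + ennreal (2 * B l (Suc j)) * ?T + 2 * ?O st)"
      using Ap Bp \<eta> P T Ov by (simp add: ennreal_mult ennreal_plus)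
    also have "ennreal (1 + 2 * A j + 2 * B l j * C + 2 * Ov) = U s"
      unfolding U using Ap Bp C Ov by (simp add: ennreal_mult ennreal_plus)
    finally show ?thesis using val by (meson mult_left_mono order_trans zero_le)
  qed
qed

end

section \<open>The matched fraction as a stopped likelihood ratio\<close>

text \<open>
  Along the true chain \<open>1 / sqrt p\<close> is a reflected supermartingale, and the chain stops when it is
  reflected at 1. The potential \<open>keep\<close> is quadratic in it near 1, so that its expected loss
  per step is of the order of the relative entropy of that step, while its total variation
  is only \<open>\<alpha>\<close>. This replaces Doob's maximal inequality.
\<close>

definition keep :: "real \<Rightarrow> real \<Rightarrow> real" where
  "keep \<alpha> p = 1 - (max 0 (1 + \<alpha> - 1 / sqrt p))\<^sup>2 / \<alpha>"

lemma keep_le_1: "\<alpha> > 0 \<Longrightarrow> keep \<alpha> p \<le> 1"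
  by (simp add: keep_def)

lemma keep_1: "\<alpha> > 0 \<Longrightarrow> keep \<alpha> 1 = 1 - \<alpha>"
  by (simp add: keep_def max_def power2_eq_square)

text \<open>Here \<open>x\<close> is \<open>1 / sqrt\<close> of the fraction before reflection. For
  \<open>x \<ge> 1\<close> both sides agree. For \<open>x < 1\<close> the chain survives with
  probability \<open>x ^ 2\<close> and continues with \<open>keep \<alpha> 1\<close>; the difference
  of the two quadratics has the root \<open>x = 1\<close>, which gives the factorization
  below.\<close>

lemma keep_reflected:
  assumes "0 < \<alpha>" "\<alpha> \<le> 1" "0 < x"
  shows "1 - (max 0 (1 + \<alpha> - x))\<^sup>2 / \<alpha> \<le> min 1 (x\<^sup>2) * keep \<alpha> (min 1 (1 / x\<^sup>2))"
proof (cases "x \<ge> 1")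
  case True
  then have "1 \<le> x\<^sup>2" by (rule one_le_power)
  moreover from this have "1 / x\<^sup>2 \<le> 1" by (subst divide_le_eq_1) linarith
  ultimately have "min 1 (x\<^sup>2) = 1" "min 1 (1 / x\<^sup>2) = 1 / x\<^sup>2" by (simp_all add: min_absorb1 min_absorb2)
  moreover have "1 / sqrt (1 / x\<^sup>2) = x" using assms by (simp add: real_sqrt_divide)
  ultimately show ?thesis by (simp add: keep_def)
next
  case False
  then have x: "x < 1" by simp
  have m: "min 1 (x\<^sup>2) = x\<^sup>2" "min 1 (1 / x\<^sup>2) = 1"
    using x assms power_le_one[of x 2] by (auto simp: min_def field_simps)
  have mx: "max 0 (1 + \<alpha> - x) = 1 + \<alpha> - x" using x assms by simp
  have "0 \<le> (1 - x) * ((1 + \<alpha> + \<alpha>\<^sup>2) - (1 + \<alpha> - \<alpha>\<^sup>2) * x)"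
  proof (intro mult_nonneg_nonneg)
    have "\<alpha> * \<alpha> \<le> 1 * 1" using assms by (intro mult_mono) auto
    then have "(1 + \<alpha> - \<alpha>\<^sup>2) * x \<le> (1 + \<alpha> - \<alpha>\<^sup>2) * 1"
      using assms x by (intro mult_left_mono) (auto simp: power2_eq_square)
    also have "\<dots> \<le> 1 + \<alpha> + \<alpha>\<^sup>2" by simp
    finally show "0 \<le> (1 + \<alpha> + \<alpha>\<^sup>2) - (1 + \<alpha> - \<alpha>\<^sup>2) * x" by simp
  qed (use x in simp)
  also have "\<dots> = \<alpha> * (x\<^sup>2 * (1 - \<alpha>)) - (\<alpha> - (1 + \<alpha> - x)\<^sup>2)"
    by (simp add: power2_eq_square algebra_simps)
  finally have "\<alpha> - (1 + \<alpha> - x)\<^sup>2 \<le> \<alpha> * (x\<^sup>2 * (1 - \<alpha>))" by simp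
  then have "(\<alpha> - (1 + \<alpha> - x)\<^sup>2) / \<alpha> \<le> x\<^sup>2 * (1 - \<alpha>)"
    using assms by (simp add: divide_le_eq mult.commute)
  then show ?thesis unfolding m mx keep_1[OF assms(1)] using assms by (simp add: diff_divide_distrib)
qed

text \<open>\<open>v\<close> is the square root of the likelihood ratio of the draft to the true law
  in one step. As \<open>keep\<close> is constant once \<open>1 / sqrt p\<close> exceeds
  \<open>1 + \<alpha>\<close>, the factor \<open>w\<close> may be truncated there, which keeps the
  coefficients of the loss bounded.\<close>

lemma keep_step:
  assumes "0 < \<alpha>" "\<alpha> \<le> 1" "0 < p" "p \<le> 1" "0 < v"
  defines "w \<equiv> min (1 / sqrt p) (1 + \<alpha>)"
  shows "keep \<alpha> p - (2 * (1 + \<alpha> - w) * w * (1 - v) + w\<^sup>2 * (1 - v)\<^sup>2) / \<alpha> \<le>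
    min 1 (v\<^sup>2 / p) * keep \<alpha> (min 1 (p / v\<^sup>2))"
proof -
  have sq: "sqrt p > 0" "sqrt p \<le> 1" using assms by auto
  then have w: "0 < w" "w \<le> 1 / sqrt p" "w \<le> 1 + \<alpha>" using assms by (auto simp: w_def)
  have kp: "keep \<alpha> p = 1 - (1 + \<alpha> - w)\<^sup>2 / \<alpha>" by (auto simp: keep_def w_def max_def min_def)
  define x where "x = v / sqrt p"
  have x: "x > 0" "x\<^sup>2 = v\<^sup>2 / p" "1 / x\<^sup>2 = p / v\<^sup>2"
    using assms sq by (auto simp: x_def power_divide)
  have "w * v \<le> x" using mult_right_mono[OF w(2), of v] assms(5) by (simp add: x_def)
  then have "max 0 (1 + \<alpha> - x) \<le> \<bar>1 + \<alpha> - w * v\<bar>" by auto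
  then have "(max 0 (1 + \<alpha> - x))\<^sup>2 \<le> (1 + \<alpha> - w * v)\<^sup>2"
    by (metis abs_ge_zero max.cobounded1 power2_abs power_mono)
  also have "\<dots> = (1 + \<alpha> - w)\<^sup>2 + (2 * (1 + \<alpha> - w) * w * (1 - v) + w\<^sup>2 * (1 - v)\<^sup>2)"
    by (simp add: power2_eq_square algebra_simps)
  finally have "(max 0 (1 + \<alpha> - x))\<^sup>2 / \<alpha> \<le>
    (1 + \<alpha> - w)\<^sup>2 / \<alpha> + (2 * (1 + \<alpha> - w) * w * (1 - v) + w\<^sup>2 * (1 - v)\<^sup>2) / \<alpha>"
    using assms(1) by (simp add: divide_right_mono flip: add_divide_distrib)
  moreover have "1 - (max 0 (1 + \<alpha> - x))\<^sup>2 / \<alpha> \<le> min 1 (v\<^sup>2 / p) * keep \<alpha> (min 1 (p / v\<^sup>2))"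
    using keep_reflected[OF assms(1,2) x(1), unfolded x(3), unfolded x(2)] .
  ultimately show ?thesis unfolding kp by linarith
qed

text \<open>\<open>E1\<close> and \<open>E2\<close> are of Hellinger type:
  \<open>ln v \<le> v - 1\<close> gives \<open>2 * E1 \<le> KL\<close>, and expanding the square
  gives \<open>E2 \<le> 2 * E1\<close>. As \<open>g * w \<le> 2\<close> and
  \<open>w ^ 2 \<le> 4\<close>, the loss is at most \<open>(2 + 4) * KL / \<alpha>\<close>, the
  origin of the 6.\<close>

lemma keep_sum:
  fixes \<mu> \<nu> :: "'a \<Rightarrow> real"
  assumes \<alpha>: "0 < \<alpha>" "\<alpha> \<le> 1" and p: "0 < p" "p \<le> 1"
    and \<mu>: "\<And>a. a \<in> X \<Longrightarrow> \<mu> a \<ge> 0" "sum \<mu> X = 1"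
    and \<nu>: "\<And>a. a \<in> X \<Longrightarrow> \<nu> a \<ge> 0" "sum \<nu> X \<le> 1"
    and ac: "\<And>a. a \<in> X \<Longrightarrow> \<mu> a > 0 \<Longrightarrow> \<nu> a > 0"
  shows "keep \<alpha> p - 6 / \<alpha> * (\<Sum>a\<in>X. \<mu> a * ln (\<mu> a / \<nu> a)) \<le>
      (\<Sum>a\<in>X. \<mu> a * (min 1 (\<nu> a / (p * \<mu> a)) * keep \<alpha> (min 1 (p * (\<mu> a / \<nu> a)))))"
    and "0 \<le> (\<Sum>a\<in>X. \<mu> a * ln (\<mu> a / \<nu> a))"
proof -
  define v where "v a = sqrt (\<nu> a / \<mu> a)" for a
  define w where "w = min (1 / sqrt p) (1 + \<alpha>)"
  define g where "g = 1 + \<alpha> - w"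
  define KL where "KL = (\<Sum>a\<in>X. \<mu> a * ln (\<mu> a / \<nu> a))"
  define E1 where "E1 = (\<Sum>a\<in>X. \<mu> a * (1 - v a))"
  define E2 where "E2 = (\<Sum>a\<in>X. \<mu> a * (1 - v a)\<^sup>2)"
  have "1 \<le> 1 / sqrt p" using p by simp
  then have w: "1 \<le> w" "w \<le> 1 + \<alpha>" using \<alpha> by (auto simp: w_def)
  have g: "0 \<le> g" "g \<le> \<alpha>" using w by (auto simp: g_def)
  have "\<mu> a * (1 - v a)\<^sup>2 \<le> 2 * (\<mu> a * (1 - v a)) + (\<nu> a - \<mu> a)" if "a \<in> X" for a
  proof (cases "\<mu> a = 0")
    case False
    then have "\<mu> a > 0" using \<mu>(1)[OF that] by simp
    moreover from this have "\<nu> a > 0" using ac that by simp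
    ultimately have "\<mu> a * (v a)\<^sup>2 = \<nu> a" by (simp add: v_def)
    then show ?thesis by (simp add: power2_diff algebra_simps)
  qed (use \<nu>(1)[OF that] in simp)
  then have "E2 \<le> (\<Sum>a\<in>X. 2 * (\<mu> a * (1 - v a)) + (\<nu> a - \<mu> a))" unfolding E2_def by (rule sum_mono)
  also have "\<dots> = 2 * E1 + (sum \<nu> X - sum \<mu> X)"
    by (simp add: E1_def sum.distrib sum_subtractf sum_distrib_left)
  finally have E2: "E2 \<le> 2 * E1" using \<mu>(2) \<nu>(2) by simp
  have "\<mu> a * (1 - v a) \<le> \<mu> a * ln (\<mu> a / \<nu> a) / 2" if "a \<in> X" for a
  proof (cases "\<mu> a = 0")
    case False
    then have pos: "\<mu> a > 0" using \<mu>(1)[OF that] by simp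
    moreover from this have pos': "\<nu> a > 0" using ac that by simp
    ultimately have "v a > 0" by (simp add: v_def)
    then have "ln (v a) \<le> v a - 1" by (rule ln_le_minus_one)
    moreover have "ln (v a) = - ln (\<mu> a / \<nu> a) / 2"
      using pos pos' by (simp add: v_def ln_sqrt ln_div)
    ultimately have "1 - v a \<le> ln (\<mu> a / \<nu> a) / 2" by simp
    then have "\<mu> a * (1 - v a) \<le> \<mu> a * (ln (\<mu> a / \<nu> a) / 2)" using pos by (intro mult_left_mono) auto
    then show ?thesis by simp
  qed simp
  then have "E1 \<le> (\<Sum>a\<in>X. \<mu> a * ln (\<mu> a / \<nu> a) / 2)" unfolding E1_def by (rule sum_mono)
  then have E1: "2 * E1 \<le> KL" by (simp add: KL_def flip: sum_divide_distrib)
  have "0 \<le> E2" unfolding E2_def using \<mu>(1) by (intro sum_nonneg) auto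
  with E1 E2 have KL0: "0 \<le> KL" by simp
  then show "0 \<le> (\<Sum>a\<in>X. \<mu> a * ln (\<mu> a / \<nu> a))" by (simp add: KL_def)
  have "\<mu> a * (keep \<alpha> p - (2 * g * w * (1 - v a) + w\<^sup>2 * (1 - v a)\<^sup>2) / \<alpha>) \<le>
      \<mu> a * (min 1 (\<nu> a / (p * \<mu> a)) * keep \<alpha> (min 1 (p * (\<mu> a / \<nu> a))))" if "a \<in> X" for a
  proof (cases "\<mu> a = 0")
    case False
    then have pos: "\<mu> a > 0" using \<mu>(1)[OF that] by simp
    then have pos': "\<nu> a > 0" using ac that by simp
    have v: "v a > 0" "(v a)\<^sup>2 / p = \<nu> a / (p * \<mu> a)" "p / (v a)\<^sup>2 = p * (\<mu> a / \<nu> a)"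
      using pos pos' by (auto simp: v_def field_simps)
    show ?thesis using keep_step[OF \<alpha> p v(1)] pos unfolding v g_def w_def
      by (intro mult_left_mono) auto
  qed simp
  then have "(\<Sum>a\<in>X. \<mu> a * (keep \<alpha> p - (2 * g * w * (1 - v a) + w\<^sup>2 * (1 - v a)\<^sup>2) / \<alpha>)) \<le>
      (\<Sum>a\<in>X. \<mu> a * (min 1 (\<nu> a / (p * \<mu> a)) * keep \<alpha> (min 1 (p * (\<mu> a / \<nu> a)))))" by (rule sum_mono)
  moreover have "(\<Sum>a\<in>X. \<mu> a * (keep \<alpha> p - (2 * g * w * (1 - v a) + w\<^sup>2 * (1 - v a)\<^sup>2) / \<alpha>)) =
    keep \<alpha> p - (2 * g * w * E1 + w\<^sup>2 * E2) / \<alpha>"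
  proof -
    have "(\<Sum>a\<in>X. \<mu> a * (keep \<alpha> p - (2 * g * w * (1 - v a) + w\<^sup>2 * (1 - v a)\<^sup>2) / \<alpha>)) =
      (\<Sum>a\<in>X. \<mu> a * keep \<alpha> p - (2 * g * w * (\<mu> a * (1 - v a)) + w\<^sup>2 * (\<mu> a * (1 - v a)\<^sup>2)) / \<alpha>)"
      by (intro sum.cong refl) (simp add: algebra_simps add_divide_distrib)
    also have "\<dots> = sum \<mu> X * keep \<alpha> p - (2 * g * w * E1 + w\<^sup>2 * E2) / \<alpha>"
      by (simp only: E1_def E2_def sum_subtractf sum.distrib sum_distrib_left sum_distrib_right flip: sum_divide_distrib)
    finally show ?thesis by (simp add: \<mu>(2))
  qed
  moreover have "2 * g * w * E1 + w\<^sup>2 * E2 \<le> 6 * KL"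
  proof -
    have "g * w \<le> 1 * 2" using g w \<alpha> by (intro mult_mono) auto
    then have "(g * w) * (2 * E1) \<le> 2 * KL"
      using E1 E2 \<open>0 \<le> E2\<close> by (intro mult_mono) auto
    moreover have "w\<^sup>2 \<le> 2\<^sup>2" using w \<alpha> by (intro power_mono) auto
    then have "w\<^sup>2 * E2 \<le> 4 * KL" using E1 E2 \<open>0 \<le> E2\<close> by (intro mult_mono) auto
    ultimately show ?thesis by simp
  qed
  then have "(2 * g * w * E1 + w\<^sup>2 * E2) / \<alpha> \<le> 6 / \<alpha> * KL"
    using \<alpha>(1) by (simp add: divide_right_mono)
  ultimately show "keep \<alpha> p - 6 / \<alpha> * (\<Sum>a\<in>X. \<mu> a * ln (\<mu> a / \<nu> a)) \<le>
      (\<Sum>a\<in>X. \<mu> a * (min 1 (\<nu> a / (p * \<mu> a)) * keep \<alpha> (min 1 (p * (\<mu> a / \<nu> a)))))"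
    unfolding KL_def by linarith
qed

section \<open>Entropy along random revelations\<close>

locale target_sampler = sampler n q blk for n q :: nat and blk :: "nat \<Rightarrow> nat" +
  fixes \<pi> :: "(nat \<Rightarrow> nat) pmf" and \<kappa> :: marginals
  assumes target: "distribution_on_configs n q \<pi>"
    and marginals: "conditional_marginals n q \<pi> \<kappa>"
begin

lemma marginals_support: "S \<subseteq> {1..n} \<Longrightarrow> i \<in> {1..n} - S \<Longrightarrow> x \<in> configs q S \<Longrightarrow> set_pmf (\<kappa> S i x) \<subseteq> {1..q}"
  using marginals unfolding conditional_marginals_def by blast

sublocale oracle_sampler n q blk \<kappa>
proof
  fix S i x assume "valid_query n q (Sampling S i x)"
  then show "set_pmf (\<kappa> S i x) \<subseteq> {1..q}" by (intro marginals_support) auto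
qed

definition Pr :: "nat set \<Rightarrow> (nat \<Rightarrow> nat) \<Rightarrow> real" where
  "Pr S z = measure_pmf.prob \<pi> {X. restrict X S = z}"

definition pos :: "nat set \<Rightarrow> (nat \<Rightarrow> nat) \<Rightarrow> bool" where
  "pos S z \<longleftrightarrow> S \<subseteq> {1..n} \<and> z \<in> configs q S \<and> Pr S z > 0"

lemma restrict_insert_eq_iff:
  assumes "z \<in> configs q S" "i \<notin> S"
  shows "restrict X (insert i S) = z(i := a) \<longleftrightarrow> restrict X S = z \<and> X i = a"
proof -
  have z: "z j = undefined" if "j \<notin> S" for j
    using assms(1) that unfolding configs_def by (rule PiE_arb)
  show ?thesis
  proof safe
    assume e: "restrict X (insert i S) = z(i := a)"
    show "X i = a" using fun_cong[OF e, of i] by simp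
    show "restrict X S = z"
    proof
      fix j show "restrict X S j = z j"
        using fun_cong[OF e, of j] z[of j] assms(2) by (auto simp: restrict_def split: if_splits)
    qed
  qed (use assms(2) in \<open>auto simp: fun_eq_iff restrict_def\<close>)
qed

text \<open>The chain rule. On a null \<open>z\<close> the kernel is arbitrary, but both sides are
  0.\<close>

lemma Pr_marginal:
  assumes "S \<subseteq> {1..n}" "i \<in> {1..n} - S" "z \<in> configs q S"
  shows "Pr S z * pmf (\<kappa> S i z) a = Pr (insert i S) (z(i := a))"
proof -
  let ?E = "{X. restrict X S = z}"
  have E: "{X. restrict X (insert i S) = z(i := a)} = ?E \<inter> ((\<lambda>X. X i) -` {a})"
    using restrict_insert_eq_iff[OF assms(3)] assms(2) by auto
  show ?thesis
  proof (cases "Pr S z = 0")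
    case True
    then have "Pr (insert i S) (z(i := a)) \<le> 0"
      unfolding Pr_def E using measure_pmf.finite_measure_mono[of "?E \<inter> ((\<lambda>X. X i) -` {a})" ?E \<pi>] by simp
    then show ?thesis using True by (simp add: Pr_def measure_le_0_iff)
  next
    case False
    then have p: "Pr S z > 0" by (simp add: Pr_def zero_less_measure_iff)
    then have "\<kappa> S i z = map_pmf (\<lambda>X. X i) (cond_pmf \<pi> ?E)"
      using marginals assms unfolding conditional_marginals_def Pr_def by blast
    then have "pmf (\<kappa> S i z) a = measure (measure_pmf (cond_pmf \<pi> ?E)) ((\<lambda>X. X i) -` {a})"
      by (simp add: pmf_map)
    also have ne: "set_pmf \<pi> \<inter> ?E \<noteq> {}"
      using p unfolding Pr_def by (auto simp: measure_pmf_zero_iff zero_less_measure_iff)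
    then have "measure_pmf (cond_pmf \<pi> ?E) = uniform_measure (measure_pmf \<pi>) ?E"
      by (rule cond_pmf.rep_eq)
    then have "measure (measure_pmf (cond_pmf \<pi> ?E)) ((\<lambda>X. X i) -` {a}) =
        measure \<pi> (?E \<inter> ((\<lambda>X. X i) -` {a})) / measure \<pi> ?E"
      using p unfolding Pr_def by (simp add: measure_pmf.emeasure_eq_measure)
    finally show ?thesis using p unfolding Pr_def E by simp
  qed
qed

lemma pos_reveal:
  assumes "pos S z" "i \<in> {1..n} - S" "pmf (\<kappa> S i z) a > 0"
  shows "pos (insert i S) (z(i := a))" "a \<in> {1..q}"
proof -
  have S: "S \<subseteq> {1..n}" "z \<in> configs q S" "Pr S z > 0" using assms(1) by (auto simp: pos_def)
  show a: "a \<in> {1..q}"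
    using marginals_support[OF S(1) assms(2) S(2)] assms(3) by (auto simp: pmf_positive_iff)
  have "Pr (insert i S) (z(i := a)) > 0"
    unfolding Pr_marginal[OF S(1) assms(2) S(2), symmetric] using S(3) assms(3) by simp
  then show "pos (insert i S) (z(i := a))"
    unfolding pos_def using S assms(2) configs_upd[OF S(2) a] by auto
qed

lemma sum_marginal:
  "S \<subseteq> {1..n} \<Longrightarrow> i \<in> {1..n} - S \<Longrightarrow> z \<in> configs q S \<Longrightarrow> (\<Sum>a\<in>{1..q}. pmf (\<kappa> S i z) a) = 1"
  by (intro sum_pmf_eq_1 marginals_support) auto

lemma Pr_total:
  assumes "S \<subseteq> {1..n}" "i \<in> {1..n} - S" "z \<in> configs q S"
  shows "(\<Sum>a\<in>{1..q}. Pr (insert i S) (z(i := a))) = Pr S z"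
  using sum_marginal[OF assms] by (simp flip: Pr_marginal[OF assms] sum_distrib_left)

text \<open>By the chain rule in both orders: multiplied by \<open>Pr S z\<close>, either side is
  the probability of seeing \<open>z\<close> and the letter \<open>b\<close> at
  \<open>j\<close>.\<close>

lemma total_probability:
  assumes "pos S z" "i \<in> {1..n} - S" "j \<in> {1..n} - S" "i \<noteq> j" "b \<in> {1..q}"
  shows "(\<Sum>a\<in>{1..q}. pmf (\<kappa> S i z) a * pmf (\<kappa> (insert i S) j (z(i := a))) b) = pmf (\<kappa> S j z) b"
proof -
  have S: "S \<subseteq> {1..n}" "z \<in> configs q S" "Pr S z > 0" using assms(1) by (auto simp: pos_def)
  have "Pr S z * (\<Sum>a\<in>{1..q}. pmf (\<kappa> S i z) a * pmf (\<kappa> (insert i S) j (z(i := a))) b) =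
    (\<Sum>a\<in>{1..q}. Pr (insert i S) (z(i := a)) * pmf (\<kappa> (insert i S) j (z(i := a))) b)"
    by (simp add: sum_distrib_left mult.assoc[symmetric] Pr_marginal[OF S(1) assms(2) S(2)])
  also have "\<dots> = (\<Sum>a\<in>{1..q}. Pr (insert i (insert j S)) ((z(j := b))(i := a)))"
  proof (intro sum.cong refl)
    fix a assume a: "a \<in> {1..q}"
    have "Pr (insert i S) (z(i := a)) * pmf (\<kappa> (insert i S) j (z(i := a))) b =
      Pr (insert j (insert i S)) ((z(i := a))(j := b))"
      using S assms by (intro Pr_marginal configs_upd[OF S(2) a]) auto
    then show "Pr (insert i S) (z(i := a)) * pmf (\<kappa> (insert i S) j (z(i := a))) b =
      Pr (insert i (insert j S)) ((z(j := b))(i := a))"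
      using assms(4) by (simp add: insert_commute fun_upd_twist)
  qed
  also have "\<dots> = Pr (insert j S) (z(j := b))"
    using S assms by (intro Pr_total configs_upd[OF S(2)]) auto
  also have "\<dots> = Pr S z * pmf (\<kappa> S j z) b" by (rule Pr_marginal[OF S(1) assms(3) S(2), symmetric])
  finally show ?thesis using S(3) by simp
qed

definition avg :: "(nat set \<Rightarrow> (nat \<Rightarrow> nat) \<Rightarrow> nat \<Rightarrow> real) \<Rightarrow> nat set \<Rightarrow> (nat \<Rightarrow> nat) \<Rightarrow> real" where
  "avg g S z = (\<Sum>i\<in>{1..n} - S. g S z i) / real (card ({1..n} - S))"

text \<open>Real-valued counterpart of \<open>forecast\<close>: the expectation after one uniform
  coordinate takes its true letter. Reals are used because entropies have to be subtracted.\<close>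

definition reveal :: "(nat set \<Rightarrow> (nat \<Rightarrow> nat) \<Rightarrow> real) \<Rightarrow> nat set \<Rightarrow> (nat \<Rightarrow> nat) \<Rightarrow> real" where
  "reveal f = avg (\<lambda>S z i. \<Sum>a\<in>{1..q}. pmf (\<kappa> S i z) a * f (insert i S) (z(i := a)))"

lemma avg_mono: "(\<And>i. i \<in> {1..n} - S \<Longrightarrow> g S z i \<le> h S z i) \<Longrightarrow> avg g S z \<le> avg h S z"
  unfolding avg_def by (intro divide_right_mono sum_mono) auto

lemma pos_finite: "pos S z \<Longrightarrow> finite S \<and> card S \<le> n \<and> card ({1..n} - S) = n - card S"
proof -
  assume "pos S z"
  then have "S \<subseteq> {1..n}" by (simp add: pos_def)
  moreover from this have "finite S" by (rule finite_subset) simp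
  ultimately show ?thesis using card_mono[of "{1..n}" S] by (auto simp: card_Diff_subset)
qed

text \<open>Successors of probability zero have weight zero, so the comparison is demanded only at
  positive ones.\<close>

lemma reveal_mono:
  assumes "pos S z" "\<And>S' z'. pos S' z' \<Longrightarrow> card S' = Suc (card S) \<Longrightarrow> S \<subseteq> S' \<Longrightarrow> restrict z' S = z \<Longrightarrow> f S' z' \<le> g S' z'"
  shows "reveal f S z \<le> reveal g S z"
  unfolding reveal_def
proof (intro avg_mono sum_mono)
  fix i a assume i: "i \<in> {1..n} - S"
  have z: "z \<in> configs q S" using assms(1) by (simp add: pos_def)
  show "pmf (\<kappa> S i z) a * f (insert i S) (z(i := a)) \<le> pmf (\<kappa> S i z) a * g (insert i S) (z(i := a))"
  proof (cases "pmf (\<kappa> S i z) a = 0")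
    case False
    then have "pmf (\<kappa> S i z) a > 0" by (simp add: pmf_pos)
    note p = pos_reveal[OF assms(1) i this]
    have r: "restrict (z(i := a)) S = z"
    proof
      fix j show "restrict (z(i := a)) S j = z j"
        using i PiE_arb[OF z[unfolded configs_def], of j] by auto
    qed
    have "f (insert i S) (z(i := a)) \<le> g (insert i S) (z(i := a))"
      by (rule assms(2)[OF p(1) _ _ r]) (use i pos_finite[OF assms(1)] in auto)
    then show ?thesis by (intro mult_left_mono) auto
  qed simp
qed

lemma reveal_const:
  assumes "pos S z" "card S < n"
  shows "reveal (\<lambda>_ _. c) S z = c"
proof -
  have S: "S \<subseteq> {1..n}" "z \<in> configs q S" using assms(1) by (auto simp: pos_def)
  have "reveal (\<lambda>_ _. c) S z = (\<Sum>i\<in>{1..n} - S. c) / real (card ({1..n} - S))"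
    unfolding reveal_def avg_def
    by (intro arg_cong2[where f = "(/)"] sum.cong refl)
       (simp only: sum_marginal[OF S(1) _ S(2)] mult_1_left flip: sum_distrib_right)
  moreover have "\<not> {1..n} \<subseteq> S" using card_mono[of S "{1..n}"] pos_finite[OF assms(1)] assms(2) by auto
  ultimately show ?thesis by simp
qed

lemma avg_add: "avg (\<lambda>S z i. f S z i + g S z i) S z = avg f S z + avg g S z"
  by (simp add: avg_def sum.distrib add_divide_distrib)

lemma avg_cmult: "avg (\<lambda>S z i. c * f S z i) S z = c * avg f S z"
  by (simp add: avg_def flip: sum_distrib_left)

lemma reveal_add: "reveal (\<lambda>S z. f S z + g S z) S z = reveal f S z + reveal g S z"
  by (simp add: reveal_def distrib_left sum.distrib avg_add)

lemma reveal_cmult: "reveal (\<lambda>S z. c * f S z) S z = c * reveal f S z"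
proof -
  have "(\<Sum>a\<in>{1..q}. pmf (\<kappa> S i z) a * (c * f (insert i S) (z(i := a)))) =
    c * (\<Sum>a\<in>{1..q}. pmf (\<kappa> S i z) a * f (insert i S) (z(i := a)))" for S z i
    by (simp add: sum_distrib_left mult_ac)
  then show ?thesis by (simp add: reveal_def avg_cmult)
qed

lemma reveal_diff: "reveal (\<lambda>S z. f S z - g S z) S z = reveal f S z - reveal g S z"
  using reveal_add[of f "\<lambda>S z. (-1) * g S z"] reveal_cmult[of "-1" g] by simp

lemma reveal_sum: "finite I \<Longrightarrow> reveal (\<lambda>S z. \<Sum>t\<in>I. f t S z) S z = (\<Sum>t\<in>I. reveal (f t) S z)"
proof (induction I rule: finite_induct)
  case empty
  then show ?case using reveal_cmult[of 0 "\<lambda>_ _. 0" S z] by simp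
next
  case (insert t I)
  then show ?case by (simp add: reveal_add)
qed

text \<open>Cross entropy of the current marginal relative to the drafted one. It is linear in the
  current marginal, which is what makes it a martingale under revelations.\<close>

definition cross :: "nat set \<Rightarrow> (nat \<Rightarrow> nat) \<Rightarrow> nat set \<Rightarrow> (nat \<Rightarrow> nat) \<Rightarrow> nat \<Rightarrow> real" where
  "cross S0 z0 S z i = (\<Sum>a\<in>{1..q}. pmf (\<kappa> S i z) a * (- ln (pmf (\<kappa> S0 i z0) a)))"

definition ent :: "nat set \<Rightarrow> (nat \<Rightarrow> nat) \<Rightarrow> real" where
  "ent = avg (\<lambda>S z. cross S z S z)"

definition cent :: "nat set \<Rightarrow> (nat \<Rightarrow> nat) \<Rightarrow> nat set \<Rightarrow> (nat \<Rightarrow> nat) \<Rightarrow> real" where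
  "cent S0 z0 = avg (cross S0 z0)"

text \<open>Expected entropy of a uniform unrevealed coordinate after \<open>t\<close> further
  random revelations.\<close>

definition future_ent :: "nat \<Rightarrow> nat set \<Rightarrow> (nat \<Rightarrow> nat) \<Rightarrow> real" where
  "future_ent t = (reveal ^^ t) ent"

lemma future_ent_0: "future_ent 0 = ent" and future_ent_Suc: "future_ent (Suc t) = reveal (future_ent t)"
  by (simp_all add: future_ent_def)

lemma cross_nonneg: "0 \<le> cross S0 z0 S z i"
proof -
  have "ln (pmf (\<kappa> S0 i z0) a) \<le> 0" for a
  proof (cases "pmf (\<kappa> S0 i z0) a = 0")
    case False
    then have "ln (pmf (\<kappa> S0 i z0) a) \<le> pmf (\<kappa> S0 i z0) a - 1"
      by (intro ln_le_minus_one) (simp add: pmf_pos)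
    then show ?thesis using pmf_le_1[of "\<kappa> S0 i z0" a] by linarith
  qed simp
  then show ?thesis unfolding cross_def by (intro sum_nonneg mult_nonneg_nonneg) auto
qed

lemma cent_nonneg: "0 \<le> cent S0 z0 S z"
  unfolding cent_def avg_def using cross_nonneg by (intro divide_nonneg_nonneg sum_nonneg) auto

lemma cent_self: "cent S z S z = ent S z"
  by (simp add: cent_def ent_def avg_def)

lemma ent_nonneg: "0 \<le> ent S z"
  using cent_nonneg[of S z S z] by (simp add: cent_self)

lemma ent_le:
  assumes "pos S z"
  shows "ent S z \<le> ln (real q)"
proof -
  have S: "S \<subseteq> {1..n}" "z \<in> configs q S" using assms by (auto simp: pos_def)
  have q1: "real q > 0" using q by simp
  have c: "cross S z S z i \<le> ln (real q)" if i: "i \<in> {1..n} - S" for i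
  proof -
    \<comment> \<open>Gibbs' inequality against the uniform law, letter by letter, so that letters
      of probability 0 need no separate sum.\<close>
    have "pmf (\<kappa> S i z) a * (- ln (pmf (\<kappa> S i z) a)) \<le>
      pmf (\<kappa> S i z) a * ln (real q) + (1 / real q - pmf (\<kappa> S i z) a)" for a
    proof (cases "pmf (\<kappa> S i z) a = 0")
      case False
      then have p: "pmf (\<kappa> S i z) a > 0" by (simp add: pmf_pos)
      then have "ln (1 / (real q * pmf (\<kappa> S i z) a)) \<le> 1 / (real q * pmf (\<kappa> S i z) a) - 1"
        using q1 by (intro ln_le_minus_one) simp
      then have "- ln (real q) - ln (pmf (\<kappa> S i z) a) \<le> 1 / (real q * pmf (\<kappa> S i z) a) - 1"
        using p q1 by (simp add: ln_div ln_mult)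
      then have "pmf (\<kappa> S i z) a * (- ln (real q) - ln (pmf (\<kappa> S i z) a)) \<le>
        pmf (\<kappa> S i z) a * (1 / (real q * pmf (\<kappa> S i z) a) - 1)" using p by (intro mult_left_mono) auto
      also have "\<dots> = 1 / real q - pmf (\<kappa> S i z) a" using p by (simp add: right_diff_distrib)
      finally show ?thesis by (simp add: algebra_simps)
    qed simp
    then have "cross S z S z i \<le> (\<Sum>a\<in>{1..q}. pmf (\<kappa> S i z) a * ln (real q) + (1 / real q - pmf (\<kappa> S i z) a))"
      unfolding cross_def by (intro sum_mono)
    also have "\<dots> = ln (real q)"
      using sum_marginal[OF S(1) i S(2)] q1
      by (simp add: sum.distrib sum_subtractf flip: sum_distrib_right)
    finally show ?thesis .
  qed
  show ?thesis
  proof (cases "card S < n")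
    case True
    have "ent S z \<le> avg (\<lambda>_ _ _. ln (real q)) S z" unfolding ent_def by (rule avg_mono) (rule c)
    also have "\<dots> = ln (real q)" using True pos_finite[OF assms] by (simp add: avg_def)
    finally show ?thesis .
  next
    case False
    then have "card ({1..n} - S) = 0" using pos_finite[OF assms] by simp
    then have "ent S z = 0" by (simp add: ent_def avg_def)
    then show ?thesis using q by simp
  qed
qed

end

section \<open>Relative entropy of the true marginals with respect to the drafted ones\<close>

context target_sampler
begin

definition extends :: "nat set \<Rightarrow> (nat \<Rightarrow> nat) \<Rightarrow> nat set \<Rightarrow> (nat \<Rightarrow> nat) \<Rightarrow> bool" where
  "extends S0 z0 S z \<longleftrightarrow> S0 \<subseteq> S \<and> restrict z S0 = z0"

lemma extends_refl: "pos S z \<Longrightarrow> extends S z S z"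
  unfolding extends_def pos_def configs_def by (auto intro: PiE_restrict)

lemma extends_upd: "extends S0 z0 S z \<Longrightarrow> i \<notin> S \<Longrightarrow> extends S0 z0 (insert i S) (z(i := a))"
  unfolding extends_def by (auto simp: fun_eq_iff restrict_def split: if_splits)

lemma extends_trans: "extends S0 z0 S z \<Longrightarrow> S \<subseteq> S' \<Longrightarrow> restrict z' S = z \<Longrightarrow> extends S0 z0 S' z'"
  unfolding extends_def by (auto simp: fun_eq_iff restrict_def subset_iff split: if_splits)

text \<open>Absolute continuity: the event on the larger set is contained in the one on the smaller
  set, so a letter possible after more conditioning is possible after less.\<close>

lemma extends_support:
  assumes "pos S0 z0" "pos S z" "extends S0 z0 S z" "i \<in> {1..n} - S" "pmf (\<kappa> S i z) a > 0"
  shows "pmf (\<kappa> S0 i z0) a > 0"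
proof -
  have S0: "S0 \<subseteq> {1..n}" "z0 \<in> configs q S0" "S0 \<subseteq> S" "restrict z S0 = z0"
    using assms(1,3) by (auto simp: pos_def extends_def)
  have i: "i \<in> {1..n} - S0" using assms(4) S0 by auto
  have "Pr (insert i S) (z(i := a)) > 0"
    using pos_reveal(1)[OF assms(2,4,5)] by (simp add: pos_def)
  also have "Pr (insert i S) (z(i := a)) \<le> Pr (insert i S0) (z0(i := a))"
    unfolding Pr_def
  proof (intro measure_pmf.finite_measure_mono)
    show "{X. restrict X (insert i S) = z(i := a)} \<subseteq> {X. restrict X (insert i S0) = z0(i := a)}"
    proof safe
      fix X assume X: "restrict X (insert i S) = z(i := a)"
      show "restrict X (insert i S0) = z0(i := a)"
      proof
        fix j
        show "restrict X (insert i S0) j = (z0(i := a)) j"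
          using fun_cong[OF X, of j] fun_cong[OF S0(4), of j] S0(3) assms(4)
          by (auto simp: restrict_def split: if_splits)
      qed
    qed
  qed simp
  finally have "0 < Pr S0 z0 * pmf (\<kappa> S0 i z0) a" by (simp add: Pr_marginal[OF S0(1) i S0(2)])
  then show ?thesis by (simp add: zero_less_mult_iff Pr_def)
qed

definition relent :: "nat set \<Rightarrow> (nat \<Rightarrow> nat) \<Rightarrow> nat set \<Rightarrow> (nat \<Rightarrow> nat) \<Rightarrow> nat \<Rightarrow> real" where
  "relent S0 z0 S z i = (\<Sum>a\<in>{1..q}. pmf (\<kappa> S i z) a * ln (pmf (\<kappa> S i z) a / pmf (\<kappa> S0 i z0) a))"

lemma relent_eq:
  assumes "pos S0 z0" "pos S z" "extends S0 z0 S z" "i \<in> {1..n} - S"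
  shows "relent S0 z0 S z i = cross S0 z0 S z i - cross S z S z i"
  unfolding relent_def cross_def sum_subtractf[symmetric]
proof (intro sum.cong refl)
  fix a
  show "pmf (\<kappa> S i z) a * ln (pmf (\<kappa> S i z) a / pmf (\<kappa> S0 i z0) a) =
    pmf (\<kappa> S i z) a * - ln (pmf (\<kappa> S0 i z0) a) - pmf (\<kappa> S i z) a * - ln (pmf (\<kappa> S i z) a)"
  proof (cases "pmf (\<kappa> S i z) a = 0")
    case False
    then have "pmf (\<kappa> S i z) a > 0" by (simp add: pmf_pos)
    with extends_support[OF assms this] show ?thesis by (simp add: ln_div right_diff_distrib)
  qed simp
qed

lemma keep_relent:
  assumes "0 < \<alpha>" "\<alpha> \<le> 1" "0 < p" "p \<le> 1" "pos S0 z0" "pos S z" "extends S0 z0 S z" "i \<in> {1..n} - S"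
  shows "keep \<alpha> p - 6 / \<alpha> * relent S0 z0 S z i \<le>
      (\<Sum>a\<in>{1..q}. pmf (\<kappa> S i z) a * ((1 - surplus \<kappa> S0 z0 (p, S, i, z) a) * keep \<alpha> (matched \<kappa> S0 z0 (p, S, i, z) a)))"
    and "0 \<le> relent S0 z0 S z i"
proof -
  have S: "S \<subseteq> {1..n}" "z \<in> configs q S" and S0: "S0 \<subseteq> {1..n}" "z0 \<in> configs q S0" "i \<in> {1..n} - S0"
    using assms(5-8) by (auto simp: pos_def extends_def)
  have sums: "(\<Sum>a\<in>{1..q}. pmf (\<kappa> S i z) a) = 1" "(\<Sum>a\<in>{1..q}. pmf (\<kappa> S0 i z0) a) \<le> 1"
    using sum_marginal[OF S(1) assms(8) S(2)] sum_marginal[OF S0(1,3,2)] by simp_all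
  note k = keep_sum[OF assms(1-4), of "{1..q}" "pmf (\<kappa> S i z)" "pmf (\<kappa> S0 i z0)",
      OF pmf_nonneg sums(1) pmf_nonneg sums(2) extends_support[OF assms(5-8)]]
  show "0 \<le> relent S0 z0 S z i" using k(2) by (simp add: relent_def)
  show "keep \<alpha> p - 6 / \<alpha> * relent S0 z0 S z i \<le>
      (\<Sum>a\<in>{1..q}. pmf (\<kappa> S i z) a * ((1 - surplus \<kappa> S0 z0 (p, S, i, z) a) * keep \<alpha> (matched \<kappa> S0 z0 (p, S, i, z) a)))"
    using k(1) by (simp add: relent_def)
qed

lemma cent_minus_ent:
  assumes "pos S0 z0" "pos S z" "extends S0 z0 S z"
  shows "avg (relent S0 z0) S z = cent S0 z0 S z - ent S z"
  using relent_eq[OF assms]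
  by (simp add: avg_def cent_def ent_def diff_divide_distrib[symmetric] flip: sum_subtractf)

lemma ent_le_cent:
  assumes "pos S0 z0" "pos S z" "extends S0 z0 S z"
  shows "ent S z \<le> cent S0 z0 S z"
proof -
  have "0 \<le> avg (relent S0 z0) S z" unfolding avg_def
    using keep_relent(2)[of 1 1, OF _ _ _ _ assms] by (intro divide_nonneg_nonneg sum_nonneg) auto
  then show ?thesis by (simp add: cent_minus_ent[OF assms])
qed

text \<open>For a fixed coordinate \<open>j\<close>, linearity and total probability preserve the
  mean of the cross entropy when another coordinate is revealed. Deleting a uniform one of
  \<open>m > 1\<close> coordinates also preserves the mean over the others. Strict decrease is
  possible only at the last coordinate, after which \<open>cent\<close> is 0.\<close>

lemma reveal_cent:
  assumes "pos S0 z0" "pos S z" "extends S0 z0 S z"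
  shows "reveal (cent S0 z0) S z \<le> cent S0 z0 S z"
proof (cases "card ({1..n} - S) \<le> 1")
  case True
  have "cent S0 z0 (insert i S) (z(i := a)) = 0" if "i \<in> {1..n} - S" for i a
  proof -
    have "{1..n} - insert i S = {1..n} - S - {i}" by auto
    then have "card ({1..n} - insert i S) = 0" using True that by simp
    then show ?thesis by (simp add: cent_def avg_def)
  qed
  then have "reveal (cent S0 z0) S z = 0" by (simp add: reveal_def avg_def)
  then show ?thesis using cent_nonneg by simp
next
  case False
  let ?R = "{1..n} - S"
  define m where "m = card ?R"
  have m: "m > 1" using False by (simp add: m_def)
  have S: "S \<subseteq> {1..n}" "z \<in> configs q S" using assms by (auto simp: pos_def)
  have inner: "(\<Sum>a\<in>{1..q}. pmf (\<kappa> S i z) a * cent S0 z0 (insert i S) (z(i := a))) =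
    ((\<Sum>j\<in>?R. cross S0 z0 S z j) - cross S0 z0 S z i) / real (m - 1)" if i: "i \<in> ?R" for i
  proof -
    have R: "{1..n} - insert i S = ?R - {i}" by auto
    have c: "card ({1..n} - insert i S) = m - 1" unfolding R m_def using i by (rule card_Diff_singleton)
    have "(\<Sum>a\<in>{1..q}. pmf (\<kappa> S i z) a * cent S0 z0 (insert i S) (z(i := a))) =
      (\<Sum>a\<in>{1..q}. \<Sum>j\<in>?R - {i}. pmf (\<kappa> S i z) a * cross S0 z0 (insert i S) (z(i := a)) j) / real (m - 1)"
      unfolding cent_def avg_def c unfolding R by (simp add: sum_divide_distrib sum_distrib_left)
    also have "(\<Sum>a\<in>{1..q}. \<Sum>j\<in>?R - {i}. pmf (\<kappa> S i z) a * cross S0 z0 (insert i S) (z(i := a)) j) =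
      (\<Sum>j\<in>?R - {i}. \<Sum>a\<in>{1..q}. pmf (\<kappa> S i z) a * cross S0 z0 (insert i S) (z(i := a)) j)"
      by (rule sum.swap)
    also have "\<dots> = (\<Sum>j\<in>?R - {i}. cross S0 z0 S z j)"
    proof (intro sum.cong refl)
      fix j assume j: "j \<in> ?R - {i}"
      have "(\<Sum>a\<in>{1..q}. pmf (\<kappa> S i z) a * cross S0 z0 (insert i S) (z(i := a)) j) =
        (\<Sum>b\<in>{1..q}. \<Sum>a\<in>{1..q}. pmf (\<kappa> S i z) a * (pmf (\<kappa> (insert i S) j (z(i := a))) b * - ln (pmf (\<kappa> S0 j z0) b)))"
        unfolding cross_def by (subst sum.swap) (simp add: sum_distrib_left)
      also have "\<dots> = (\<Sum>b\<in>{1..q}. pmf (\<kappa> S j z) b * - ln (pmf (\<kappa> S0 j z0) b))"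
      proof (intro sum.cong refl)
        fix b assume b: "b \<in> {1..q}"
        have "(\<Sum>a\<in>{1..q}. pmf (\<kappa> S i z) a * (pmf (\<kappa> (insert i S) j (z(i := a))) b * - ln (pmf (\<kappa> S0 j z0) b))) =
          (\<Sum>a\<in>{1..q}. pmf (\<kappa> S i z) a * pmf (\<kappa> (insert i S) j (z(i := a))) b) * - ln (pmf (\<kappa> S0 j z0) b)"
          by (simp only: sum_distrib_right mult.assoc)
        also have "\<dots> = pmf (\<kappa> S j z) b * - ln (pmf (\<kappa> S0 j z0) b)"
          using total_probability[OF assms(2) i _ _ b, of j] j by auto
        finally show "(\<Sum>a\<in>{1..q}. pmf (\<kappa> S i z) a * (pmf (\<kappa> (insert i S) j (z(i := a))) b * - ln (pmf (\<kappa> S0 j z0) b))) =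
          pmf (\<kappa> S j z) b * - ln (pmf (\<kappa> S0 j z0) b)" .
      qed
      finally show "(\<Sum>a\<in>{1..q}. pmf (\<kappa> S i z) a * cross S0 z0 (insert i S) (z(i := a)) j) = cross S0 z0 S z j"
        by (simp only: cross_def)
    qed
    also have "\<dots> = (\<Sum>j\<in>?R. cross S0 z0 S z j) - cross S0 z0 S z i"
      using i by (subst sum_diff1) auto
    finally show ?thesis .
  qed
  have "reveal (cent S0 z0) S z =
    (\<Sum>i\<in>?R. ((\<Sum>j\<in>?R. cross S0 z0 S z j) - cross S0 z0 S z i) / real (m - 1)) / real m"
    unfolding reveal_def avg_def m_def[symmetric]
    by (intro arg_cong2[where f = "(/)"] sum.cong refl inner)
  also have "\<dots> = ((real m - 1) * (\<Sum>j\<in>?R. cross S0 z0 S z j)) / real (m - 1) / real m"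
    by (simp add: sum_divide_distrib[symmetric] sum_subtractf m_def[symmetric] algebra_simps del: One_nat_def)
  also have "\<dots> = (\<Sum>j\<in>?R. cross S0 z0 S z j) / real m" using m by (simp add: of_nat_diff)
  also have "\<dots> = cent S0 z0 S z" by (simp add: cent_def avg_def m_def)
  finally show ?thesis by simp
qed

text \<open>Conditioning lowers entropy on average: the new entropy is at most the cross entropy
  relative to the old marginals, whose mean does not grow.\<close>

lemma reveal_ent: "pos S z \<Longrightarrow> reveal ent S z \<le> ent S z"
proof -
  assume p: "pos S z"
  have "reveal ent S z \<le> reveal (cent S z) S z"
    by (rule reveal_mono[OF p]) (rule ent_le_cent[OF p _ extends_trans[OF extends_refl[OF p]]])
  also have "\<dots> \<le> cent S z S z" by (rule reveal_cent[OF p p extends_refl[OF p]])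
  finally show ?thesis by (simp add: cent_self)
qed

lemma future_ent_Suc_le: "pos S z \<Longrightarrow> future_ent (Suc t) S z \<le> future_ent t S z"
proof (induction t arbitrary: S z)
  case 0
  then show ?case by (simp add: future_ent_Suc future_ent_0 reveal_ent)
next
  case (Suc t)
  show ?case unfolding future_ent_Suc[of "Suc t"] future_ent_Suc[of t]
    by (rule reveal_mono[OF Suc.prems]) (simp add: Suc.IH flip: future_ent_Suc)
qed

lemma future_ent_antimono: "pos S z \<Longrightarrow> t \<le> t' \<Longrightarrow> future_ent t' S z \<le> future_ent t S z"
  using lift_Suc_antimono_le[of "\<lambda>t. future_ent t S z"] future_ent_Suc_le by blast

lemma future_ent_nonneg: "0 \<le> future_ent t S z"
proof (induction t arbitrary: S z)
  case 0
  then show ?case by (simp add: future_ent_0 ent_nonneg)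
next
  case (Suc t)
  then show ?case unfolding future_ent_Suc reveal_def avg_def
    by (intro divide_nonneg_nonneg sum_nonneg mult_nonneg_nonneg) auto
qed

lemma future_ent_le_ln: "pos S z \<Longrightarrow> future_ent t S z \<le> ln (real q)"
  using future_ent_antimono[of S z 0 t] ent_le by (fastforce simp: future_ent_0)

text \<open>Passes from \<open>ennreal\<close> potentials to real sums. The bound is asked only at
  letters of positive probability, so \<open>g\<close> may be infinite at the others.\<close>

lemma nn_integral_reveal_le:
  assumes "pos S z" "card S < n"
    and g: "\<And>i a. i \<in> {1..n} - S \<Longrightarrow> pmf (\<kappa> S i z) a > 0 \<Longrightarrow> g i a \<le> ennreal (h i a) \<and> 0 \<le> h i a"
  shows "(\<integral>\<^sup>+i. \<integral>\<^sup>+a. g i a \<partial>\<kappa> S i z \<partial>pmf_of_set ({1..n} - S)) \<le>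
    ennreal (avg (\<lambda>S z i. \<Sum>a\<in>{1..q}. pmf (\<kappa> S i z) a * h i a) S z)"
proof -
  have S: "S \<subseteq> {1..n}" "z \<in> configs q S" using assms(1) by (auto simp: pos_def)
  note R = remaining[OF S(1) assms(2)]
  have nn: "0 \<le> pmf (\<kappa> S i z) a * h i a" if "i \<in> {1..n} - S" for i a
    using g[OF that, of a] pmf_pos[of "\<kappa> S i z" a] by (cases "pmf (\<kappa> S i z) a = 0") auto
  have inner: "(\<integral>\<^sup>+a. g i a \<partial>\<kappa> S i z) \<le> ennreal (\<Sum>a\<in>{1..q}. pmf (\<kappa> S i z) a * h i a)" if i: "i \<in> {1..n} - S" for i
  proof -
    have sup: "set_pmf (\<kappa> S i z) \<subseteq> {1..q}" by (rule marginals_support[OF S(1) i S(2)])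
    have "(\<integral>\<^sup>+a. g i a \<partial>\<kappa> S i z) \<le> (\<integral>\<^sup>+a. ennreal (h i a) \<partial>\<kappa> S i z)"
      using g[OF i] by (intro nn_integral_mono_AE AE_pmfI) (auto simp: pmf_positive)
    also have "\<dots> = (\<Sum>a\<in>{1..q}. ennreal (h i a) * ennreal (pmf (\<kappa> S i z) a))"
      using sup by (intro nn_integral_measure_pmf_support) auto
    also have "\<dots> = (\<Sum>a\<in>{1..q}. ennreal (pmf (\<kappa> S i z) a * h i a))"
    proof (intro sum.cong refl)
      fix a show "ennreal (h i a) * ennreal (pmf (\<kappa> S i z) a) = ennreal (pmf (\<kappa> S i z) a * h i a)"
        using g[OF i, of a] pmf_pos[of "\<kappa> S i z" a]
        by (cases "pmf (\<kappa> S i z) a = 0") (auto simp: ennreal_mult mult.commute)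
    qed
    also have "\<dots> = ennreal (\<Sum>a\<in>{1..q}. pmf (\<kappa> S i z) a * h i a)" using nn[OF i] by (intro sum_ennreal) auto
    finally show ?thesis .
  qed
  have "(\<integral>\<^sup>+i. \<integral>\<^sup>+a. g i a \<partial>\<kappa> S i z \<partial>pmf_of_set ({1..n} - S)) =
    (\<Sum>i\<in>{1..n} - S. \<integral>\<^sup>+a. g i a \<partial>\<kappa> S i z) / of_nat (card ({1..n} - S))"
    by (simp only: nn_integral_pmf_of_set[OF R(2,1)])
  also have "\<dots> \<le> (\<Sum>i\<in>{1..n} - S. ennreal (\<Sum>a\<in>{1..q}. pmf (\<kappa> S i z) a * h i a)) / of_nat (card ({1..n} - S))"
    by (intro divide_right_mono_ennreal sum_mono inner)
  also have "\<dots> = ennreal (\<Sum>i\<in>{1..n} - S. \<Sum>a\<in>{1..q}. pmf (\<kappa> S i z) a * h i a) / ennreal (real (card ({1..n} - S)))"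
    using nn by (subst sum_ennreal) (auto intro!: sum_nonneg simp: ennreal_of_nat_eq_real_of_nat)
  also have "\<dots> = ennreal (avg (\<lambda>S z i. \<Sum>a\<in>{1..q}. pmf (\<kappa> S i z) a * h i a) S z)"
    unfolding avg_def using nn R assms(2)
    by (intro divide_ennreal) (auto intro!: sum_nonneg)
  finally show ?thesis .
qed

text \<open>Each step loses \<open>6 / \<alpha>\<close> times its relative entropy, whose average
  over the coordinates is \<open>cent - ent\<close>. The present \<open>cent\<close> bounds its
  later means, and the mean entropy after \<open>t\<close> steps is \<open>future_ent t\<close>,
  which yields the bracket.\<close>

lemma stop_prob_le_keep:
  assumes \<alpha>: "0 < \<alpha>" "\<alpha> \<le> 1" and base: "pos S0 z0"
    and "pos S z" "extends S0 z0 S z" "card S + m \<le> n" "0 < p" "p \<le> 1"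
  shows "stop_prob S0 z0 m p S z \<le>
    ennreal (1 - keep \<alpha> p + 6 / \<alpha> * (real m * cent S0 z0 S z - (\<Sum>t<m. future_ent t S z)))"
  using assms(4-8)
proof (induction m arbitrary: p S z)
  case (Suc m)
  note prems = Suc.prems
  let ?E = "\<lambda>S z. real m * cent S0 z0 S z - (\<Sum>t<m. future_ent t S z)"
  let ?s = "\<lambda>i. surplus \<kappa> S0 z0 (p, S, i, z)" and ?m = "\<lambda>i. matched \<kappa> S0 z0 (p, S, i, z)"
  define h where "h i a = (1 - (1 - ?s i a) * keep \<alpha> (?m i a)) + 6 / \<alpha> * ?E (insert i S) (z(i := a))" for i a
  have E: "0 \<le> ?E S' z'" if "pos S' z'" "extends S0 z0 S' z'" for S' z'
  proof -
    have "(\<Sum>t<m. future_ent t S' z') \<le> (\<Sum>t<m. cent S0 z0 S' z')"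
    proof (intro sum_mono)
      fix t
      show "future_ent t S' z' \<le> cent S0 z0 S' z'"
        using future_ent_antimono[OF that(1), of 0 t] ent_le_cent[OF base that] by (simp add: future_ent_0)
    qed
    then show ?thesis by simp
  qed
  have sr: "0 \<le> ?s i a" "?s i a \<le> 1" and mr: "?m i a \<le> 1" for i a
    using surplus_range[of "(p, S, i, z)"] matched_range[of "(p, S, i, z)"] prems by auto
  have "stop_prob S0 z0 (Suc m) p S z = (\<integral>\<^sup>+i. \<integral>\<^sup>+a. ennreal (?s i a) + ennreal (1 - ?s i a) * stop_prob S0 z0 m (?m i a) (insert i S) (z(i := a))
      \<partial>\<kappa> S i z \<partial>pmf_of_set ({1..n} - S))"
    by (simp add: stop_prob_def del: surplus.simps matched.simps)
  also have "\<dots> \<le> ennreal (avg (\<lambda>S z i. \<Sum>a\<in>{1..q}. pmf (\<kappa> S i z) a * h i a) S z)"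
  proof (rule nn_integral_reveal_le[OF prems(1)])
    show "card S < n" using prems by simp
  next
    fix i a assume i: "i \<in> {1..n} - S" and a: "pmf (\<kappa> S i z) a > 0"
    have p': "pos (insert i S) (z(i := a))" by (rule pos_reveal(1)[OF prems(1) i a])
    have e': "extends S0 z0 (insert i S) (z(i := a))" using i by (intro extends_upd prems) auto
    have "pmf (\<kappa> S0 i z0) a > 0" by (rule extends_support[OF base prems(1,2) i a])
    then have mp: "?m i a > 0" using a prems by simp
    let ?X = "1 - keep \<alpha> (?m i a) + 6 / \<alpha> * ?E (insert i S) (z(i := a))"
    have X0: "0 \<le> ?X" using keep_le_1[OF \<alpha>(1)] E[OF p' e'] \<alpha> by simp
    have IH: "stop_prob S0 z0 m (?m i a) (insert i S) (z(i := a)) \<le> ennreal ?X"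
      by (rule Suc.IH[OF p' e' _ mp mr]) (use prems i pos_finite[OF prems(1)] in simp)
    \<comment> \<open>The survival probability in front of the later entropies is dropped: steps
      after leaving are counted too, so the entropy terms follow the unstopped chain.\<close>
    have "(1 - ?s i a) * (6 / \<alpha> * ?E (insert i S) (z(i := a))) \<le> 1 * (6 / \<alpha> * ?E (insert i S) (z(i := a)))"
      using sr[of i a] E[OF p' e'] \<alpha> by (intro mult_right_mono) (auto simp del: surplus.simps)
    then have le: "?s i a + (1 - ?s i a) * ?X \<le> h i a"
      unfolding h_def by (simp add: algebra_simps del: surplus.simps matched.simps)
    have "ennreal (?s i a) + ennreal (1 - ?s i a) * stop_prob S0 z0 m (?m i a) (insert i S) (z(i := a))
      \<le> ennreal (?s i a) + ennreal (1 - ?s i a) * ennreal ?X"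
      by (intro add_left_mono mult_left_mono IH) auto
    also have "\<dots> = ennreal (?s i a + (1 - ?s i a) * ?X)"
      using sr X0 by (simp add: ennreal_mult ennreal_plus del: surplus.simps matched.simps)
    also have "\<dots> \<le> ennreal (h i a)" using le by (rule ennreal_leI)
    finally have 1: "ennreal (?s i a) + ennreal (1 - ?s i a) * stop_prob S0 z0 m (?m i a) (insert i S) (z(i := a))
      \<le> ennreal (h i a)" .
    have "0 \<le> (1 - ?s i a) * ?X"
      by (rule mult_nonneg_nonneg[OF _ X0]) (use sr[of i a] in \<open>simp del: surplus.simps\<close>)
    then have "0 \<le> ?s i a + (1 - ?s i a) * ?X" using sr[of i a] by linarith
    with le 1 show "ennreal (?s i a) + ennreal (1 - ?s i a) * stop_prob S0 z0 m (?m i a) (insert i S) (z(i := a))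
      \<le> ennreal (h i a) \<and> 0 \<le> h i a" by linarith
  qed
  also have "avg (\<lambda>S z i. \<Sum>a\<in>{1..q}. pmf (\<kappa> S i z) a * h i a) S z \<le>
    1 - keep \<alpha> p + 6 / \<alpha> * (real (Suc m) * cent S0 z0 S z - (\<Sum>t<Suc m. future_ent t S z))"
  proof -
    have S: "S \<subseteq> {1..n}" "z \<in> configs q S" using prems(1) by (auto simp: pos_def)
    define E' where "E' = (\<lambda>S z i. \<Sum>a\<in>{1..q}. pmf (\<kappa> S i z) a * ?E (insert i S) (z(i := a)))"
    have "avg (\<lambda>S z i. \<Sum>a\<in>{1..q}. pmf (\<kappa> S i z) a * h i a) S z \<le>
      avg (\<lambda>S z i. (1 - keep \<alpha> p) + 6 / \<alpha> * (relent S0 z0 S z i + E' S z i)) S z"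
    proof (rule avg_mono)
      fix i assume i: "i \<in> {1..n} - S"
      let ?k = "\<Sum>a\<in>{1..q}. pmf (\<kappa> S i z) a * ((1 - ?s i a) * keep \<alpha> (?m i a))"
      have "(\<Sum>a\<in>{1..q}. pmf (\<kappa> S i z) a * h i a) =
        (\<Sum>a\<in>{1..q}. pmf (\<kappa> S i z) a - pmf (\<kappa> S i z) a * ((1 - ?s i a) * keep \<alpha> (?m i a))
          + 6 / \<alpha> * (pmf (\<kappa> S i z) a * ?E (insert i S) (z(i := a))))"
        by (intro sum.cong refl) (simp only: h_def right_diff_distrib distrib_left mult_1_right mult.left_commute)
      also have "\<dots> = (\<Sum>a\<in>{1..q}. pmf (\<kappa> S i z) a) - ?k + 6 / \<alpha> * E' S z i"
        by (simp only: E'_def sum.distrib sum_subtractf sum_distrib_left)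
      also have "\<dots> = 1 - ?k + 6 / \<alpha> * E' S z i" by (simp only: sum_marginal[OF S(1) i S(2)])
      also have "\<dots> \<le> 1 - (keep \<alpha> p - 6 / \<alpha> * relent S0 z0 S z i) + 6 / \<alpha> * E' S z i"
        using keep_relent(1)[OF \<alpha> prems(4,5) base prems(1,2) i] by linarith
      finally show "(\<Sum>a\<in>{1..q}. pmf (\<kappa> S i z) a * h i a) \<le> (1 - keep \<alpha> p) + 6 / \<alpha> * (relent S0 z0 S z i + E' S z i)"
        by (simp add: distrib_left)
    qed
    also have "\<dots> = (1 - keep \<alpha> p) + 6 / \<alpha> * (avg (relent S0 z0) S z + avg E' S z)"
    proof -
      have "avg (\<lambda>_ _ _. 1 - keep \<alpha> p) S z = 1 - keep \<alpha> p"
        using remaining[OF S(1)] prems by (simp add: avg_def)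
      then show ?thesis by (simp only: avg_add avg_cmult)
    qed
    also have "avg (relent S0 z0) S z = cent S0 z0 S z - ent S z"
      by (rule cent_minus_ent[OF base prems(1,2)])
    also have "avg E' S z = reveal ?E S z" by (simp add: E'_def reveal_def)
    also have "\<dots> = real m * reveal (cent S0 z0) S z - (\<Sum>t<m. future_ent (Suc t) S z)"
      by (simp add: reveal_diff reveal_cmult reveal_sum future_ent_Suc)
    also have "(1 - keep \<alpha> p) + 6 / \<alpha> * (cent S0 z0 S z - ent S z +
        (real m * reveal (cent S0 z0) S z - (\<Sum>t<m. future_ent (Suc t) S z))) \<le>
      (1 - keep \<alpha> p) + 6 / \<alpha> * (cent S0 z0 S z - ent S z +
        (real m * cent S0 z0 S z - (\<Sum>t<m. future_ent (Suc t) S z)))"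
      using \<alpha> reveal_cent[OF base prems(1,2)]
      by (intro add_left_mono mult_left_mono diff_right_mono) auto
    also have "cent S0 z0 S z - ent S z + (real m * cent S0 z0 S z - (\<Sum>t<m. future_ent (Suc t) S z)) =
      real (Suc m) * cent S0 z0 S z - (\<Sum>t<Suc m. future_ent t S z)"
      by (simp only: sum.lessThan_Suc_shift future_ent_0) (simp add: algebra_simps)
    finally show ?thesis .
  qed
  finally show ?case by (simp add: ennreal_leI)
qed (simp add: stop_prob_def)

text \<open>At \<open>p = 1\<close> the potential \<open>keep\<close> equals
  \<open>1 - \<alpha>\<close>, the source of the summand \<open>\<alpha>\<close>. For
  \<open>\<alpha> > 1\<close> the right side already exceeds 1.\<close>

lemma stop_prob_le_entropy:
  assumes "0 < \<alpha>" "pos S z" "card S + m \<le> n"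
  shows "stop_prob S z m 1 S z \<le> ennreal (\<alpha> + 6 / \<alpha> * (real m * ent S z - (\<Sum>t<m. future_ent t S z)))"
proof (cases "\<alpha> \<le> 1")
  case True
  show ?thesis
    using stop_prob_le_keep[OF assms(1) True assms(2,2) extends_refl[OF assms(2)] assms(3), of 1]
    by (simp add: keep_1[OF assms(1)] cent_self)
next
  case False
  have "(\<Sum>t<m. future_ent t S z) \<le> (\<Sum>t<m. ent S z)"
    using future_ent_antimono[OF assms(2), of 0] by (intro sum_mono) (simp add: future_ent_0)
  then have "1 \<le> \<alpha> + 6 / \<alpha> * (real m * ent S z - (\<Sum>t<m. future_ent t S z))"
    using False assms(1) by (intro order_trans[OF _ add_increasing2[of _ \<alpha>]]) auto
  then have "1 \<le> ennreal (\<alpha> + 6 / \<alpha> * (real m * ent S z - (\<Sum>t<m. future_ent t S z)))"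
    by (metis ennreal_1 ennreal_leI)
  with stop_prob_le_1[of 1 S z m S z] show ?thesis by (simp add: order_trans)
qed

end

section \<open>The grid of blocks\<close>

locale ladder =
  fixes n b h :: nat
  assumes b: "b \<ge> 1" and h: "h \<ge> 1"
begin

definition lev :: "nat \<Rightarrow> nat" where
  "lev p = Max {k. k < h \<and> b ^ k dvd p}"

definition blk :: "nat \<Rightarrow> nat" where
  "blk p = min (b ^ lev p) (n - p)"

lemma lev: "lev p < h" "b ^ lev p dvd p"
proof -
  have "lev p \<in> {k. k < h \<and> b ^ k dvd p}" unfolding lev_def
    by (rule Max_in) (use h in \<open>auto intro: exI[of _ 0]\<close>)
  then show "lev p < h" "b ^ lev p dvd p" by auto
qed

lemma lev_eqI:
  assumes "k < h" "b ^ k dvd p" "Suc k < h \<Longrightarrow> \<not> b ^ Suc k dvd p"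
  shows "lev p = k"
  unfolding lev_def
proof (rule Max_eqI)
  fix k' assume k': "k' \<in> {k. k < h \<and> b ^ k dvd p}"
  show "k' \<le> k"
  proof (rule ccontr)
    assume "\<not> k' \<le> k"
    then have "b ^ Suc k dvd b ^ k'" by (intro le_imp_power_dvd) simp
    with k' have "b ^ Suc k dvd p" by (auto intro: dvd_trans)
    with k' \<open>\<not> k' \<le> k\<close> assms(3) show False by auto
  qed
qed (use assms in auto)

lemma pow_pos: "b ^ k \<ge> 1"
  using b by simp

lemma sampler: "q \<ge> 1 \<Longrightarrow> sampler n q blk"
  by unfold_locales (use pow_pos in \<open>auto simp: blk_def Suc_le_eq\<close>)

text \<open>The number of attempts from position \<open>p\<close> on if every draft is
  accepted.\<close>

function attempts :: "nat \<Rightarrow> nat" where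
  "attempts p = (if p < n then Suc (attempts (p + b ^ lev p)) else 0)"
  by auto
termination
proof (relation "Wellfounded.measure (\<lambda>p. n - p)")
  fix p assume "p < n"
  then show "(p + b ^ lev p, p) \<in> Wellfounded.measure (\<lambda>p. n - p)" using pow_pos[of "lev p"] by auto
qed simp

declare attempts.simps [simp del]

lemma attempts_ge: "n \<le> p \<Longrightarrow> attempts p = 0"
  by (subst attempts.simps) simp

lemma attempts_blk: "p < n \<Longrightarrow> attempts p = Suc (attempts (p + blk p))"
  by (subst attempts.simps) (auto simp: blk_def min_def attempts_ge)

text \<open>Counts \<open>d\<close> consecutive blocks of level \<open>k\<close>; the hypotheses
  ensure that no larger block starts at any of them. Passing \<open>n\<close> is harmless because
  \<open>attempts\<close> is 0 there.\<close>

lemma attempts_same_level: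
  assumes "k < h" "b ^ k dvd p" "\<And>c. p < p + c * b ^ k \<Longrightarrow> c < d \<Longrightarrow> Suc k < h \<Longrightarrow> \<not> b ^ Suc k dvd p + c * b ^ k"
    and "d > 0 \<Longrightarrow> Suc k < h \<Longrightarrow> \<not> b ^ Suc k dvd p"
  shows "attempts p \<le> d + attempts (p + d * b ^ k)"
  using assms(2-)
proof (induction d arbitrary: p)
  case (Suc d)
  have l: "lev p = k" using Suc.prems by (intro lev_eqI assms(1)) auto
  have "attempts p \<le> Suc (attempts (p + b ^ k))" by (subst attempts.simps) (simp add: l)
  also have "attempts (p + b ^ k) \<le> d + attempts (p + b ^ k + d * b ^ k)"
  proof (rule Suc.IH)
    show "\<not> b ^ Suc k dvd p + b ^ k + c * b ^ k" if "c < d" "Suc k < h" for c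
      using Suc.prems(2)[of "Suc c"] that b by (simp add: add_ac)
    show "\<not> b ^ Suc k dvd p + b ^ k" if "d > 0" "Suc k < h"
      using Suc.prems(2)[of 1] that b by simp
  qed (use Suc.prems(1) in simp)
  finally show ?case by (simp add: add_ac)
qed simp

text \<open>Like carrying in base \<open>b\<close>: after a multiple of the lower power is reached,
  fewer than \<open>b\<close> blocks of that size lead to the next multiple of the higher
  power.\<close>

lemma attempts_climb:
  assumes "k < h" "b ^ k dvd e" "p \<le> e" "e < p + b ^ k"
  shows "attempts p \<le> k * b + attempts e"
  using assms
proof (induction k arbitrary: e)
  case (Suc k)
  define r where "r = (e - p) mod b ^ k"
  define d where "d = (e - p) div b ^ k"
  have e: "e = (p + r) + d * b ^ k"
    using Suc.prems(3) div_mult_mod_eq[of "e - p" "b ^ k"] by (simp add: r_def d_def)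
  have "b ^ k dvd e" using Suc.prems(2) by (metis dvd_mult_right power_Suc)
  then have dv: "b ^ k dvd p + r" using e by (metis dvd_add_left_iff dvd_triv_right)
  have r: "r < b ^ k" using b by (simp add: r_def)
  have "r + d * b ^ k < b * b ^ k" using Suc.prems(4) unfolding e by simp
  then have "d * b ^ k < b * b ^ k" by (rule le_less_trans[OF le_add2])
  then have db: "d < b" by simp
  \<comment> \<open>Two multiples of \<open>b ^ Suc k\<close> cannot be closer than
    \<open>b ^ Suc k\<close>, so the blocks before \<open>e\<close> have level exactly
    \<open>k\<close>.\<close>
  have n: "\<not> b ^ Suc k dvd p + r + c * b ^ k" if c: "c < d" for c
  proof
    assume "b ^ Suc k dvd p + r + c * b ^ k"
    then have "b ^ Suc k dvd e - (p + r + c * b ^ k)" using Suc.prems(2) by (rule dvd_diff_nat[rotated])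
    moreover have "e - (p + r + c * b ^ k) = (d - c) * b ^ k" unfolding e by (simp add: diff_mult_distrib)
    moreover have "(d - c) * b ^ k < b ^ Suc k" using db c b by simp
    moreover have "(d - c) * b ^ k > 0" using c b by simp
    ultimately show False by (metis nat_dvd_not_less)
  qed
  have "attempts p \<le> k * b + attempts (p + r)"
    using Suc.prems(1) dv r by (intro Suc.IH) auto
  also have "attempts (p + r) \<le> d + attempts e"
    unfolding e
    by (rule attempts_same_level) (use Suc.prems(1) dv n n[of 0] in auto)
  finally show ?case using db by simp
next
  case 0
  then have "e = p" by simp
  then show ?case by simp
qed

text \<open>The untruncated end of the failed block is aligned to its level; after the climb back to
  it, the count is the same as without the failure.\<close>

lemma attempts_after_failure:
  assumes "p < n" "p < p'" "p' \<le> p + blk p"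
  shows "attempts p' \<le> (h - 1) * b + attempts (p + blk p)"
proof -
  have "attempts p' \<le> lev p * b + attempts (p + b ^ lev p)"
    using assms lev by (intro attempts_climb) (auto simp: blk_def)
  also have "lev p * b \<le> (h - 1) * b" using lev(1)[of p] by (intro mult_right_mono) auto
  \<comment> \<open>A block truncated at \<open>n\<close> ends at \<open>n\<close>, and both counts
    are then 0.\<close>
  also have "attempts (p + b ^ lev p) = attempts (p + blk p)"
    by (cases "p + b ^ lev p \<le> n") (auto simp: blk_def min_def attempts_ge)
  finally show ?thesis by simp
qed

text \<open>One climb to the top level; from there on every block has size
  \<open>b ^ (h - 1)\<close>.\<close>

lemma attempts_le: "attempts p \<le> (h - 1) * b + n div b ^ (h - 1) + 1"
proof -
  define k where "k = h - 1"
  have k: "k < h" "\<not> Suc k < h" using h by (auto simp: k_def)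
  define e where "e = (p + (b ^ k - 1)) div b ^ k * b ^ k"
  have e: "b ^ k dvd e" "p \<le> e" "e < p + b ^ k"
  proof -
    have "e + (p + (b ^ k - 1)) mod b ^ k = p + (b ^ k - 1)" unfolding e_def by (rule div_mult_mod_eq)
    moreover have "(p + (b ^ k - 1)) mod b ^ k < b ^ k" using b by simp
    ultimately show "p \<le> e" "e < p + b ^ k" using pow_pos[of k] by linarith+
  qed (simp add: e_def)
  have "attempts p \<le> k * b + attempts e" using k(1) e by (rule attempts_climb)
  also have "attempts e \<le> (n div b ^ k + 1) + attempts (e + (n div b ^ k + 1) * b ^ k)"
    by (rule attempts_same_level) (use k e in auto)
  also have "attempts (e + (n div b ^ k + 1) * b ^ k) = 0"
    using dividend_less_div_times[of "b ^ k" n] b by (intro attempts_ge) (simp add: add_ac)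
  finally show ?thesis by (simp add: k_def)
qed

definition multiples :: "nat \<Rightarrow> nat \<Rightarrow> nat" where
  "multiples k p = card {p' \<in> {p..<n}. b ^ k dvd p'}"

lemma multiples_Suc: "p < n \<Longrightarrow> multiples k p = (if b ^ k dvd p then 1 else 0) + multiples k (Suc p)"
proof -
  assume "p < n"
  then have "{p..<n} = insert p {Suc p..<n}" by auto
  then have "{p' \<in> {p..<n}. b ^ k dvd p'} = (if b ^ k dvd p then {p} else {}) \<union> {p' \<in> {Suc p..<n}. b ^ k dvd p'}"
    by auto
  then show ?thesis by (simp add: multiples_def card_insert_if)
qed

lemma multiples_le: "multiples k p \<le> n div b ^ k + 1"
proof -
  have "{p' \<in> {p..<n}. b ^ k dvd p'} \<subseteq> (\<lambda>c. b ^ k * c) ` {..n div b ^ k}"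
    using b by (auto simp: dvd_def image_iff less_eq_div_iff_mult_less_eq mult.commute intro: less_imp_le)
  then have "multiples k p \<le> card ((\<lambda>c. b ^ k * c) ` {..n div b ^ k})"
    unfolding multiples_def by (intro card_mono) auto
  also have "\<dots> \<le> card {..n div b ^ k}" by (rule card_image_le) simp
  finally show ?thesis by simp
qed

text \<open>Exchanges positions for levels: the blocks aligned to \<open>b ^ k\<close> have total
  length at most \<open>n + b ^ k\<close>.\<close>

lemma sum_blk_le:
  assumes "\<And>k. k < h \<Longrightarrow> b ^ k \<le> n"
  shows "(\<Sum>p\<in>{0..<n}. blk p) \<le> 2 * n * h"
proof -
  have "blk p \<le> (\<Sum>k<h. if b ^ k dvd p then b ^ k else 0)" for p
  proof -
    have "blk p \<le> b ^ lev p" by (simp add: blk_def)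
    also have "\<dots> \<le> (\<Sum>k<h. if b ^ k dvd p then b ^ k else 0)"
      using lev[of p] member_le_sum[of "lev p" "{..<h}" "\<lambda>k. if b ^ k dvd p then b ^ k else 0"] by auto
    finally show ?thesis .
  qed
  then have "(\<Sum>p\<in>{0..<n}. blk p) \<le> (\<Sum>p\<in>{0..<n}. \<Sum>k<h. if b ^ k dvd p then b ^ k else 0)"
    by (intro sum_mono)
  also have "\<dots> = (\<Sum>k<h. \<Sum>p\<in>{0..<n}. if b ^ k dvd p then b ^ k else 0)" by (rule sum.swap)
  also have "\<dots> = (\<Sum>k<h. multiples k 0 * b ^ k)"
    by (simp add: multiples_def sum.If_cases Int_def)
  also have "\<dots> \<le> (\<Sum>k<h. 2 * n)"
  proof (intro sum_mono)
    fix k assume "k \<in> {..<h}"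
    have "multiples k 0 * b ^ k \<le> (n div b ^ k + 1) * b ^ k" by (intro mult_right_mono multiples_le) simp
    also have "\<dots> \<le> n + b ^ k" using div_times_less_eq_dividend[of n "b ^ k"] by (simp add: add_ac)
    also have "\<dots> \<le> 2 * n" using assms \<open>k \<in> {..<h}\<close> by auto
    finally show "multiples k 0 * b ^ k \<le> 2 * n" .
  qed
  finally show ?thesis by (simp add: mult_ac)
qed

definition gap :: "nat \<Rightarrow> nat \<Rightarrow> nat" where
  "gap k p = (if b ^ k dvd p then 0 else b ^ k - p mod b ^ k)"

lemma gap_le: "gap k p < b ^ k"
  using b by (auto simp: gap_def mod_greater_zero_iff_not_dvd)

lemma gap_Suc: "gap k (Suc p) = (if b ^ k dvd p then b ^ k - 1 else gap k p - 1)"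
proof -
  define l where "l = b ^ k"
  have l: "l \<ge> 1" using pow_pos by (simp add: l_def)
  have m: "p mod l < l" using l by simp
  have S: "Suc p mod l = (if Suc (p mod l) = l then 0 else Suc (p mod l))" by (rule mod_Suc)
  show ?thesis
  proof (cases "p mod l = 0")
    case True
    then show ?thesis using S l by (simp add: gap_def dvd_eq_mod_eq_0 flip: l_def)
  next
    case False
    then show ?thesis using S m by (simp add: gap_def dvd_eq_mod_eq_0 flip: l_def)
  qed
qed

end

section \<open>Telescoping of the entropies, level by level\<close>

locale ladder_target = ladder n b h + target_sampler n q "ladder.blk n b h" \<pi> \<kappa>
  for n b h q :: nat and \<pi> :: "(nat \<Rightarrow> nat) pmf" and \<kappa> :: marginals
begin

lemma reveal_cong:
  assumes "pos S z" "\<And>S' z'. pos S' z' \<Longrightarrow> card S' = Suc (card S) \<Longrightarrow> f S' z' = g S' z'"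
  shows "reveal f S z = reveal g S z"
  using assms by (intro antisym reveal_mono) auto

text \<open>
  Summed over all blocks of size \<open>b ^ k\<close> still to come, the expected relative entropies telescope;
  \<open>pot k\<close> is a closed form for this sum, also valid in the middle of a block.
\<close>

definition pot :: "nat \<Rightarrow> nat set \<Rightarrow> (nat \<Rightarrow> nat) \<Rightarrow> real" where
  "pot k S z = (\<Sum>t<gap k (card S). future_ent t S z)
     + real (b ^ k - gap k (card S)) * future_ent (gap k (card S)) S z"

lemma pot_nonneg: "0 \<le> pot k S z"
  unfolding pot_def by (intro add_nonneg_nonneg sum_nonneg mult_nonneg_nonneg future_ent_nonneg) simp

lemma pot_le:
  assumes "pos S z"
  shows "pot k S z \<le> real (b ^ k) * ln (real q)"
proof -
  let ?g = "gap k (card S)"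
  have "pot k S z \<le> (\<Sum>t<?g. ln (real q)) + real (b ^ k - ?g) * ln (real q)"
    unfolding pot_def by (intro add_mono sum_mono mult_left_mono future_ent_le_ln assms) auto
  also have "\<dots> = real (?g + (b ^ k - ?g)) * ln (real q)" by (simp only: of_nat_add distrib_right) simp
  also have "?g + (b ^ k - ?g) = b ^ k" using gap_le[of k "card S"] by simp
  finally show ?thesis .
qed

text \<open>At an aligned position \<open>pot\<close> is \<open>b ^ k * ent\<close>, and after one
  revelation it is a sum of \<open>b ^ k\<close> later entropies; the difference covers the relative
  entropy of the block. At other positions a present entropy is exchanged for a later one, which is
  smaller in mean.\<close>

lemma pot_step:
  assumes "pos S z"
  shows "reveal (pot k) S z
    + (if b ^ k dvd card S then real (b ^ k) * ent S z - (\<Sum>t<b ^ k. future_ent t S z) else 0) \<le> pot k S z"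
proof (cases "b ^ k dvd card S")
  case True
  obtain l where l: "b ^ k = Suc l" using pow_pos[of k] by (cases "b ^ k") auto
  have "reveal (pot k) S z = reveal (\<lambda>S z. \<Sum>t<b ^ k. future_ent t S z) S z"
  proof (rule reveal_cong[OF assms])
    fix S' :: "nat set" and z' assume c: "card S' = Suc (card S)"
    have "gap k (card S') = l" using True by (simp add: c gap_Suc l)
    then show "pot k S' z' = (\<Sum>t<b ^ k. future_ent t S' z')" by (simp add: pot_def l)
  qed
  also have "\<dots> = (\<Sum>t<b ^ k. future_ent (Suc t) S z)" by (simp add: reveal_sum future_ent_Suc)
  also have "\<dots> \<le> (\<Sum>t<b ^ k. future_ent t S z)" by (intro sum_mono future_ent_Suc_le assms)
  finally have "reveal (pot k) S z \<le> (\<Sum>t<b ^ k. future_ent t S z)" .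
  moreover have "pot k S z = real (b ^ k) * ent S z"
    using True by (simp add: pot_def gap_def future_ent_0)
  ultimately show ?thesis using True by simp
next
  case False
  then have "gap k (card S) > 0" using gap_le[of k "card S"] b
    by (auto simp: gap_def)
  then obtain u where u: "gap k (card S) = Suc u" by (metis Suc_pred')
  have ul: "Suc u < b ^ k" using gap_le[of k "card S"] by (simp add: u)
  have "reveal (pot k) S z =
    reveal (\<lambda>S z. (\<Sum>t<u. future_ent t S z) + real (b ^ k - u) * future_ent u S z) S z"
  proof (rule reveal_cong[OF assms])
    fix S' :: "nat set" and z' assume c: "card S' = Suc (card S)"
    have "gap k (card S') = u" using False by (simp add: c gap_Suc u)
    then show "pot k S' z' = (\<Sum>t<u. future_ent t S' z') + real (b ^ k - u) * future_ent u S' z'"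
      by (simp add: pot_def)
  qed
  also have "\<dots> = (\<Sum>t<u. future_ent (Suc t) S z) + real (b ^ k - u) * future_ent (Suc u) S z"
    by (simp add: reveal_add reveal_sum reveal_cmult future_ent_Suc)
  also have "b ^ k - u = Suc (b ^ k - Suc u)" using ul by simp
  also have "(\<Sum>t<u. future_ent (Suc t) S z) + real (Suc (b ^ k - Suc u)) * future_ent (Suc u) S z =
    (\<Sum>t<u. future_ent (Suc t) S z) + real (b ^ k - Suc u) * future_ent (Suc u) S z + future_ent (Suc u) S z"
    by (simp add: distrib_right)
  also have "\<dots> \<le> (\<Sum>t<u. future_ent (Suc t) S z) + real (b ^ k - Suc u) * future_ent (Suc u) S z + future_ent 0 S z"
    by (intro add_left_mono future_ent_antimono assms) simp
  also have "\<dots> = pot k S z"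
    unfolding pot_def u sum.lessThan_Suc_shift by simp
  finally show ?thesis using False by simp
qed

text \<open>The bracket bounds the expected number of failures to come and \<open>K\<close> is the
  price of one. \<open>\<beta>\<close> is the price of the expected tests of one attempt; since
  every attempt settles a coordinate, at most \<open>n - card S\<close> attempts remain.\<close>

definition weight :: "real \<Rightarrow> (nat \<Rightarrow> real) \<Rightarrow> real \<Rightarrow> nat set \<Rightarrow> (nat \<Rightarrow> nat) \<Rightarrow> real" where
  "weight K \<alpha> \<beta> S z = K * (\<Sum>k<h. \<alpha> k * real (multiples k (card S)) + 6 / \<alpha> k * pot k S z) + \<beta> * real (n - card S)"

lemma weight_nonneg: "0 \<le> K \<Longrightarrow> (\<And>k. 0 < \<alpha> k) \<Longrightarrow> 0 \<le> \<beta> \<Longrightarrow> 0 \<le> weight K \<alpha> \<beta> S z"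
  unfolding weight_def
  by (intro add_nonneg_nonneg mult_nonneg_nonneg sum_nonneg pot_nonneg divide_nonneg_nonneg) (auto intro: less_imp_le)

lemma weight_le:
  assumes "0 \<le> K" "\<And>k. 0 < \<alpha> k" "0 \<le> \<beta>" "pos S z"
  shows "weight K \<alpha> \<beta> S z \<le>
    K * (\<Sum>k<h. \<alpha> k * real (n div b ^ k + 1) + 6 / \<alpha> k * (real (b ^ k) * ln (real q))) + \<beta> * real n"
proof -
  have "\<alpha> k * real (multiples k (card S)) + 6 / \<alpha> k * pot k S z \<le>
    \<alpha> k * real (n div b ^ k + 1) + 6 / \<alpha> k * (real (b ^ k) * ln (real q))" for k
    using assms(2)[of k] multiples_le[of k "card S"] pot_le[OF assms(4), of k]
    by (intro add_mono mult_left_mono of_nat_mono) auto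
  then have "(\<Sum>k<h. \<alpha> k * real (multiples k (card S)) + 6 / \<alpha> k * pot k S z) \<le>
    (\<Sum>k<h. \<alpha> k * real (n div b ^ k + 1) + 6 / \<alpha> k * (real (b ^ k) * ln (real q)))"
    by (intro sum_mono)
  then show ?thesis unfolding weight_def using assms(1,3) by (intro add_mono mult_left_mono) auto
qed

text \<open>Only the level of the current block has to release its share, the other levels merely
  must not increase. A block truncated at \<open>n\<close> has fewer terms than
  \<open>b ^ k\<close>, and the missing ones are nonnegative.\<close>

lemma weight_step:
  fixes S :: "nat set"
  defines "k \<equiv> lev (card S)" and "m \<equiv> blk (card S)"
  assumes K: "0 \<le> K" and \<alpha>: "\<And>k. 0 < \<alpha> k" and S: "pos S z" "card S < n"
  shows "reveal (weight K \<alpha> \<beta>) S z + K * (\<alpha> k + 6 / \<alpha> k * (real m * ent S z - (\<Sum>t<m. future_ent t S z))) + \<beta>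
    \<le> weight K \<alpha> \<beta> S z"
proof -
  let ?p = "card S"
  let ?X = "real m * ent S z - (\<Sum>t<m. future_ent t S z)"
  let ?old = "\<lambda>k'. \<alpha> k' * real (multiples k' ?p) + 6 / \<alpha> k' * pot k' S z"
  let ?new = "\<lambda>k'. \<alpha> k' * real (multiples k' (Suc ?p)) + 6 / \<alpha> k' * reveal (pot k') S z"
  have "reveal (weight K \<alpha> \<beta>) S z =
    reveal (\<lambda>S z. (K * (\<Sum>k<h. \<alpha> k * real (multiples k (Suc ?p))) + \<beta> * real (n - Suc ?p))
      + K * (\<Sum>k<h. 6 / \<alpha> k * pot k S z)) S z"
    by (rule reveal_cong[OF S(1)]) (simp add: weight_def sum.distrib distrib_left)
  also have "\<dots> = (K * (\<Sum>k<h. \<alpha> k * real (multiples k (Suc ?p))) + \<beta> * real (n - Suc ?p))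
      + K * (\<Sum>k<h. 6 / \<alpha> k * reveal (pot k) S z)"
    by (simp only: reveal_add reveal_const[OF S] reveal_cmult reveal_sum[OF finite_lessThan])
  also have "\<dots> = K * (\<Sum>k<h. ?new k) + \<beta> * real (n - Suc ?p)"
    by (simp add: sum.distrib distrib_left)
  finally have rev: "reveal (weight K \<alpha> \<beta>) S z = K * (\<Sum>k<h. ?new k) + \<beta> * real (n - Suc ?p)" .
  have le: "?new k' \<le> ?old k'" for k'
  proof -
    have "multiples k' (Suc ?p) \<le> multiples k' ?p" using multiples_Suc[OF S(2)] by simp
    moreover have "0 \<le> (if b ^ k' dvd ?p then real (b ^ k') * ent S z - (\<Sum>t<b ^ k'. future_ent t S z) else 0)"
    proof -
      have "(\<Sum>t<b ^ k'. future_ent t S z) \<le> (\<Sum>t<b ^ k'. ent S z)"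
        using future_ent_antimono[OF S(1), of 0] by (intro sum_mono) (simp add: future_ent_0)
      then show ?thesis by simp
    qed
    then have "reveal (pot k') S z \<le> pot k' S z" using pot_step[OF S(1), of k'] by linarith
    ultimately show ?thesis using \<alpha>[of k'] by (intro add_mono mult_left_mono of_nat_mono) auto
  qed
  have kh: "k < h" "b ^ k dvd ?p" using lev[of ?p] by (simp_all add: k_def)
  have "?new k + (\<alpha> k + 6 / \<alpha> k * ?X) \<le> ?old k"
  proof -
    have "?X = (\<Sum>t<m. ent S z - future_ent t S z)" by (simp add: sum_subtractf)
    also have "\<dots> \<le> (\<Sum>t<b ^ k. ent S z - future_ent t S z)"
      using future_ent_antimono[OF S(1), of 0]
      by (intro sum_mono2) (auto simp: m_def k_def blk_def future_ent_0)
    also have "\<dots> = real (b ^ k) * ent S z - (\<Sum>t<b ^ k. future_ent t S z)" by (simp add: sum_subtractf)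
    finally have "reveal (pot k) S z + ?X \<le> pot k S z" using pot_step[OF S(1), of k] kh by simp
    then have "6 / \<alpha> k * (reveal (pot k) S z + ?X) \<le> 6 / \<alpha> k * pot k S z"
      using \<alpha>[of k] by (intro mult_left_mono) auto
    then show ?thesis using multiples_Suc[OF S(2), of k] kh by (simp add: distrib_left)
  qed
  moreover have "(\<Sum>k'\<in>{..<h} - {k}. ?new k') \<le> (\<Sum>k'\<in>{..<h} - {k}. ?old k')" by (intro sum_mono le)
  moreover have "(\<Sum>k<h. ?new k) = ?new k + (\<Sum>k'\<in>{..<h} - {k}. ?new k')"
    "(\<Sum>k<h. ?old k) = ?old k + (\<Sum>k'\<in>{..<h} - {k}. ?old k')"
    using kh by (auto intro!: sum.remove)
  ultimately have "(\<Sum>k<h. ?new k) + (\<alpha> k + 6 / \<alpha> k * ?X) \<le> (\<Sum>k<h. ?old k)" by linarith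
  then have "K * ((\<Sum>k<h. ?new k) + (\<alpha> k + 6 / \<alpha> k * ?X)) \<le> K * (\<Sum>k<h. ?old k)"
    using K by (rule mult_left_mono)
  then have "K * (\<Sum>k<h. ?new k) + K * (\<alpha> k + 6 / \<alpha> k * ?X) \<le> K * (\<Sum>k<h. ?old k)"
    by (simp only: distrib_left)
  moreover have "real (n - ?p) = real (n - Suc ?p) + 1" using S(2) by simp
  then have "\<beta> * real (n - ?p) = \<beta> * real (n - Suc ?p) + \<beta>" by (simp only: distrib_left mult_1_right)
  ultimately show ?thesis unfolding rev weight_def by linarith
qed

end

section \<open>Prices of failures and tests, and a potential bounded over all states of positive
  probability\<close>

locale ladder_potential = ladder_target n b h q \<pi> \<kappa>
  for n b h q :: nat and \<pi> :: "(nat \<Rightarrow> nat) pmf" and \<kappa> :: marginals +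
  fixes \<eta> :: real and J :: nat and \<alpha> :: "nat \<Rightarrow> real" and K \<beta> :: real
  assumes \<eta>: "0 < \<eta>" "\<eta> \<le> 1" and \<alpha>: "\<And>k. 0 < \<alpha> k"
    and K: "K = \<eta> * real ((h - 1) * b) + ((1 + \<eta>) ^ Suc J - 1)"
    and \<beta>: "\<beta> = 2 * \<eta> * (1 + \<eta>) ^ J / 2 ^ J"
    and budget: "\<eta> * real ((h - 1) * b + n div b ^ (h - 1) + 1)
      + (K * (\<Sum>k<h. \<alpha> k * real (n div b ^ k + 1) + 6 / \<alpha> k * (real (b ^ k) * ln (real q))) + \<beta> * real n) \<le> 1 / 2"
begin

text \<open>Solves \<open>A j = \<eta> + (1 + \<eta>) * A (Suc j)\<close> for \<open>j < J\<close>,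
  so these batches are prepaid in full; from \<open>J\<close> on it stays at
  \<open>\<eta>\<close>.\<close>

definition A :: "nat \<Rightarrow> real" where
  "A j = (1 + \<eta>) ^ Suc (J - j) - 1"

text \<open>From batch \<open>J\<close> on, the tests of a lost batch pay exactly
  \<open>\<eta>\<close> towards the next one; before that the price is compounded by
  \<open>1 + \<eta>\<close> per batch. The divisor \<open>l\<close> makes
  \<open>B l 0 * l = \<beta>\<close> independent of the block length.\<close>

definition B :: "nat \<Rightarrow> nat \<Rightarrow> real" where
  "B l j = 2 * \<eta> * (1 + \<eta>) ^ (J - j) / (real l * 2 ^ max j J)"

definition total :: "nat set \<Rightarrow> (nat \<Rightarrow> nat) \<Rightarrow> real" where
  "total S z = \<eta> * real (attempts (card S)) + weight K \<alpha> \<beta> S z"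

lemma A_ge: "\<eta> \<le> A j"
proof -
  have "(1 + \<eta>) * 1 \<le> (1 + \<eta>) * (1 + \<eta>) ^ (J - j)" using \<eta> by (intro mult_left_mono one_le_power) auto
  then show ?thesis by (simp add: A_def)
qed

lemma B_pos: "l \<ge> 1 \<Longrightarrow> 0 < B l j"
  using \<eta> by (simp add: B_def)

lemma B_Suc:
  assumes "l \<ge> 1"
  shows "(1 + \<eta>) * B l (Suc j) \<le> B l j"
proof (cases "j < J")
  case True
  then have "J - j = Suc (J - Suc j)" "max (Suc j) J = J" "max j J = J" by auto
  then show ?thesis by (simp add: B_def mult_ac)
next
  case False
  then have m: "J - j = 0" "J - Suc j = 0" "max (Suc j) J = Suc j" "max j J = j" by auto
  have half: "B l (Suc j) = B l j / 2" unfolding B_def m by simp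
  have "(1 + \<eta>) * (B l j / 2) \<le> 2 * (B l j / 2)"
    using \<eta> B_pos[OF assms, of j] by (intro mult_right_mono) auto
  then show ?thesis unfolding half by simp
qed

lemma A_Suc:
  assumes "l \<ge> 1"
  shows "\<eta> + (1 + \<eta>) * A (Suc j) \<le> A j + (1 + \<eta>) * B l (Suc j) * real (l * 2 ^ j)"
proof (cases "j < J")
  case True
  then have "J - j = Suc (J - Suc j)" by auto
  then have "\<eta> + (1 + \<eta>) * A (Suc j) = A j" by (simp add: A_def algebra_simps)
  moreover have "0 \<le> (1 + \<eta>) * B l (Suc j) * real (l * 2 ^ j)"
    using B_pos[OF assms] \<eta> by (intro mult_nonneg_nonneg) (auto intro: less_imp_le)
  ultimately show ?thesis by simp
next
  case False
  then have m: "J - j = 0" "J - Suc j = 0" "max (Suc j) J = Suc j" by auto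
  have "B l (Suc j) * real (l * 2 ^ j) = \<eta>" using assms unfolding B_def m by (simp add: field_simps)
  then show ?thesis by (simp add: A_def m mult.assoc)
qed

lemma K_nonneg: "0 \<le> K" and \<beta>_nonneg: "0 \<le> \<beta>"
proof -
  have "0 \<le> A 0" using A_ge[of 0] \<eta> by simp
  then show "0 \<le> K" using \<eta> by (simp add: K A_def)
  show "0 \<le> \<beta>" using \<eta> by (simp add: \<beta>)
qed

lemma total_nonneg: "0 \<le> total S z"
  unfolding total_def using \<eta> weight_nonneg[where \<alpha> = \<alpha>, OF K_nonneg \<alpha> \<beta>_nonneg] by simp

lemma total_le: "pos S z \<Longrightarrow> total S z \<le> 1 / 2"
proof -
  assume p: "pos S z"
  have "\<eta> * real (attempts (card S)) \<le> \<eta> * real ((h - 1) * b + n div b ^ (h - 1) + 1)"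
    using \<eta> attempts_le[of "card S"] by (intro mult_left_mono of_nat_mono) auto
  then show ?thesis unfolding total_def
    by (rule order_trans[OF add_mono[OF _ weight_le[where \<alpha> = \<alpha>, OF K_nonneg \<alpha> \<beta>_nonneg p]] budget])
qed

text \<open>On a null configuration the kernel is arbitrary and no drift is available, hence the
  infinite value. From positive configurations the true chain reaches null ones with probability
  0.\<close>

definition cost :: "nat set \<Rightarrow> (nat \<Rightarrow> nat) \<Rightarrow> ennreal" where
  "cost S z = (if pos S z then ennreal (total S z) else \<top>)"

lemma cost_half: "cost S z \<le> 1/2 \<or> cost S z = \<top>"
proof (cases "pos S z")
  case True
  have "(1/2 :: ennreal) = ennreal (1/2)"
    by (metis divide_ennreal ennreal_1 ennreal_numeral zero_le_one zero_less_numeral)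
  then show ?thesis using total_le[OF True] by (simp add: cost_def ennreal_leI del: ennreal_half)
qed (simp add: cost_def)

text \<open>\<open>weight_step\<close> pays for a possible failure and for the tests, so the loss of
  one attempt is a net gain of \<open>2 * \<eta>\<close>. Half of it absorbs the factor
  \<open>1 + \<eta>\<close> on the constant 1, the other half absorbs it on
  \<open>2 * total\<close>, which is at most 1.\<close>

lemma cost_start:
  assumes S: "S \<subseteq> {1..n}" "z \<in> configs q S" "card S < n"
  shows "ennreal (1 + \<eta>) * stopped_avg S z (ennreal (2 * B (blk (card S)) 0)) (\<lambda>S z. 1 + 2 * cost S z)
        (\<lambda>S z. 1 + ennreal (2 * A 0) + 2 * cost S z) (blk (card S)) 1 S z \<le> 1 + 2 * cost S z"
proof (cases "pos S z")
  case True
  let ?p = "card S" and ?l = "blk (card S)" and ?k = "lev (card S)"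
  let ?e = "card S + blk (card S)"
  let ?W = "weight K \<alpha> \<beta>"
  \<comment> \<open>The count of attempts stays outside \<open>f\<close>: it can grow inside a
    block, so it is taken at the end of the block and the excess after a failure is put into
    \<open>M\<close>.\<close>
  define f where "f S z = (if pos S z then ennreal (2 * ?W S z) else \<top>)" for S z
  define Q where "Q = 1 + ennreal (2 * \<eta> * real (attempts ?e))"
  define M where "M = ennreal (2 * K)"
  let ?X = "real ?l * ent S z - (\<Sum>t<?l. future_ent t S z)"
  note W0 = weight_nonneg[where \<alpha> = \<alpha>, OF K_nonneg \<alpha> \<beta>_nonneg]
  have l: "1 \<le> ?l" "?p + ?l \<le> n" using blk_pos[OF S(3)] blk_le[OF S(3)] S(3) by auto
  have X0: "0 \<le> ?X"
  proof -
    have "(\<Sum>t<?l. future_ent t S z) \<le> (\<Sum>t<?l. ent S z)"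
      using future_ent_antimono[OF True, of 0] by (intro sum_mono) (simp add: future_ent_0)
    then show ?thesis by simp
  qed
  have fc: "forecast f S z \<le> ennreal (2 * reveal ?W S z)" if p: "pos S z" "card S < n" for S z
  proof -
    have "forecast f S z \<le> ennreal (avg (\<lambda>S z i. \<Sum>a\<in>{1..q}. pmf (\<kappa> S i z) a * (2 * ?W (insert i S) (z(i := a)))) S z)"
      unfolding forecast_def
      using nn_integral_reveal_le[OF p, of "\<lambda>i a. f (insert i S) (z(i := a))" "\<lambda>i a. 2 * ?W (insert i S) (z(i := a))"]
        pos_reveal(1)[OF p(1)] W0 by (simp add: f_def avg_def)
    also have "avg (\<lambda>S z i. \<Sum>a\<in>{1..q}. pmf (\<kappa> S i z) a * (2 * ?W (insert i S) (z(i := a)))) S z = 2 * reveal ?W S z"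
      using reveal_cmult[of 2 ?W S z] by (simp add: reveal_def)
    finally show ?thesis .
  qed
  have rW: "reveal ?W S z + K * (\<alpha> ?k + 6 / \<alpha> ?k * ?X) + \<beta> \<le> ?W S z"
    by (rule weight_step[where \<alpha> = \<alpha>, OF K_nonneg \<alpha> True S(3)])
  have super: "forecast f S z \<le> f S z" if "S \<subseteq> {1..n}" "card S < n" "z \<in> configs q S" for S z
  proof (cases "pos S z")
    case p: True
    let ?X = "real (blk (card S)) * ent S z - (\<Sum>t<blk (card S). future_ent t S z)"
    have "(\<Sum>t<blk (card S). future_ent t S z) \<le> (\<Sum>t<blk (card S). ent S z)"
      using future_ent_antimono[OF p, of 0] by (intro sum_mono) (simp add: future_ent_0)
    then have "0 \<le> K * (\<alpha> (lev (card S)) + 6 / \<alpha> (lev (card S)) * ?X)"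
      using K_nonneg \<alpha>[of "lev (card S)"] by (intro mult_nonneg_nonneg add_nonneg_nonneg) auto
    then have "reveal ?W S z \<le> ?W S z"
      using weight_step[where K = K and \<alpha> = \<alpha> and \<beta> = \<beta>, OF K_nonneg \<alpha> p that(2)] \<beta>_nonneg by linarith
    then show ?thesis using fc[OF p that(2)] p by (simp add: f_def ennreal_leI order_trans)
  qed (simp add: f_def)
  have cost_f: "1 + 2 * cost S' z' = f S' z' + (1 + ennreal (2 * \<eta> * real (attempts (card S'))))" for S' z'
  proof (cases "pos S' z'")
    case True
    have "2 * ennreal (total S' z') = ennreal (2 * total S' z')"
      using total_nonneg by (simp add: ennreal_mult)
    also have "\<dots> = ennreal (2 * ?W S' z' + 2 * \<eta> * real (attempts (card S')))"
      by (simp add: total_def algebra_simps)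
    also have "\<dots> = ennreal (2 * ?W S' z') + ennreal (2 * \<eta> * real (attempts (card S')))"
      using W0 \<eta> by (intro ennreal_plus) auto
    finally show ?thesis using True by (simp add: cost_def f_def add_ac)
  qed (simp add: cost_def f_def ennreal_mult_eq_top_iff)
  have "stopped_avg S z (ennreal (2 * B ?l 0)) (\<lambda>S z. 1 + 2 * cost S z)
        (\<lambda>S z. 1 + ennreal (2 * A 0) + 2 * cost S z) ?l 1 S z \<le>
      forecast f S z + Q + M * stop_prob S z ?l 1 S z + ennreal (2 * B ?l 0) * of_nat ?l"
  proof (rule stopped_avg_le[where e = ?e and ?p0.0 = ?p])
    show "1 + 2 * cost S' z' \<le> f S' z' + Q" if "card S' = ?e" for S' z'
      unfolding cost_f Q_def using that by simp
    show "1 + ennreal (2 * A 0) + 2 * cost S' z' \<le> f S' z' + Q + M" if "?p < card S'" "card S' \<le> ?e" for S' z'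
    proof -
      have at: "attempts (card S') \<le> (h - 1) * b + attempts ?e"
        by (rule attempts_after_failure[OF S(3) that])
      have "1 + ennreal (2 * A 0) + 2 * cost S' z' = ennreal (2 * A 0) + (1 + 2 * cost S' z')" by (simp only: add_ac)
      also have "\<dots> = f S' z' + 1 + ennreal (2 * A 0 + 2 * \<eta> * real (attempts (card S')))"
        unfolding cost_f using \<eta> A_ge[of 0] by (simp add: ennreal_plus add_ac)
      also have "\<dots> \<le> f S' z' + 1 + ennreal (2 * A 0 + 2 * \<eta> * real ((h - 1) * b + attempts ?e))"
        using \<eta> at by (intro add_left_mono ennreal_leI mult_left_mono of_nat_mono) auto
      \<comment> \<open>\<open>K\<close> was chosen as the cost of the climb after a failure plus
        \<open>A 0\<close>, the prepaid batches.\<close>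
      also have "2 * A 0 + 2 * \<eta> * real ((h - 1) * b + attempts ?e) = 2 * \<eta> * real (attempts ?e) + 2 * K"
        by (simp add: K A_def algebra_simps)
      also have "ennreal \<dots> = ennreal (2 * \<eta> * real (attempts ?e)) + ennreal (2 * K)"
        using \<eta> K_nonneg by (intro ennreal_plus) auto
      finally show ?thesis by (simp add: Q_def M_def add_ac)
    qed
  qed (use super S l in auto)
  also have "\<dots> \<le> ennreal (2 * reveal ?W S z) + Q + M * ennreal (\<alpha> ?k + 6 / \<alpha> ?k * ?X) + ennreal (2 * \<beta>)"
  proof (intro add_mono mult_left_mono fc True S(3) order_refl)
    show "stop_prob S z ?l 1 S z \<le> ennreal (\<alpha> ?k + 6 / \<alpha> ?k * ?X)"
      by (rule stop_prob_le_entropy[OF \<alpha> True l(2)])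
    have "ennreal (2 * B ?l 0) * of_nat ?l = ennreal (2 * B ?l 0 * real ?l)"
      using B_pos[OF l(1), of 0] by (simp add: ennreal_of_nat_eq_real_of_nat flip: ennreal_mult)
    also have "2 * B ?l 0 * real ?l = 2 * \<beta>" using l(1) by (simp add: B_def \<beta>)
    finally show "ennreal (2 * B ?l 0) * of_nat ?l \<le> ennreal (2 * \<beta>)" by simp
  qed simp
  also have "\<dots> = ennreal (1 + 2 * (reveal ?W S z + \<eta> * real (attempts ?e) + K * (\<alpha> ?k + 6 / \<alpha> ?k * ?X) + \<beta>))"
  proof -
    have "0 \<le> reveal ?W S z" unfolding reveal_def avg_def using W0
      by (intro divide_nonneg_nonneg sum_nonneg mult_nonneg_nonneg) auto
    moreover have "0 \<le> \<alpha> ?k + 6 / \<alpha> ?k * ?X" using \<alpha>[of ?k] X0 by (intro add_nonneg_nonneg mult_nonneg_nonneg) auto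
    moreover have "ennreal (2 * r) + (1 + ennreal (2 * \<eta> * a)) + ennreal (2 * K) * ennreal y + ennreal (2 * \<beta>) =
        ennreal (1 + 2 * (r + \<eta> * a + K * y + \<beta>))" if "0 \<le> r" "0 \<le> y" "0 \<le> a" for r y a
    proof -
      have "1 + 2 * (r + \<eta> * a + K * y + \<beta>) = 2 * r + (1 + 2 * \<eta> * a) + 2 * K * y + 2 * \<beta>" by simp
      then show ?thesis using that \<eta> K_nonneg \<beta>_nonneg by (simp only: ennreal_plus ennreal_mult) (simp add: ennreal_plus ennreal_mult)
    qed
    ultimately show ?thesis unfolding Q_def M_def by simp
  qed
  also have "\<dots> \<le> ennreal (1 + 2 * (total S z - \<eta>))"
  proof -
    have "attempts ?p = Suc (attempts ?e)" by (rule attempts_blk[OF S(3)])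
    then have "total S z - \<eta> = \<eta> * real (attempts ?e) + ?W S z" by (simp add: total_def distrib_left)
    moreover have "1 + 2 * (r + a + y + c) \<le> 1 + 2 * t" if "t = a + w" "r + y + c \<le> w" for r a y c w t :: real
      using that by simp
    ultimately show ?thesis using rW by (intro ennreal_leI) blast
  qed
  finally have "ennreal (1 + \<eta>) * stopped_avg S z (ennreal (2 * B ?l 0)) (\<lambda>S z. 1 + 2 * cost S z)
        (\<lambda>S z. 1 + ennreal (2 * A 0) + 2 * cost S z) ?l 1 S z \<le> ennreal (1 + \<eta>) * ennreal (1 + 2 * (total S z - \<eta>))"
    by (intro mult_left_mono) auto
  also have "\<dots> = ennreal ((1 + \<eta>) * (1 + 2 * (total S z - \<eta>)))"
    using \<eta> by (simp add: ennreal_mult')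
  also have "(1 + \<eta>) * (1 + 2 * (total S z - \<eta>)) \<le> 1 + 2 * total S z"
  proof -
    have "\<eta> * total S z \<le> \<eta> * (1 / 2)" using \<eta> total_le[OF True] by (intro mult_left_mono) auto
    moreover have "0 \<le> \<eta> * \<eta>" by simp
    moreover have "(1 + \<eta>) * (1 + 2 * (total S z - \<eta>)) =
        1 + 2 * total S z - \<eta> + 2 * (\<eta> * total S z) - 2 * (\<eta> * \<eta>)"
      by (simp add: algebra_simps)
    ultimately show ?thesis by linarith
  qed
  finally show ?thesis using True total_nonneg[of S z]
    by (simp add: cost_def ennreal_plus ennreal_mult ennreal_leI)
qed (simp add: cost_def ennreal_mult_eq_top_iff)

end

section \<open>Correctness and cost\<close>

definition initial :: "(state + (nat \<Rightarrow> nat)) pmf" where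
  "initial = return_pmf (Inl (Start {} (\<lambda>_. undefined)))"

context target_sampler
begin

lemma Pr_empty: "Pr {} (\<lambda>_. undefined) = 1"
proof -
  have "restrict X {} = (\<lambda>_. undefined)" for X :: "nat \<Rightarrow> nat" by (simp add: restrict_def)
  then show ?thesis by (simp add: Pr_def)
qed

lemma pos_empty: "pos {} (\<lambda>_. undefined)"
  by (simp add: pos_def Pr_empty configs_def)

lemma Pr_full:
  assumes "Pr {1..n} x > 0"
  shows "Pr {1..n} x = pmf \<pi> x" "restrict x {1..n} = x"
proof -
  have restr: "restrict X {1..n} = X" if "X \<in> set_pmf \<pi>" for X
    using target that unfolding distribution_on_configs_def configs_def by (auto intro: PiE_restrict)
  have "set_pmf \<pi> \<inter> {X. restrict X {1..n} = x} \<noteq> {}"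
    using assms unfolding Pr_def by (auto simp: measure_pmf_zero_iff zero_less_measure_iff)
  then show "restrict x {1..n} = x" using restr by auto
  have "Pr {1..n} x = measure_pmf.prob \<pi> ({X. restrict X {1..n} = x} \<inter> set_pmf \<pi>)"
    unfolding Pr_def by (simp add: measure_Int_set_pmf)
  also have "{X. restrict X {1..n} = x} \<inter> set_pmf \<pi> = {x} \<inter> set_pmf \<pi>"
    using restr \<open>restrict x {1..n} = x\<close> by auto
  also have "measure_pmf.prob \<pi> \<dots> = pmf \<pi> x" by (simp add: measure_Int_set_pmf measure_pmf_single)
  finally show "Pr {1..n} x = pmf \<pi> x" .
qed

text \<open>
  The conditional probability of the output \<open>x\<close>. The value 1 on null configurations makes the
  potential superharmonic for every choice of \<open>\<kappa>\<close> there and excludes outputs outside the support.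
\<close>

definition hit :: "(nat \<Rightarrow> nat) \<Rightarrow> nat set \<Rightarrow> (nat \<Rightarrow> nat) \<Rightarrow> real" where
  "hit x S z = (if Pr S z > 0 then if restrict x S = z then pmf \<pi> x / Pr S z else 0 else 1)"

lemma hit_full: "hit x {1..n} x = 1"
  using Pr_full[of x] by (auto simp: hit_def)

text \<open>Only the letter \<open>x i\<close> keeps \<open>hit\<close> alive, and its probability
  cancels against the new denominator. A null configuration has null successors only, so the value 1
  is preserved there.\<close>

lemma forecast_hit:
  assumes S: "S \<subseteq> {1..n}" "card S < n" "z \<in> configs q S"
  shows "forecast (\<lambda>S z. ennreal (hit x S z)) S z \<le> ennreal (hit x S z)"
proof (cases "Pr S z > 0")
  case False
  then have "Pr S z = 0" by (simp add: Pr_def zero_less_measure_iff)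
  note R = remaining[OF S(1,2)]
  have "forecast (\<lambda>S z. ennreal (hit x S z)) S z \<le> (\<integral>\<^sup>+i. \<integral>\<^sup>+a. 1 \<partial>\<kappa> S i z \<partial>pmf_of_set ({1..n} - S))"
    unfolding forecast_def
  proof (intro nn_integral_mono_AE AE_pmfI, goal_cases)
    case (1 i a)
    then have i: "i \<in> {1..n} - S" using R by simp
    have "Pr (insert i S) (z(i := a)) = 0"
      using Pr_marginal[OF S(1) i S(3), of a] \<open>Pr S z = 0\<close> by simp
    then show ?case by (simp add: hit_def)
  qed
  then show ?thesis using False by (simp add: hit_def)
next
  case True
  then have p: "pos S z" using S by (simp add: pos_def)
  have nn: "0 \<le> hit x S z" for S z by (simp add: hit_def Pr_def)
  have "forecast (\<lambda>S z. ennreal (hit x S z)) S z \<le>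
    ennreal (avg (\<lambda>S z i. \<Sum>a\<in>{1..q}. pmf (\<kappa> S i z) a * hit x (insert i S) (z(i := a))) S z)"
    unfolding forecast_def
    using nn_integral_reveal_le[OF p S(2), of "\<lambda>i a. ennreal (hit x (insert i S) (z(i := a)))" "\<lambda>i a. hit x (insert i S) (z(i := a))"] nn
    by (simp add: avg_def)
  also have "avg (\<lambda>S z i. \<Sum>a\<in>{1..q}. pmf (\<kappa> S i z) a * hit x (insert i S) (z(i := a))) S z \<le> avg (\<lambda>_ _ _. hit x S z) S z"
  proof (rule avg_mono)
    fix i assume i: "i \<in> {1..n} - S"
    have term_le: "pmf (\<kappa> S i z) a * hit x (insert i S) (z(i := a)) \<le> (if a = x i then hit x S z else 0)" for a
    proof (cases "pmf (\<kappa> S i z) a = 0")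
      case True
      then show ?thesis using nn by simp
    next
      case False
      then have a: "pmf (\<kappa> S i z) a > 0" by (simp add: pmf_pos)
      have P: "Pr (insert i S) (z(i := a)) > 0" using pos_reveal(1)[OF p i a] by (simp add: pos_def)
      have eq: "restrict x (insert i S) = z(i := a) \<longleftrightarrow> restrict x S = z \<and> x i = a"
        using i by (intro restrict_insert_eq_iff[OF S(3)]) simp
      show ?thesis
      proof (cases "restrict x S = z \<and> x i = a")
        case True
        have "pmf (\<kappa> S i z) a * hit x (insert i S) (z(i := a)) = pmf (\<kappa> S i z) a * (pmf \<pi> x / (Pr S z * pmf (\<kappa> S i z) a))"
          using P True unfolding hit_def eq Pr_marginal[OF S(1) i S(3)] by simp
        also have "\<dots> = hit x S z" using a \<open>Pr S z > 0\<close> True by (simp add: hit_def)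
        finally show ?thesis using True by simp
      next
        case False
        then have "hit x (insert i S) (z(i := a)) = 0" using P unfolding hit_def eq by auto
        then show ?thesis using nn by simp
      qed
    qed
    have "(\<Sum>a\<in>{1..q}. pmf (\<kappa> S i z) a * hit x (insert i S) (z(i := a))) \<le> (\<Sum>a\<in>{1..q}. if a = x i then hit x S z else 0)"
      by (intro sum_mono term_le)
    also have "\<dots> \<le> hit x S z" using nn by (simp add: sum.delta)
    finally show "(\<Sum>a\<in>{1..q}. pmf (\<kappa> S i z) a * hit x (insert i S) (z(i := a))) \<le> hit x S z" .
  qed
  also have "avg (\<lambda>_ _ _. hit x S z) S z = hit x S z"
    using remaining[OF S(1,2)] S(2) by (simp add: avg_def)
  finally show ?thesis by (simp add: ennreal_leI)
qed

lemma ok_initial: "n \<ge> 1 \<Longrightarrow> ok_pmf initial"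
  by (auto simp: initial_def ok_pmf_def configs_def)

text \<open>The final reward \<open>hit x {1..n}\<close> is 1 at \<open>x\<close>, and the potential
  at the start is \<open>pmf \<pi> x\<close>, since the empty configuration has probability
  1.\<close>

lemma output_le:
  assumes "n \<ge> 1"
  shows "spmf (map_spmf (\<lambda>(x, r, m). x) (run \<kappa> (algorithm_from initial))) x \<le> pmf \<pi> x"
proof -
  define V where "V s = (case s of Start S z \<Rightarrow> ennreal (hit x S z)
    | Testing S0 z0 st l j \<Rightarrow> charge \<kappa> S0 z0 0 (\<lambda>S z. ennreal (hit x S z)) st)" for s
  let ?g = "\<lambda>z. ennreal (hit x {1..n} z)"
  have "(\<integral>\<^sup>+(x, r, m). ?g x + 0 * of_nat r + 0 * of_nat m \<partial>measure_spmf (run \<kappa> (algorithm_from initial))) \<le> val V ?g initial"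
  proof (rule run_potential[where queries = queries])
    show "2 * 0 + 0 * of_nat (queries s) + val V ?g (macro \<kappa> s) \<le> V s" if "ok n q s" for s
      using macro_potential_exact[of "\<lambda>S z. ennreal (hit x S z)", OF forecast_hit that]
      unfolding V_def[abs_def] by (simp only: mult_zero_left mult_zero_right add_0)
  qed (use length_queries ok_initial[OF assms] in auto)
  also have "val V ?g initial = ennreal (pmf \<pi> x)"
    by (simp add: initial_def V_def hit_def Pr_empty restrict_def)
  finally have le: "(\<integral>\<^sup>+(x, r, m). ?g x \<partial>measure_spmf (run \<kappa> (algorithm_from initial))) \<le> ennreal (pmf \<pi> x)"
    by (simp add: split_def)
  have "ennreal (spmf (map_spmf (\<lambda>(x, r, m). x) (run \<kappa> (algorithm_from initial))) x) =
    emeasure (measure_spmf (run \<kappa> (algorithm_from initial))) ((\<lambda>(x, r, m). x) -` {x})"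
    by (simp add: spmf_map measure_spmf.emeasure_eq_measure)
  also have "\<dots> = (\<integral>\<^sup>+\<omega>. indicator ((\<lambda>(x, r, m). x) -` {x}) \<omega> \<partial>measure_spmf (run \<kappa> (algorithm_from initial)))"
    by simp
  also have "\<dots> \<le> (\<integral>\<^sup>+(x, r, m). ?g x \<partial>measure_spmf (run \<kappa> (algorithm_from initial)))"
    by (intro nn_integral_mono) (auto simp: hit_full[unfolded One_nat_def] indicator_def)
  also note le
  finally show ?thesis by simp
qed

lemma expected_queries_le:
  assumes "n \<ge> 1"
  shows "expected_queries \<kappa> (algorithm_from initial) \<le> of_nat (12 * (\<Sum>p\<in>{0..<n}. blk p))"
proof -
  define W where "W p = 12 * (\<Sum>p'\<in>{p..<n}. blk p')" for p
  define V :: "state \<Rightarrow> ennreal" where "V s = (case s of Start S z \<Rightarrow> of_nat (W (card S))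
    | Testing S0 z0 st l j \<Rightarrow> of_nat (3 * (l * 2 ^ j)) + 6 * charge \<kappa> S0 z0 1 (\<lambda>_ _. 0) st
        + 1 * charge \<kappa> S0 z0 0 (\<lambda>S z. of_nat (W (card S))) st)" for s
  have "(\<integral>\<^sup>+(x, r, m). 0 + 0 * of_nat r + 1 * of_nat m \<partial>measure_spmf (run \<kappa> (algorithm_from initial))) \<le> val V (\<lambda>_. 0) initial"
  proof (rule run_potential[where queries = queries])
    show "2 * 0 + 1 * of_nat (queries s) + val V (\<lambda>_. 0) (macro \<kappa> s) \<le> V s" if "ok n q s" for s
      using macro_potential_queries[OF that] unfolding V_def[abs_def] W_def[abs_def]
      by (simp only: mult_1_left mult_zero_right add_0)
  qed (use length_queries ok_initial[OF assms] in auto)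
  then show ?thesis by (simp add: expected_queries_def initial_def V_def W_def)
qed

text \<open>The upper bounds over all outputs other than \<open>x\<close> become a lower bound at
  \<open>x\<close> once the total mass is 1.\<close>

lemma exact_if_lossless:
  assumes "n \<ge> 1" "lossless_spmf (run \<kappa> (algorithm_from initial))"
  shows "exact_sampler_for \<pi> \<kappa> (algorithm_from initial)"
  unfolding exact_sampler_for_def
proof (rule spmf_eqI)
  fix x
  let ?out = "map_spmf (\<lambda>(x, r, m). x) (run \<kappa> (algorithm_from initial))"
  have le: "spmf ?out y \<le> pmf \<pi> y" for y by (rule output_le[OF assms(1)])
  have em: "emeasure (measure_spmf p) X = (\<integral>\<^sup>+y. ennreal (spmf p y) * indicator X y \<partial>count_space UNIV)"
    for p :: "(nat \<Rightarrow> nat) spmf" and X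
    using nn_integral_measure_spmf[where f = "indicator X" and p = p] by simp
  have "emeasure (measure_spmf ?out) (- {x}) = (\<integral>\<^sup>+y. ennreal (spmf ?out y) * indicator (- {x}) y \<partial>count_space UNIV)"
    by (rule em)
  also have "\<dots> \<le> (\<integral>\<^sup>+y. ennreal (pmf \<pi> y) * indicator (- {x}) y \<partial>count_space UNIV)"
    using le by (intro nn_integral_mono mult_right_mono ennreal_leI) auto
  also have "\<dots> = emeasure (measure_pmf \<pi>) (- {x})"
    using nn_integral_measure_pmf[where f = "indicator (- {x})" and p = \<pi>] by simp
  finally have "measure (measure_spmf ?out) (- {x}) \<le> measure (measure_pmf \<pi>) (- {x})"
    by (simp add: measure_spmf.emeasure_eq_measure measure_pmf.emeasure_eq_measure)
  also have "\<dots> = 1 - pmf \<pi> x"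
    using measure_pmf.prob_compl[of "{x}" \<pi>] by (simp add: Compl_eq_Diff_UNIV measure_pmf_single)
  finally have "measure (measure_spmf ?out) (- {x}) \<le> 1 - pmf \<pi> x" .
  moreover have "measure (measure_spmf ?out) ({x} \<union> - {x}) = measure (measure_spmf ?out) {x} + measure (measure_spmf ?out) (- {x})"
    by (intro measure_spmf.finite_measure_Union) auto
  moreover have "measure (measure_spmf ?out) UNIV = 1"
    using assms(2) by (simp add: lossless_spmf_def flip: weight_spmf_def)
  ultimately have "pmf \<pi> x \<le> spmf ?out x" by (simp add: spmf_conv_measure_spmf)
  then show "spmf ?out x = spmf (spmf_of_pmf \<pi>) x" using le[of x] by simp
qed

end

context ladder_potential
begin

definition U :: "state \<Rightarrow> ennreal" where
  "U s = (case s of Start S z \<Rightarrow> 1 + 2 * cost S z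
    | Testing S0 z0 st l j \<Rightarrow> 1 + ennreal (2 * A j) + ennreal (2 * B l j) * charge \<kappa> S0 z0 1 (\<lambda>_ _. 0) st
        + 2 * charge \<kappa> S0 z0 0 cost st)"

lemma macro_U: "ok n q s \<Longrightarrow> ennreal (1 + \<eta>) * val U (\<lambda>_. 1) (macro \<kappa> s) \<le> U s"
  unfolding U_def[abs_def]
  by (rule macro_potential_exp) (use cost_half \<eta> B_pos B_Suc A_ge A_Suc cost_start in auto)

lemma U_ge_1: "1 \<le> U s"
  unfolding U_def by (cases s) (auto intro: order_trans[OF _ add_increasing2] simp: add_increasing2 add.assoc)

lemma U_initial: "val U (\<lambda>_. 1) initial \<le> 2"
proof -
  have "2 * cost {} (\<lambda>_. undefined) \<le> 2 * ennreal (1/2)"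
    using total_le[OF pos_empty] by (intro mult_left_mono) (auto simp: cost_def pos_empty intro!: ennreal_leI simp del: ennreal_half)
  also have "2 * ennreal (1/2) = ennreal (2 * (1/2))" by (subst ennreal_mult) auto
  finally have "1 + 2 * cost {} (\<lambda>_. undefined) \<le> 1 + 1" by (intro add_left_mono) simp
  then show ?thesis by (simp add: initial_def U_def)
qed

lemma rounds_tail:
  assumes "n \<ge> 1"
  shows "1 - 2 / (1 + \<eta>) ^ k \<le> measure (measure_spmf (run \<kappa> (algorithm_from initial))) {(x, r, m). r < 2 * k}"
proof -
  let ?F = "measure (measure_spmf (run \<kappa> (algorithm_from initial))) {(x, r, m). r < 2 * k}"
  have "ennreal (1 + \<eta>) ^ k * ennreal (1 - ?F) \<le> 2"
    using run_tail[OF macro_U U_ge_1 ok_initial[OF assms], of k] U_initial order_trans by blast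
  moreover have "?F \<le> 1" by (rule measure_spmf.subprob_measure_le_1)
  ultimately have "ennreal ((1 + \<eta>) ^ k * (1 - ?F)) \<le> ennreal 2"
    using \<eta> ennreal_power[of "1 + \<eta>" k] by (simp add: ennreal_mult del: ennreal_plus)
  then have "(1 + \<eta>) ^ k * (1 - ?F) \<le> 2" by (subst (asm) ennreal_le_iff) auto
  then show ?thesis using \<eta> by (simp add: field_simps)
qed

text \<open>The tail bound in the limit; runs that never stop were counted as slow.\<close>

lemma lossless:
  assumes "n \<ge> 1"
  shows "lossless_spmf (run \<kappa> (algorithm_from initial))"
proof -
  let ?w = "weight_spmf (run \<kappa> (algorithm_from initial))"
  have "1 - 2 / (1 + \<eta>) ^ k \<le> ?w" for k
    using rounds_tail[OF assms, of k] measure_spmf.bounded_measure[of "run \<kappa> (algorithm_from initial)"]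
    by (fastforce simp: weight_spmf_def intro: order_trans)
  moreover have "(\<lambda>k. 1 - 2 * inverse (1 + \<eta>) ^ k) \<longlonglongrightarrow> 1 - 2 * 0"
    using \<eta> by (intro tendsto_intros LIMSEQ_power_zero) (simp add: inverse_less_1_iff)
  then have "(\<lambda>k. 1 - 2 / (1 + \<eta>) ^ k) \<longlonglongrightarrow> 1" by (simp add: divide_inverse power_inverse)
  ultimately have "1 \<le> ?w" by (intro LIMSEQ_le_const2) auto
  then show ?thesis unfolding lossless_spmf_def using weight_spmf_le_1 order_antisym by blast
qed

text \<open>\<open>U \<ge> 1\<close> turns the factor \<open>1 + \<eta>\<close> into an additive
  drift of at least \<open>\<eta>\<close>; scaled by \<open>2 / \<eta>\<close> it pays the two
  rounds of a macro step. As \<open>U\<close> starts at 2 at most, the result is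
  \<open>4 / \<eta>\<close>.\<close>

lemma expected_rounds_le:
  assumes "n \<ge> 1"
  shows "expected_rounds \<kappa> (algorithm_from initial) \<le> ennreal (4 / \<eta>)"
proof -
  define V where "V s = ennreal (2 / \<eta>) * U s" for s
  have eq: "ennreal (2 / \<eta>) * ennreal \<eta> = 2" using \<eta> by (simp flip: ennreal_mult)
  have "(\<integral>\<^sup>+(x, r, m). 0 + 1 * of_nat r + 0 * of_nat m \<partial>measure_spmf (run \<kappa> (algorithm_from initial))) \<le> val V (\<lambda>_. 0) initial"
  proof (rule run_potential[where queries = queries])
    show "2 * 1 + 0 * of_nat (queries s) + val V (\<lambda>_. 0) (macro \<kappa> s) \<le> V s" if s: "ok n q s" for s
    proof -
      let ?u = "val U (\<lambda>_. 1) (macro \<kappa> s)"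
      have "1 = (\<integral>\<^sup>+r. 1 \<partial>macro \<kappa> s)" by simp
      also have "\<dots> \<le> ?u" using U_ge_1 by (intro nn_integral_mono) (auto split: sum.split)
      finally have "ennreal \<eta> * 1 \<le> ennreal \<eta> * ?u" by (rule mult_left_mono) simp
      have "val V (\<lambda>_. 0) (macro \<kappa> s) \<le> (\<integral>\<^sup>+r. ennreal (2 / \<eta>) * (case r of Inl s \<Rightarrow> U s | Inr x \<Rightarrow> 1) \<partial>macro \<kappa> s)"
        by (intro nn_integral_mono) (auto simp: V_def split: sum.split)
      also have "\<dots> = ennreal (2 / \<eta>) * ?u" by (rule nn_integral_cmult) simp
      finally have "2 + val V (\<lambda>_. 0) (macro \<kappa> s) \<le> ennreal (2 / \<eta>) * (ennreal \<eta> * 1) + ennreal (2 / \<eta>) * ?u"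
        using eq by (simp add: add_left_mono)
      also have "\<dots> \<le> ennreal (2 / \<eta>) * (ennreal \<eta> * ?u) + ennreal (2 / \<eta>) * ?u"
        by (intro add_right_mono mult_left_mono \<open>ennreal \<eta> * 1 \<le> ennreal \<eta> * ?u\<close>) simp
      also have "\<dots> = ennreal (2 / \<eta>) * (ennreal (1 + \<eta>) * ?u)"
        using \<eta> by (simp add: ennreal_plus distrib_left distrib_right add_ac)
      also have "\<dots> \<le> V s" unfolding V_def by (intro mult_left_mono macro_U s) simp
      finally show ?thesis by simp
    qed
  qed (use length_queries ok_initial[OF assms] in auto)
  also have "val V (\<lambda>_. 0) initial \<le> ennreal (2 / \<eta>) * 2"
    using U_initial by (simp add: initial_def V_def mult_left_mono)
  also have "\<dots> = ennreal (4 / \<eta>)" using \<eta> ennreal_mult[of "2 / \<eta>" 2] by simp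
  finally show ?thesis by (simp add: expected_rounds_def)
qed

end

section \<open>Choice of the parameters\<close>

lemma one_plus_power_le:
  assumes "0 \<le> \<eta>" "\<eta> * real m \<le> 1"
  shows "(1 + \<eta>) ^ m \<le> 1 + 2 * (\<eta> * real m)"
proof -
  have "(1 + \<eta>) ^ m \<le> exp \<eta> ^ m" using assms(1) by (intro power_mono exp_ge_add_one_self) auto
  also have "\<dots> = exp (\<eta> * real m)" by (simp add: exp_of_nat_mult[symmetric] mult.commute)
  also have "\<dots> \<le> 1 + \<eta> * real m + (\<eta> * real m)\<^sup>2" using assms by (intro exp_bound) auto
  also have "(\<eta> * real m)\<^sup>2 \<le> \<eta> * real m * 1"
    unfolding power2_eq_square using assms by (intro mult_left_mono) auto
  finally show ?thesis by simp
qed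

lemma ln2_ge: "1 / 2 \<le> ln (2 :: real)"
proof -
  have "exp (1 / 2 :: real) \<le> 1 + 1 / 2 + (1 / 2)\<^sup>2" by (intro exp_bound) auto
  then have "exp (1 / 2 :: real) \<le> 2" by (simp add: power2_eq_square)
  then have "ln (exp (1 / 2 :: real)) \<le> ln 2" by (subst ln_le_cancel_iff) auto
  then show ?thesis by simp
qed

locale parameters =
  fixes n q h :: nat
  assumes h: "h \<ge> 1" and hn: "h ^ (2 * h) \<le> n" and q2: "q \<ge> 2"
begin

definition x where "x = real n powr (1 / (2 * real h))"
definition b where "b = nat \<lfloor>x\<rfloor>"
definition L where "L = tlog (real n)"
definition s where "s = sqrt (ln (real q))"
definition R where "R = x ^ (h + 1) * real h ^ 2 * L * s"
text \<open>The three items of \<open>budget\<close> amount to 10, 72 and 12 parts in 200, which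
  stays within the allowed half.\<close>

definition \<eta> where "\<eta> = 1 / (200 * R)"
text \<open>With \<open>2 ^ J \<ge> n\<close> the term \<open>\<beta> * n\<close> is of order
  \<open>\<eta>\<close>, while the prepaid batches number only \<open>O(L)\<close>.\<close>

definition J where "J = nat \<lceil>log 2 (real n)\<rceil>"
text \<open>Balances \<open>\<alpha> * n / b ^ k\<close> against
  \<open>b ^ k * ln q / \<alpha>\<close>: both become \<open>s * x ^ h\<close>, where
  \<open>x ^ h\<close> is the square root of \<open>n\<close>.\<close>

definition \<alpha> where "\<alpha> k = real (b ^ k) * s / x ^ h" for k :: nat
definition K where "K = \<eta> * real ((h - 1) * b) + ((1 + \<eta>) ^ Suc J - 1)"
definition \<beta> where "\<beta> = 2 * \<eta> * (1 + \<eta>) ^ J / 2 ^ J"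

lemma n1: "n \<ge> 1"
  using hn h by (metis One_nat_def Suc_le_eq less_le_trans zero_less_power le_trans)

lemma xn: "x ^ (2 * h) = real n"
proof -
  have "x > 0" using n1 by (simp add: x_def)
  then have "x ^ (2 * h) = x powr real (2 * h)" by (simp only: powr_realpow)
  also have "\<dots> = real n" using h n1 by (simp add: x_def powr_powr)
  finally show ?thesis .
qed

lemma xh: "x ^ (h + 1) = real n powr (1 / 2 + 1 / (2 * real h))"
proof -
  have "x ^ (h + 1) = x powr real (h + 1)" using n1 by (subst powr_realpow) (auto simp: x_def)
  also have "\<dots> = real n powr (1 / (2 * real h) * real (h + 1))" by (simp add: x_def powr_powr)
  also have "1 / (2 * real h) * real (h + 1) = 1 / 2 + 1 / (2 * real h)" using h by (simp add: field_simps)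
  finally show ?thesis .
qed

lemma x_ge: "real h \<le> x"
proof -
  have "real h ^ (2 * h) \<le> x ^ (2 * h)" unfolding xn using hn by (metis of_nat_le_iff of_nat_power)
  then show ?thesis using h by (subst (asm) power_mono_iff) (auto simp: x_def)
qed

lemma x1: "1 \<le> x"
  using x_ge h by linarith

lemma b: "real b \<le> x" "x < real b + 1" "h \<le> b" "1 \<le> b"
proof -
  have "real b = of_int \<lfloor>x\<rfloor>" using x1 by (simp add: b_def)
  then show "real b \<le> x" "x < real b + 1" by (simp_all)
  show "h \<le> b" using x_ge by (simp add: b_def le_nat_floor)
  then show "1 \<le> b" using h by simp
qed

lemma L1: "1 \<le> L"
  by (simp add: L_def tlog_def)

lemma s_ge: "1 / 2 \<le> s"
proof -
  have "ln (2 :: real) \<le> ln (real q)" using q2 by simp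
  then have "(1 / 2)\<^sup>2 \<le> ln (real q)" using ln2_ge by (simp add: power2_eq_square)
  then show ?thesis unfolding s_def by (rule real_le_rsqrt)
qed

lemma s2: "s * s = ln (real q)"
  using q2 by (simp add: s_def)

lemma R_ge: "x ^ (h + 1) \<le> 2 * R" "L \<le> 2 * R" "1 \<le> 2 * R"
proof -
  have X: "1 \<le> x ^ (h + 1)" using x1 by (rule one_le_power)
  have H: "1 \<le> real h ^ 2" using h by (intro one_le_power) simp
  have S: "1 \<le> 2 * s" using s_ge by simp
  have eq: "2 * R = x ^ (h + 1) * (real h ^ 2 * L * (2 * s))" "2 * R = L * (x ^ (h + 1) * real h ^ 2 * (2 * s))"
    by (simp_all add: R_def)
  have "1 * 1 * 1 \<le> real h ^ 2 * L * (2 * s)" using H L1 S by (intro mult_mono) auto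
  then have "x ^ (h + 1) * 1 \<le> 2 * R" unfolding eq(1) using X by (intro mult_left_mono) auto
  then show "x ^ (h + 1) \<le> 2 * R" by simp
  with X show "1 \<le> 2 * R" by simp
  have "1 * 1 * 1 \<le> x ^ (h + 1) * real h ^ 2 * (2 * s)" using H X S by (intro mult_mono) auto
  then have "L * 1 \<le> 2 * R" unfolding eq(2) using L1 by (intro mult_left_mono) auto
  then show "L \<le> 2 * R" by simp
qed

lemma \<eta>: "0 < \<eta>" "\<eta> \<le> 1 / 100" "\<eta> * R = 1 / 200"
  using R_ge(3) by (auto simp: \<eta>_def field_simps)

lemma J: "real n \<le> 2 ^ J" "real J + 1 \<le> 4 * L"
proof -
  have l0: "0 \<le> log 2 (real n)" using n1 by simp
  have "real n = 2 powr (log 2 (real n))" using n1 by simp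
  also have "\<dots> \<le> 2 powr (real J)" using l0 unfolding J_def by (intro powr_mono) auto
  finally show "real n \<le> 2 ^ J" by (simp add: powr_realpow)
  have "real J \<le> log 2 (real n) + 1" unfolding J_def using l0 by linarith
  also have "log 2 (real n) \<le> ln (real n) / (1 / 2)"
    unfolding log_def using n1 ln2_ge by (intro divide_left_mono) auto
  also have "ln (real n) \<le> L" by (simp add: L_def tlog_def)
  finally show "real J + 1 \<le> 4 * L" using L1 by simp
qed

lemma \<eta>J: "\<eta> * real (Suc J) \<le> 1"
proof -
  have "\<eta> * real (Suc J) \<le> \<eta> * (8 * R)" using \<eta> J(2) R_ge(2) by (intro mult_left_mono) auto
  then show ?thesis using \<eta>(3) by simp
qed

text \<open>A climb of length at most \<open>h * x\<close> and \<open>O(L)\<close> prepaid batches,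
  bounded crudely by the product since both quantities are at least 1.\<close>

lemma K_le: "0 \<le> K" "K \<le> 9 * \<eta> * real h * x * L"
proof -
  have p: "1 \<le> (1 + \<eta>) ^ Suc J" using \<eta> by (intro one_le_power) simp
  then show "0 \<le> K" using \<eta> by (simp add: K_def)
  have "(1 + \<eta>) ^ Suc J - 1 \<le> 2 * (\<eta> * real (Suc J))"
    using one_plus_power_le[of \<eta> "Suc J"] \<eta> \<eta>J by simp
  also have "\<dots> \<le> 2 * (\<eta> * (4 * L))" using \<eta> J(2) by (intro mult_left_mono) auto
  also have "\<dots> \<le> 8 * \<eta> * L * (real h * x)"
  proof -
    have "1 * 1 \<le> real h * x" using h x1 by (intro mult_mono) auto
    then have "8 * \<eta> * L * 1 \<le> 8 * \<eta> * L * (real h * x)" using \<eta> L1 by (intro mult_left_mono) auto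
    then show ?thesis by simp
  qed
  finally have 1: "(1 + \<eta>) ^ Suc J - 1 \<le> 8 * \<eta> * L * (real h * x)" .
  have "\<eta> * real ((h - 1) * b) \<le> \<eta> * (real h * x)"
    unfolding of_nat_mult using \<eta> b(1) x1 by (intro mult_left_mono mult_mono) auto
  also have "\<dots> = \<eta> * (real h * x) * 1" by simp
  also have "\<dots> \<le> \<eta> * (real h * x) * L" using \<eta> L1 x1 by (intro mult_left_mono) auto
  finally show "K \<le> 9 * \<eta> * real h * x * L" unfolding K_def using 1 by (simp add: mult_ac)
qed

text \<open>Rounding \<open>x\<close> down to \<open>b\<close> costs
  \<open>(x / b) ^ (h - 1) \<le> (1 + 1 / b) ^ (h - 1)\<close>, at most \<open>exp 1\<close> because
  \<open>h \<le> b\<close>, which comes from \<open>h ^ (2 * h) \<le> n\<close>.\<close>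

lemma top_blocks: "real (n div b ^ (h - 1)) \<le> 3 * x ^ (h + 1)"
proof -
  have bp: "real b > 0" using b(4) by simp
  have "(x / real b) ^ (h - 1) \<le> exp 1"
  proof -
    have "x / real b \<le> 1 + 1 / real b" using b(2) bp by (simp add: field_simps)
    also have "\<dots> \<le> exp (1 / real b)" by (rule exp_ge_add_one_self)
    finally have "(x / real b) ^ (h - 1) \<le> exp (1 / real b) ^ (h - 1)" using x1 by (intro power_mono) auto
    also have "\<dots> = exp (real (h - 1) * (1 / real b))" by (rule exp_of_nat_mult[symmetric])
    also have "\<dots> \<le> exp 1" using b(3) bp by (simp add: field_simps)
    finally show ?thesis .
  qed
  also have "exp 1 \<le> (3 :: real)" by (rule exp_le)
  finally have r: "(x / real b) ^ (h - 1) \<le> 3" .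
  have "real (n div b ^ (h - 1)) \<le> real n / real (b ^ (h - 1))" by (rule of_nat_div_le_of_nat)
  also have "real n = x ^ (h + 1) * x ^ (h - 1)"
  proof -
    have "2 * h = h + 1 + (h - 1)" using h by simp
    then show ?thesis by (metis xn power_add)
  qed
  also have "\<dots> / real (b ^ (h - 1)) = x ^ (h + 1) * (x / real b) ^ (h - 1)" by (simp add: power_divide)
  also have "\<dots> \<le> x ^ (h + 1) * 3" using r x1 by (intro mult_left_mono) auto
  finally show ?thesis by simp
qed

lemma block_le: "k < h \<Longrightarrow> b ^ k \<le> n"
proof -
  assume "k < h"
  have "real (b ^ k) \<le> x ^ k" unfolding of_nat_power using b(1) by (intro power_mono) auto
  also have "\<dots> \<le> x ^ (2 * h)" using x1 \<open>k < h\<close> by (intro power_increasing) auto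
  finally show ?thesis unfolding xn by simp
qed

lemma \<alpha>_pos: "0 < \<alpha> k"
  using b(4) s_ge x1 by (simp add: \<alpha>_def)

lemma level_cost:
  assumes "k < h"
  shows "\<alpha> k * real (n div b ^ k + 1) + 6 / \<alpha> k * (real (b ^ k) * ln (real q)) \<le> 8 * s * x ^ h"
proof -
  let ?l = "real (b ^ k)"
  have l: "?l > 0" using b(4) by simp
  have xp: "x ^ h > 0" using x1 by simp
  have sp: "s > 0" using s_ge by simp
  have xx: "real n = x ^ h * x ^ h" by (simp add: xn[symmetric] mult_2 power_add)
  have "real (n div b ^ k + 1) \<le> real n / ?l + 1" using of_nat_div_le_of_nat[of n "b ^ k"] by simp
  also have "\<dots> \<le> 2 * (real n / ?l)" using block_le[OF assms] l by (simp add: field_simps flip: of_nat_power)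
  finally have "\<alpha> k * real (n div b ^ k + 1) \<le> \<alpha> k * (2 * (real n / ?l))"
    using \<alpha>_pos[of k] by (intro mult_left_mono) auto
  also have "\<dots> = 2 * s * x ^ h"
  proof -
    have "l * s / y * (2 * (y * y / l)) = 2 * s * y" if "l > 0" "y > 0" for l y :: real
      using that by (simp add: field_simps)
    from this[OF l xp] show ?thesis unfolding \<alpha>_def xx .
  qed
  finally have 1: "\<alpha> k * real (n div b ^ k + 1) \<le> 2 * s * x ^ h" .
  have "6 / \<alpha> k * (?l * ln (real q)) = 6 * s * x ^ h"
  proof -
    have "6 / (l * s / y) * (l * (s * s)) = 6 * s * y" if "l > 0" "y > 0" for l y :: real
      using that sp by (simp add: field_simps)
    from this[OF l xp] show ?thesis unfolding \<alpha>_def s2 .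
  qed
  with 1 show ?thesis by simp
qed

lemma budget: "\<eta> * real ((h - 1) * b + n div b ^ (h - 1) + 1)
      + (K * (\<Sum>k<h. \<alpha> k * real (n div b ^ k + 1) + 6 / \<alpha> k * (real (b ^ k) * ln (real q))) + \<beta> * real n) \<le> 1 / 2"
proof -
  have "real ((h - 1) * b) \<le> x ^ (h + 1)"
  proof -
    have "real ((h - 1) * b) \<le> x * x" unfolding of_nat_mult using b(1) x_ge h x1 by (intro mult_mono) auto
    also have "\<dots> \<le> x ^ (h + 1)" using x1 h power_increasing[of 2 "h + 1" x] by (simp add: power2_eq_square)
    finally show ?thesis .
  qed
  moreover have "1 \<le> x ^ (h + 1)" using x1 by (rule one_le_power)
  ultimately have "real ((h - 1) * b + n div b ^ (h - 1) + 1) \<le> 5 * x ^ (h + 1)"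
    using top_blocks by simp
  also have "\<dots> \<le> 10 * R" using R_ge(1) by simp
  finally have "\<eta> * real ((h - 1) * b + n div b ^ (h - 1) + 1) \<le> \<eta> * (10 * R)"
    using \<eta>(1) by (intro mult_left_mono) auto
  then have 1: "\<eta> * real ((h - 1) * b + n div b ^ (h - 1) + 1) \<le> 10 / 200" using \<eta>(3) by simp
  have "(\<Sum>k<h. \<alpha> k * real (n div b ^ k + 1) + 6 / \<alpha> k * (real (b ^ k) * ln (real q))) \<le> (\<Sum>k<h. 8 * s * x ^ h)"
    by (intro sum_mono level_cost) simp
  also have "\<dots> = real h * (8 * s * x ^ h)" by simp
  finally have "K * (\<Sum>k<h. \<alpha> k * real (n div b ^ k + 1) + 6 / \<alpha> k * (real (b ^ k) * ln (real q))) \<le>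
    K * (real h * (8 * s * x ^ h))" using K_le(1) by (rule mult_left_mono)
  also have "\<dots> \<le> (9 * \<eta> * real h * x * L) * (real h * (8 * s * x ^ h))"
    using K_le(2) s_ge x1 by (intro mult_right_mono) auto
  also have "\<dots> = 72 * (\<eta> * R)" by (simp add: R_def power2_eq_square)
  finally have 2: "K * (\<Sum>k<h. \<alpha> k * real (n div b ^ k + 1) + 6 / \<alpha> k * (real (b ^ k) * ln (real q))) \<le> 72 / 200"
    using \<eta>(3) by simp
  have "(1 + \<eta>) ^ J \<le> (1 + \<eta>) ^ Suc J" using \<eta>(1) by (intro power_increasing) auto
  also have "\<dots> \<le> 3" using one_plus_power_le[of \<eta> "Suc J"] \<eta> \<eta>J by simp
  finally have "\<beta> * real n \<le> 2 * \<eta> * 3 / 2 ^ J * 2 ^ J"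
    unfolding \<beta>_def using \<eta>(1) J(1) by (intro mult_mono divide_right_mono mult_left_mono) auto
  also have "\<dots> = 6 * (\<eta> * 1)" by simp
  also have "\<dots> \<le> 6 * (\<eta> * (2 * R))" using \<eta>(1) R_ge(3) by (intro mult_left_mono) auto
  finally have "\<beta> * real n \<le> 12 / 200" using \<eta>(3) by simp
  with 1 2 show ?thesis by simp
qed

text \<open>Defined before any target distribution or kernel is fixed, so that one algorithm serves
  all of them.\<close>

definition the_sampler :: algorithm where
  "the_sampler = sampling_machine.algorithm_from q (pick n (ladder.blk n b h)) samples checks (resume n) initial"

lemma ladder: "ladder b h"
  by unfold_locales (use b(4) h in auto)

lemma valid_the_sampler: "valid_algorithm n q the_sampler"
proof -
  interpret ladder n b h by (rule ladder)
  interpret sampler n q blk using q2 by (intro sampler) simp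
  show ?thesis unfolding the_sampler_def
    by (rule valid_algorithm_from) (use n1 in \<open>auto simp: initial_def ok_pmf_def configs_def\<close>)
qed

lemma the_sampler:
  assumes "distribution_on_configs n q \<pi>" "conditional_marginals n q \<pi> \<kappa>"
  shows "exact_sampler_for \<pi> \<kappa> the_sampler"
    and "expected_rounds \<kappa> the_sampler \<le> ennreal (800 * R)"
    and "expected_queries \<kappa> the_sampler \<le> ennreal (24 * (real n * real h))"
    and "1 - 2 / (1 + \<eta>) ^ k \<le> measure (measure_spmf (run \<kappa> the_sampler)) {(x, r, m). r < 2 * k}"
proof -
  interpret ladder n b h by (rule ladder)
  interpret ladder_potential n b h q \<pi> \<kappa> \<eta> J \<alpha> K \<beta>
  proof (intro ladder_potential.intro ladder_target.intro ladder target_sampler.intro sampler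
      target_sampler_axioms.intro ladder_potential_axioms.intro)
    show "1 \<le> q" using q2 by simp
  qed (use assms \<eta> \<alpha>_pos K_def \<beta>_def budget in auto)
  have A: "the_sampler = algorithm_from initial" by (simp add: the_sampler_def)
  show "exact_sampler_for \<pi> \<kappa> the_sampler" unfolding A by (intro exact_if_lossless lossless n1)
  have "4 / \<eta> = 800 * R" by (simp add: \<eta>_def)
  then show "expected_rounds \<kappa> the_sampler \<le> ennreal (800 * R)" unfolding A using expected_rounds_le[OF n1] by simp
  have "real (12 * (\<Sum>p\<in>{0..<n}. blk p)) \<le> real (24 * (n * h))"
    using sum_blk_le[OF block_le] by (intro of_nat_mono) (simp add: mult_ac)
  then have "real (12 * (\<Sum>p\<in>{0..<n}. blk p)) \<le> 24 * (real n * real h)"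
    by (simp only: of_nat_mult of_nat_numeral)
  from ennreal_leI[OF this] show "expected_queries \<kappa> the_sampler \<le> ennreal (24 * (real n * real h))"
    unfolding A ennreal_of_nat_eq_real_of_nat[symmetric] by (rule order_trans[OF expected_queries_le[OF n1]])
  show "1 - 2 / (1 + \<eta>) ^ k \<le> measure (measure_spmf (run \<kappa> the_sampler)) {(x, r, m). r < 2 * k}"
    unfolding A by (rule rounds_tail[OF n1])
qed

end

theorem theorem28:
  "\<exists>C::real. C > 0 \<and>
     (\<forall>(n::nat) (q::nat) (h::nat). h \<ge> 1 \<longrightarrow> h ^ (2 * h) \<le> n \<longrightarrow>
       (\<exists>A. valid_algorithm n q A \<and>
         (\<forall>\<pi> \<kappa>. distribution_on_configs n q \<pi> \<longrightarrow> conditional_marginals n q \<pi> \<kappa> \<longrightarrow>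
            exact_sampler_for \<pi> \<kappa> A \<and>
            expected_rounds \<kappa> A
              \<le> ennreal (C * (real n powr (1/2 + 1 / (2 * real h))
                   * real h ^ 2 * tlog (real n) * sqrt (ln (real q)))) \<and>
            expected_queries \<kappa> A \<le> ennreal (C * (real n * real h)) \<and>
            (\<forall>\<epsilon>::real. \<epsilon> > 0 \<longrightarrow>
               prob_rounds_le \<kappa> A
                 (C * (real n powr (1/2 + 1 / (2 * real h))
                    * (real h ^ 2 * tlog (real n) * sqrt (ln (real q))
                       + (4 * real h) ^ h * ln (real n / \<epsilon>) ^ h)
                    * tlog (1 / \<epsilon>)))
               \<ge> 1 - \<epsilon>))))"
  (is "\<exists>C. _ \<and> (\<forall>n q h. _ \<longrightarrow> _ \<longrightarrow> ?P C n q h)"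
   is "\<exists>C. _ \<and> (\<forall>n q h. _ \<longrightarrow> _ \<longrightarrow> (\<exists>A. _ \<and> (\<forall>\<pi> \<kappa>. _ \<longrightarrow> _ \<longrightarrow>
      _ \<and> _ \<le> ennreal (?rounds C n q h) \<and> _ \<and> (\<forall>\<epsilon>. _ \<longrightarrow> prob_rounds_le _ _ (?tail C n q h \<epsilon>) \<ge> _))))")
\<comment> \<open>For \<open>q \<ge> 2\<close> the expected rounds need 800. The tail uses half of
  3200, as macro steps have two rounds, and \<open>1600 * \<eta> * R = 8\<close>.\<close>
proof (intro exI[of _ 3200] conjI allI impI)
  fix n q h :: nat
  assume h: "h \<ge> 1" and hn: "h ^ (2 * h) \<le> n"
  have n1: "n \<ge> 1" using hn h by (metis One_nat_def Suc_le_eq less_le_trans zero_less_power le_trans)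
  have tail_trivial: "1 - \<epsilon> \<le> prob_rounds_le \<kappa> A c" if "\<epsilon> \<ge> 1" for \<epsilon> c :: real and \<kappa> A
  proof -
    have "1 - \<epsilon> \<le> 0" using that by simp
    then show ?thesis unfolding prob_rounds_le_def by (rule order_trans) simp
  qed
  show "?P 3200 n q h"
  \<comment> \<open>For \<open>q = 1\<close> the bound on the expected rounds is 0; with at most one
    letter only a point mass is possible, and it is output without a query.\<close>
  proof (cases "q \<ge> 2")
    case True
    interpret parameters n q h by unfold_locales (use h hn True in auto)
    have R: "R = real n powr (1/2 + 1 / (2 * real h)) * real h ^ 2 * tlog (real n) * sqrt (ln (real q))"
      unfolding R_def L_def s_def xh ..
    show ?thesis
    proof (intro exI[of _ the_sampler] conjI allI impI)
      show "valid_algorithm n q the_sampler" by (rule valid_the_sampler)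
    next
      fix \<pi> \<kappa> assume \<pi>: "distribution_on_configs n q \<pi>" "conditional_marginals n q \<pi> \<kappa>"
      note samp = the_sampler[OF \<pi>]
      show "exact_sampler_for \<pi> \<kappa> the_sampler" by (rule samp(1))
      show "expected_rounds \<kappa> the_sampler \<le> ennreal (?rounds 3200 n q h)"
        unfolding R[symmetric] by (rule order_trans[OF samp(2)]) (use R_ge(3) in \<open>simp add: ennreal_leI\<close>)
      show "expected_queries \<kappa> the_sampler \<le> ennreal (3200 * (real n * real h))"
        by (rule order_trans[OF samp(3)]) (simp add: ennreal_leI)
      fix \<epsilon> :: real assume \<epsilon>: "\<epsilon> > 0"
      show "prob_rounds_le \<kappa> the_sampler (?tail 3200 n q h \<epsilon>) \<ge> 1 - \<epsilon>"
      proof (cases "\<epsilon> < 1")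
        case e1: True
        define t where "t = tlog (1 / \<epsilon>)"
        have t: "1 \<le> t" "ln (1 / \<epsilon>) \<le> t" by (simp_all add: t_def tlog_def)
        have "1 \<le> real n / \<epsilon>" using n1 \<epsilon> e1 by (simp add: field_simps)
        then have "0 \<le> real n powr (1/2 + 1 / (2 * real h)) * ((4 * real h) ^ h * ln (real n / \<epsilon>) ^ h)"
          by simp
        then have "R \<le> real n powr (1/2 + 1 / (2 * real h))
            * (real h ^ 2 * tlog (real n) * sqrt (ln (real q)) + (4 * real h) ^ h * ln (real n / \<epsilon>) ^ h)"
          unfolding R by (simp add: distrib_left mult.assoc)
        then have bnd: "3200 * (R * t) \<le> ?tail 3200 n q h \<epsilon>"
          unfolding t_def[symmetric] using t by (intro mult_left_mono mult_right_mono) auto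
        define k where "k = nat \<lfloor>?tail 3200 n q h \<epsilon> / 2\<rfloor>"
        have "0 \<le> R * t" using R_ge(3) t by simp
        then have k: "real k \<le> ?tail 3200 n q h \<epsilon> / 2" "?tail 3200 n q h \<epsilon> / 2 - 1 \<le> real k"
          using bnd unfolding k_def by linarith+
        have "\<eta> * (3200 * (R * t) / 2 - 1) \<le> \<eta> * real k"
        proof (rule mult_left_mono)
          show "3200 * (R * t) / 2 - 1 \<le> real k" using bnd k(2) by linarith
        qed (use \<eta> in simp)
        moreover have "\<eta> * (3200 * (R * t) / 2 - 1) = 1600 * (\<eta> * R) * t - \<eta>"
          by (simp add: algebra_simps)
        moreover have "1600 * (\<eta> * R) * t = 8 * t" by (simp only: \<eta>(3))
        ultimately have kt: "8 * t - 1 \<le> \<eta> * real k" using \<eta>(2) by linarith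
        \<comment> \<open>\<open>ln (1 + \<eta>) \<ge> \<eta> / 2\<close> and
          \<open>\<eta> * k \<ge> 8 * t - 1\<close> give the exponent \<open>4 * t - 1/2\<close>,
          which is at least \<open>1 + t\<close> because \<open>t \<ge> 1\<close>.\<close>
        have "\<eta> * \<eta> \<le> \<eta> * (1 / 2)" using \<eta> by (intro mult_left_mono) auto
        moreover have "\<eta> - \<eta>\<^sup>2 \<le> ln (1 + \<eta>)" using \<eta> by (intro ln_one_plus_pos_lower_bound) auto
        ultimately have "\<eta> / 2 \<le> ln (1 + \<eta>)" unfolding power2_eq_square by linarith
        then have "real k * (\<eta> / 2) \<le> real k * ln (1 + \<eta>)" by (intro mult_left_mono) auto
        moreover have "ln (2 / \<epsilon>) \<le> 1 + t"
          using t(2) \<epsilon> ln_le_minus_one[of 2] by (simp add: ln_div)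
        ultimately have "ln (2 / \<epsilon>) \<le> real k * ln (1 + \<eta>)" using kt t(1) by (simp add: mult.commute)
        also have "\<dots> = ln ((1 + \<eta>) ^ k)" using \<eta> by (simp add: ln_realpow)
        finally have "2 / \<epsilon> \<le> (1 + \<eta>) ^ k" using \<eta> \<epsilon> by (subst (asm) ln_le_cancel_iff) auto
        then have "2 / (1 + \<eta>) ^ k \<le> \<epsilon>" using \<eta> \<epsilon> by (simp add: field_simps)
        then have "1 - \<epsilon> \<le> 1 - 2 / (1 + \<eta>) ^ k" by simp
        also note samp(4)[of k]
        also have "measure (measure_spmf (run \<kappa> the_sampler)) {(x, r, m). r < 2 * k} \<le>
            prob_rounds_le \<kappa> the_sampler (?tail 3200 n q h \<epsilon>)"
          unfolding prob_rounds_le_def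
        proof (rule measure_spmf.finite_measure_mono)
          have "real r \<le> c" if "real k \<le> c / 2" "r < 2 * k" for r c using that by linarith
          note r = this[OF k(1)]
          show "{(x, r, m). r < 2 * k} \<subseteq> {(x, r, m). real r \<le> ?tail 3200 n q h \<epsilon>}"
            by (clarify, rule r)
        qed simp
        finally show ?thesis .
      qed (use tail_trivial in simp)
    qed
  next
    case False
    define y where "y = restrict (\<lambda>_. 1 :: nat) {1..n}"
    define A where "A = Algorithm (return_pmf (Output y))"
    have run: "run \<kappa> A = return_spmf (y, 0, 0)" for \<kappa>
      by (subst run.simps) (simp add: A_def bind_return_pmf)
    show ?thesis
    proof (intro exI[of _ A] conjI allI impI)
      show "valid_algorithm n q A" unfolding A_def by (rule valid_algorithm.intros) simp
    next
      fix \<pi> \<kappa> assume \<pi>: "distribution_on_configs n q \<pi>"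
      have "X = y" if "X \<in> set_pmf \<pi>" for X
      proof -
        have X: "X \<in> {1..n} \<rightarrow>\<^sub>E {1..q}"
          using \<pi> that by (auto simp: distribution_on_configs_def configs_def)
        have q: "{1..q} \<subseteq> {1}" using False by auto
        have "X i = y i" for i
        proof (cases "i \<in> {1..n}")
          case True
          then have "X i \<in> {1}" using PiE_mem[OF X] q by blast
          then show ?thesis using True by (simp add: y_def)
        qed (use PiE_arb[OF X] in \<open>auto simp: y_def\<close>)
        then show ?thesis by blast
      qed
      then have "set_pmf \<pi> = {y}" using set_pmf_not_empty[of \<pi>] by blast
      then have "\<pi> = return_pmf y" by (rule set_pmf_subset_singleton[THEN iffD1, OF equalityD1])
      then show "exact_sampler_for \<pi> \<kappa> A" by (simp add: exact_sampler_for_def run)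
      show "expected_rounds \<kappa> A \<le> ennreal (?rounds 3200 n q h)"
        by (simp add: expected_rounds_def run measure_spmf_return_spmf nn_integral_return)
      show "expected_queries \<kappa> A \<le> ennreal (3200 * (real n * real h))"
        by (simp add: expected_queries_def run measure_spmf_return_spmf nn_integral_return)
      fix \<epsilon> :: real assume \<epsilon>: "\<epsilon> > 0"
      show "prob_rounds_le \<kappa> A (?tail 3200 n q h \<epsilon>) \<ge> 1 - \<epsilon>"
      proof (cases "\<epsilon> < 1")
        case e1: True
        have "1 \<le> real n / \<epsilon>" using n1 \<epsilon> e1 by (simp add: field_simps)
        moreover have "0 \<le> ln (real q)" by (cases "q = 0") auto
        ultimately have "0 \<le> ?tail 3200 n q h \<epsilon>" unfolding tlog_def
          by (intro mult_nonneg_nonneg add_nonneg_nonneg) auto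
        then show ?thesis using \<epsilon> by (simp add: prob_rounds_le_def run measure_spmf_return_spmf measure_return)
      qed (use tail_trivial in simp)
    qed
  qed
qed simp

end
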